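(* Let $\Lambda$ be a finite set, let $\tau:\Lambda^{\mathbb{N}_0}\to\Lambda^{\mathbb{N}_0}$ be a bi-permutative cellular automaton, and let $\mu$ be a shift-invariant Borel probability measure on $\Lambda^{\mathbb{N}_0}$ which is also $\tau$-invariant. Assume also that $h_{(\pi_\mu)_*\mu}(\sigma)=0$. Define a shift-invariant measure $\tilde\mu$ on $\{(A,a): A\subseteq\Lambda,\ a\in A\}^{\mathbb{N}_0}$ by requiring, for every cylinder, $$\tilde\mu\left([(A_0,a_0),\dots,(A_n,a_n)]\right)=\frac{(\pi_\mu)_*\mu([A_0,\dots,A_n])}{|A_0|\cdots|A_n|}.$$ Then: (i) $\varphi_\mu$ is a measure-theoretical isomorphism between the dynamical systems $(\Lambda^{\mathbb{N}_0},\sigma,\mu)$ and $(\{(A,a):A\subseteq\Lambda,\ a\in A\}^{\mathbb{N}_0},\sigma,\tilde\mu)$; in particular $(\varphi_\mu)_*\mu=\tilde\mu$. (ii) $((2^\Lambda)^{\mathbb{N}_0},\sigma,(\pi_\mu)_*\mu)$, with factor map $\pi_\mu$, is the Pinsker factor of $(\Lambda^{\mathbb{N}_0},\sigma,\mu)$. (iii) $\pi_\mu\circ\tau=\tau'\circ\pi_\mu$ $\mu$-almost-surely (in particular, the measure $(\pi_\mu)_*\mu$ on $(2^\Lambda)^{\mathbb{N}_0}$ is also invariant relative to $\tau'$). (iv) If $\mu$ is ergodic relative to the joint action of $\sigma$ and $\tau$, then there exists an integer $1\le k\le|\Lambda|$ so that all components of a point in $(2^\Lambda)^{\mathbb{N}_0}$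 are $(\pi_\mu)_*\mu$-almost-surely subsets of size $k$.
   Context: $\mathbb{N}_0$ is the set of non-negative integers; $\sigma$ denotes the left shift on any of the shift spaces involved; $2^\Lambda$ is the set of subsets of $\Lambda$; $[b_0,\dots,b_n]$ is the cylinder of points whose first $n+1$ coordinates are $b_0,\dots,b_n$; $h$ denotes measure-theoretical entropy. A bi-permutative cellular automaton is a map $\tau:\Lambda^{\mathbb{N}_0}\to\Lambda^{\mathbb{N}_0}$ of the form $(\tau(x))_i=r(x_i,x_{i+1})$ for some $r:\Lambda^2\to\Lambda$ such that for every fixed $a\in\Lambda$ both $r(\cdot,a)$ and $r(a,\cdot)$ are bijections of $\Lambda$. Let $\mathcal{B}$ be the Borel $\sigma$-algebra of $\Lambda^{\mathbb{N}_0}$ and $\mu_x^{\sigma^{-1}\mathcal{B}}$ the conditional probability of $\mu$ given $\sigma^{-1}\mathcal{B}$ at $x$. Put $\Lambda_{\mu,x}=\{a\in\Lambda:\mu_x^{\sigma^{-1}\mathcal{B}}(\{(a,x_1,x_2,\dots)\})>0\}$ (for $\mu$ as in the claim, $\mu_x^{\sigma^{-1}\mathcal B}$, viewed as a measure on $\Lambda$ through the coordinate at index zero, is $\mu$-almost-surely the uniform probability on $\Lambda_{\mu,x}$). The map $\pi_\mu:\Lambda^{\mathbb{N}_0}\to(2^\Lambda)^{\mathbb{N}_0}$ is the ($\mu$-almost-surely defined) shift-equivariant map with $(\pi_\mu(x))_0=\Lambda_{\mu,x}$, i.e. $(\pi_\mu(x))_i=\Lambda_{\mu,\sigma^i(x)}$.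 The map $\varphi_\mu:\Lambda^{\mathbb{N}_0}\to\{(A,a):A\subseteq\Lambda,a\in A\}^{\mathbb{N}_0}$ is defined $\mu$-almost-surely by $(\varphi_\mu(x))_i=((\pi_\mu(x))_i,x_i)$. The cellular automaton $\tau':(2^\Lambda)^{\mathbb{N}_0}\to(2^\Lambda)^{\mathbb{N}_0}$ is $(\tau'(A_0,A_1,\dots))_i=\{(\tau(a_0,a_1,\dots))_i: a_j\in A_j\ \text{for all } j\}$. The Pinsker factor being given by $\pi_\mu$ means that the Pinsker $\sigma$-algebra of $(\Lambda^{\mathbb{N}_0},\sigma,\mu)$ equals, modulo $\mu$-null sets, the preimage under $\pi_\mu$ of the Borel $\sigma$-algebra of $(2^\Lambda)^{\mathbb{N}_0}$. *)

theory Defs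
  imports "HOL-Probability.Probability"
begin

section \<open>Shift spaces\<close>

text \<open>For a countable (in particular a finite) alphabet the product \<open>\<sigma>\<close>-algebra below is the Borel
  \<open>\<sigma>\<close>-algebra of the product of discrete topologies (\<open>sets_seq_space_eq_borel\<close>).\<close>

definition seq_space :: "'b set \<Rightarrow> (nat \<Rightarrow> 'b) measure" where
  "seq_space S = (\<Pi>\<^sub>M i\<in>UNIV. count_space S)"

definition shift :: "(nat \<Rightarrow> 'b) \<Rightarrow> nat \<Rightarrow> 'b" where
  "shift x = (\<lambda>i. x (Suc i))"

lemma space_seq_space: "space (seq_space S) = UNIV \<rightarrow> S"
  by (auto simp: seq_space_def space_PiM PiE_def)

lemma sets_seq_space_eq_borel:
  fixes S :: "'b set"
  assumes S: "countable S"
  shows "sets (seq_space S) =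
    sigma_sets (UNIV \<rightarrow> S) {U. openin (product_topology (\<lambda>_::nat. discrete_topology S) UNIV) U}"
    (is "_ = sigma_sets _ ?O")
proof
  let ?T = "product_topology (\<lambda>_::nat. discrete_topology S) UNIV"
  have top: "topspace ?T = UNIV \<rightarrow> S"
    by (auto simp: PiE_def)
  have Osub: "?O \<subseteq> Pow (UNIV \<rightarrow> S)"
    using top openin_subset[of ?T] by blast
  show "sets (seq_space S) \<subseteq> sigma_sets (UNIV \<rightarrow> S) ?O"
    unfolding seq_space_def
  proof (subst sets_PiM_single, unfold space_count_space PiE_UNIV_domain, rule sigma_sets_mono, safe)
    fix A :: "'b set" and i :: nat assume A: "A \<in> sets (count_space S)"
    have "{f \<in> UNIV \<rightarrow> S. f i \<in> A} = {f \<in> topspace ?T. f i \<in> A}"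
      unfolding top ..
    moreover have "openin ?T {f \<in> topspace ?T. f i \<in> A}"
      using A by (intro openin_continuous_map_preimage[where Y = "discrete_topology S"]
          continuous_map_product_projection) auto
    ultimately show "{f \<in> UNIV \<rightarrow> S. f i \<in> A} \<in> sigma_sets (UNIV \<rightarrow> S) ?O"
      by (intro sigma_sets.Basic) auto
  qed
  have fin: "Pi\<^sub>E UNIV X \<in> sets (seq_space S)"
    if X: "\<And>i. X i \<subseteq> S" "finite {i. X i \<noteq> S}" for X :: "nat \<Rightarrow> 'b set"
    unfolding seq_space_def using X by (intro sets_PiM_I_countable) auto
  show "sigma_sets (UNIV \<rightarrow> S) ?O \<subseteq> sets (seq_space S)"
  proof -
    have "?O \<subseteq> sets (seq_space S)"
    proof safe
      fix U assume U: "openin ?T U"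
      define \<C> where "\<C> = (\<lambda>l :: 'b list. {f \<in> UNIV \<rightarrow> S. \<forall>i<length l. f i = l ! i}) ` lists S"
      have cC: "countable \<C>"
        unfolding \<C>_def using S by (intro countable_image countable_lists)
      have CM: "C \<in> sets (seq_space S)" if C: "C \<in> \<C>" for C
      proof -
        obtain l where l: "l \<in> lists S" "C = {f \<in> UNIV \<rightarrow> S. \<forall>i<length l. f i = l ! i}"
          using C by (auto simp: \<C>_def)
        have "C = Pi\<^sub>E UNIV (\<lambda>i. if i < length l then {l ! i} else S)"
        proof (intro equalityI subsetI)
          fix g assume "g \<in> C"
          then show "g \<in> Pi\<^sub>E UNIV (\<lambda>i. if i < length l then {l ! i} else S)"
            using l by (auto simp: PiE_def)
        next
          fix g assume g: "g \<in> Pi\<^sub>E UNIV (\<lambda>i. if i < length l then {l ! i} else S)"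
          have gi: "g i \<in> (if i < length l then {l ! i} else S)" for i
            using g by (simp add: PiE_iff)
          have "g i \<in> S" for i
            using gi[of i] l(1) nth_mem[of i l] by (cases "i < length l") (auto simp: in_lists_conv_set)
          moreover have "g i = l ! i" if "i < length l" for i
            using gi[of i] that by simp
          ultimately show "g \<in> C"
            unfolding l(2) by auto
        qed
        also have "\<dots> \<in> sets (seq_space S)"
          using l by (intro fin) (auto simp: in_lists_conv_set intro: finite_subset[of _ "{..<length l}"])
        finally show ?thesis .
      qed
      have "U = \<Union> {C \<in> \<C>. C \<subseteq> U}"
      proof (intro equalityI subsetI)
        fix f assume f: "f \<in> U"
        from U f obtain X where X: "finite {i. X i \<noteq> S}" "\<And>i. X i \<subseteq> S"
          "f \<in> Pi\<^sub>E UNIV X" "Pi\<^sub>E UNIV X \<subseteq> U"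
          by (auto simp: openin_product_topology_alt)
        obtain n where n: "\<And>i. X i \<noteq> S \<Longrightarrow> i < n"
          using X(1) finite_nat_set_iff_bounded by auto
        define l where "l = map f [0..<n]"
        have fS: "f i \<in> S" for i
          using X(2)[of i] X(3) by (auto simp: PiE_def)
        have "{g \<in> UNIV \<rightarrow> S. \<forall>i<length l. g i = l ! i} \<subseteq> Pi\<^sub>E UNIV X"
        proof
          fix g assume g: "g \<in> {g \<in> UNIV \<rightarrow> S. \<forall>i<length l. g i = l ! i}"
          have "g i \<in> X i" for i
          proof (cases "i < n")
            case True
            then have "g i = f i" using g by (auto simp: l_def)
            then show ?thesis using X(3) by (auto simp: PiE_def)
          next
            case False
            then have "X i = S" using n by blast
            then show ?thesis using g by auto
          qed
          then show "g \<in> Pi\<^sub>E UNIV X" by (auto simp: PiE_def)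
        qed
        moreover have "l \<in> lists S"
          using fS by (auto simp: l_def)
        ultimately have "{g \<in> UNIV \<rightarrow> S. \<forall>i<length l. g i = l ! i} \<in> {C \<in> \<C>. C \<subseteq> U}"
          using X(4) unfolding \<C>_def by blast
        moreover have "f \<in> {g \<in> UNIV \<rightarrow> S. \<forall>i<length l. g i = l ! i}"
          using fS by (auto simp: l_def)
        ultimately show "f \<in> \<Union> {C \<in> \<C>. C \<subseteq> U}" by blast
      qed auto
      also have "\<dots> \<in> sets (seq_space S)"
        using cC CM by (intro sets.countable_Union) (auto intro: countable_subset[of _ \<C>])
      finally show "U \<in> sets (seq_space S)" .
    qed
    then have "sigma_sets (space (seq_space S)) ?O \<subseteq> sets (seq_space S)"
      by (rule sets.sigma_sets_subset)
    then show ?thesis by (simp add: space_seq_space)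
  qed
qed


section \<open>Measure preserving systems, entropy and the Pinsker factor\<close>

definition measure_preserving_system :: "'x measure \<Rightarrow> ('x \<Rightarrow> 'x) \<Rightarrow> bool" where
  "measure_preserving_system M T \<longleftrightarrow> prob_space M \<and> T \<in> measurable M M \<and> distr M M T = M"

text \<open>\<open>0 ln 0 = 0\<close> because \<open>ln 0 = 0\<close>; empty atoms are therefore harmless below.\<close>

definition static_entropy :: "'x measure \<Rightarrow> 'x set set \<Rightarrow> real" where
  "static_entropy M P = - (\<Sum>A\<in>P. measure M A * ln (measure M A))"

definition finite_measurable_partition :: "'x measure \<Rightarrow> 'x set set \<Rightarrow> bool" where
  "finite_measurable_partition M P \<longleftrightarrow>
     finite P \<and> P \<subseteq> sets M \<and> disjoint P \<and> \<Union>P = space M"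

text \<open>The common refinement of \<open>P, T\<^sup>-\<^sup>1 P, \<dots>, T\<^sup>-\<^sup>(\<^sup>n\<^sup>-\<^sup>1\<^sup>) P\<close>.\<close>

definition refined_partition ::
  "'x measure \<Rightarrow> ('x \<Rightarrow> 'x) \<Rightarrow> 'x set set \<Rightarrow> nat \<Rightarrow> 'x set set" where
  "refined_partition M T P n =
     {{x \<in> space M. \<forall>i<n. (T ^^ i) x \<in> f i} | f. \<forall>i<n. f i \<in> P}"

definition partition_entropy :: "'x measure \<Rightarrow> ('x \<Rightarrow> 'x) \<Rightarrow> 'x set set \<Rightarrow> real" where
  "partition_entropy M T P = lim (\<lambda>n. static_entropy M (refined_partition M T P n) / real n)"

definition mt_entropy :: "'x measure \<Rightarrow> ('x \<Rightarrow> 'x) \<Rightarrow> ereal" where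
  "mt_entropy M T = (SUP P \<in> {P. finite_measurable_partition M P}. ereal (partition_entropy M T P))"

definition pinsker_algebra :: "'x measure \<Rightarrow> ('x \<Rightarrow> 'x) \<Rightarrow> 'x set set" where
  "pinsker_algebra M T = {A \<in> sets M. partition_entropy M T {A, space M - A} = 0}"

definition eq_mod_null :: "'x measure \<Rightarrow> 'x set set \<Rightarrow> 'x set set \<Rightarrow> bool" where
  "eq_mod_null M \<A> \<B> \<longleftrightarrow>
     (\<forall>A\<in>\<A>. \<exists>B\<in>\<B>. sym_diff A B \<in> null_sets M) \<and>
     (\<forall>B\<in>\<B>. \<exists>A\<in>\<A>. sym_diff A B \<in> null_sets M)"

definition factor_map ::
  "'x measure \<Rightarrow> ('x \<Rightarrow> 'x) \<Rightarrow> 'y measure \<Rightarrow> ('y \<Rightarrow> 'y) \<Rightarrow> ('x \<Rightarrow> 'y) \<Rightarrow> bool" where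
  "factor_map M T N S f \<longleftrightarrow>
     measure_preserving_system M T \<and> measure_preserving_system N S \<and>
     f \<in> measurable M N \<and> distr M N f = N \<and> (AE x in M. f (T x) = S (f x))"

definition pinsker_factor ::
  "'x measure \<Rightarrow> ('x \<Rightarrow> 'x) \<Rightarrow> 'y measure \<Rightarrow> ('y \<Rightarrow> 'y) \<Rightarrow> ('x \<Rightarrow> 'y) \<Rightarrow> bool" where
  "pinsker_factor M T N S f \<longleftrightarrow>
     factor_map M T N S f \<and>
     eq_mod_null M (pinsker_algebra M T) (sets (vimage_algebra (space M) f N))"

text \<open>The map \<open>f\<close> only matters on the conull set \<open>X\<close>; outside it may leave \<open>space N\<close>.\<close>

definition mt_isomorphism ::
  "'x measure \<Rightarrow> ('x \<Rightarrow> 'x) \<Rightarrow> 'y measure \<Rightarrow> ('y \<Rightarrow> 'y) \<Rightarrow> ('x \<Rightarrow> 'y) \<Rightarrow> bool" where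
  "mt_isomorphism M T N S f \<longleftrightarrow>
     measure_preserving_system M T \<and> measure_preserving_system N S \<and>
     (\<exists>X\<in>sets M. \<exists>Y\<in>sets N.
        space M - X \<in> null_sets M \<and> space N - Y \<in> null_sets N \<and>
        T ` X \<subseteq> X \<and> S ` Y \<subseteq> Y \<and> bij_betw f X Y \<and>
        f \<in> measurable (restrict_space M X) (restrict_space N Y) \<and>
        the_inv_into X f \<in> measurable (restrict_space N Y) (restrict_space M X) \<and>
        distr (restrict_space M X) (restrict_space N Y) f = restrict_space N Y \<and>
        (\<forall>x\<in>X. f (T x) = S (f x)))"

definition jointly_ergodic :: "'x measure \<Rightarrow> ('x \<Rightarrow> 'x) \<Rightarrow> ('x \<Rightarrow> 'x) \<Rightarrow> bool" where
  "jointly_ergodic M S T \<longleftrightarrow>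
     (\<forall>A\<in>sets M. S -` A \<inter> space M = A \<and> T -` A \<inter> space M = A \<longrightarrow>
        measure M A = 0 \<or> measure M A = 1)"


section \<open>Conditional probabilities\<close>

definition conditional_probability ::
  "'x measure \<Rightarrow> 'x measure \<Rightarrow> ('x \<Rightarrow> 'x measure) \<Rightarrow> bool" where
  "conditional_probability M F \<kappa> \<longleftrightarrow>
     subalgebra M F \<and> \<kappa> \<in> measurable F (prob_algebra M) \<and>
     (\<forall>E\<in>sets M. AE x in M. measure (\<kappa> x) E = real_cond_exp M F (indicator E) x)"

abbreviation shift_preimage_algebra :: "(nat \<Rightarrow> 'b) measure \<Rightarrow> (nat \<Rightarrow> 'b) measure" where
  "shift_preimage_algebra M \<equiv> vimage_algebra (space M) shift M"


lemma conditional_probability_exists: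
  fixes \<mu> :: "(nat \<Rightarrow> 'a::finite) measure"
  assumes P: "prob_space \<mu>" and sets_\<mu>: "sets \<mu> = sets (seq_space UNIV)"
  shows "\<exists>\<kappa>. conditional_probability \<mu> (shift_preimage_algebra \<mu>) \<kappa>"
proof -
  interpret P: prob_space \<mu> by fact
  define F where "F = shift_preimage_algebra \<mu>"
  have sp: "space \<mu> = UNIV"
    using sets_eq_imp_space_eq[OF sets_\<mu>] by (simp add: space_seq_space)
  have spF: "space F = UNIV"
    by (simp add: F_def sp)
  have coord: "(\<lambda>x. x i) \<in> measurable \<mu> (count_space UNIV)" for i
    unfolding measurable_cong_sets[OF sets_\<mu> refl] seq_space_def by measurable
  have seqI: "f \<in> measurable N \<mu>"
    if "\<And>i. (\<lambda>x. f x i) \<in> measurable N (count_space UNIV)" for f :: "'c \<Rightarrow> nat \<Rightarrow> 'a" and N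
    unfolding measurable_cong_sets[OF refl sets_\<mu>] seq_space_def
    using that by (intro measurable_PiM_single') auto
  have shift_meas: "shift \<in> measurable \<mu> \<mu>"
    by (rule seqI) (simp add: shift_def coord)
  have shift_F: "shift \<in> measurable F \<mu>"
    unfolding F_def by (rule measurable_vimage_algebra1) (simp add: sp)
  have sub: "subalgebra \<mu> F"
    unfolding subalgebra_def spF sp F_def using sets_vimage_algebra2[of shift "space \<mu>" \<mu>]
      measurable_sets[OF shift_meas] by (auto simp: sp)
  interpret S: finite_measure_subalgebra \<mu> F
    by unfold_locales (rule sub)
  define ins where "ins a x = x(0 := a)" for a :: 'a and x :: "nat \<Rightarrow> 'a"
  have ins_F: "ins a \<in> measurable F \<mu>" for a
  proof (rule seqI)
    fix i
    show "(\<lambda>x. ins a x i) \<in> measurable F (count_space UNIV)"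
    proof (cases i)
      case (Suc j)
      have "(\<lambda>x. shift x j) \<in> measurable F (count_space UNIV)"
        using measurable_compose[OF shift_F coord] .
      then show ?thesis by (simp add: Suc ins_def shift_def)
    qed (simp add: ins_def)
  qed
  have Fmu: "f \<in> measurable \<mu> N" if "f \<in> measurable F N" for f and N :: "'d measure"
    using measurable_from_subalg[OF sub that] .
  define p where "p a = real_cond_exp \<mu> F (indicator {y. y 0 = a})" for a
  have p_F[measurable]: "p a \<in> borel_measurable F" for a
    unfolding p_def by simp
  have cyl: "{y. y 0 = a} \<in> sets \<mu>" for a
    using measurable_sets[OF coord[of 0], of "{a}"] by (simp add: sp vimage_def)
  have p_nonneg: "AE x in \<mu>. 0 \<le> p a x" for a
    unfolding p_def using cyl by (intro S.real_cond_exp_pos) auto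
  have p_sum: "AE x in \<mu>. (\<Sum>a\<in>UNIV. p a x) = 1"
  proof -
    have "AE x in \<mu>. real_cond_exp \<mu> F (\<lambda>x. \<Sum>a\<in>UNIV. indicator {y. y 0 = a} x) x = (\<Sum>a\<in>UNIV. p a x)"
      unfolding p_def using cyl by (intro S.real_cond_exp_sum) (auto simp: P.emeasure_eq_measure)
    moreover have "(\<lambda>x. \<Sum>a\<in>UNIV. indicator {y. y 0 = a} x) = (\<lambda>x::nat \<Rightarrow> 'a. 1::real)"
      by (auto simp: indicator_def of_bool_def fun_eq_iff)
    moreover have "AE x in \<mu>. real_cond_exp \<mu> F (\<lambda>x. 1) x = 1"
      by (rule S.real_cond_exp_F_meas) auto
    ultimately have "AE x in \<mu>. real_cond_exp \<mu> F (\<lambda>x. 1) x = (\<Sum>a\<in>UNIV. p a x)"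
      and "AE x in \<mu>. real_cond_exp \<mu> F (\<lambda>x. 1) x = 1" by simp_all
    then show ?thesis by eventually_elim simp
  qed
  define good where "good x \<longleftrightarrow> (\<forall>a. 0 \<le> p a x) \<and> (\<Sum>a\<in>UNIV. p a x) = 1" for x
  have good_ae: "AE x in \<mu>. good x"
    unfolding good_def using p_nonneg p_sum by (simp add: AE_all_countable)
  have good_F[measurable]: "Measurable.pred F good"
    unfolding good_def by measurable
  define q where "q a x = (if good x then p a x else 1 / real CARD('a))" for a x
  have q_F[measurable]: "q a \<in> borel_measurable F" for a
    unfolding q_def by measurable
  have q_nonneg: "0 \<le> q a x" for a x
    by (auto simp: q_def good_def)
  have q_sum: "(\<Sum>a\<in>UNIV. q a x) = 1" for x
    by (cases "good x") (simp_all add: q_def, simp add: good_def)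
  define \<kappa> where "\<kappa> x = distr (point_measure UNIV (\<lambda>a. ennreal (q a x))) \<mu> (\<lambda>a. ins a x)" for x
  have em: "emeasure (\<kappa> x) E = ennreal (\<Sum>a\<in>UNIV. q a x * indicator E (ins a x))"
    if E: "E \<in> sets \<mu>" for x E
  proof -
    have "emeasure (\<kappa> x) E = emeasure (point_measure UNIV (\<lambda>a. ennreal (q a x))) {a. ins a x \<in> E}"
      unfolding \<kappa>_def using E
      by (subst emeasure_distr) (auto simp: measurable_point_measure_eq1 sp space_point_measure vimage_def)
    also have "\<dots> = (\<Sum>a\<in>{a. ins a x \<in> E}. ennreal (q a x))"
      by (rule emeasure_point_measure_finite) auto
    also have "\<dots> = ennreal (\<Sum>a\<in>{a. ins a x \<in> E}. q a x)"
      using q_nonneg by (intro sum_ennreal) auto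
    also have "(\<Sum>a\<in>{a. ins a x \<in> E}. q a x) = (\<Sum>a\<in>UNIV. q a x * indicator E (ins a x))"
      by (intro sum.mono_neutral_cong_left) (auto simp: indicator_def)
    finally show ?thesis .
  qed
  have prob: "prob_space (\<kappa> x)" for x
  proof
    have "space (\<kappa> x) = UNIV" by (simp add: \<kappa>_def sp)
    then show "emeasure (\<kappa> x) (space (\<kappa> x)) = 1"
      using em[of UNIV x] sets.top[of \<mu>] by (simp add: sp q_sum)
  qed
  have ind_F[measurable]: "(\<lambda>x. indicator E (ins a x) :: real) \<in> borel_measurable F"
    if "E \<in> sets \<mu>" for E a
    using measurable_compose[OF ins_F borel_measurable_indicator[OF that]] .
  have meas: "\<kappa> \<in> measurable F (prob_algebra \<mu>)"
  proof (rule measurable_prob_algebraI)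
    show "prob_space (\<kappa> x)" for x by (rule prob)
    show "\<kappa> \<in> measurable F (subprob_algebra \<mu>)"
    proof (rule measurable_subprob_algebra)
      show "subprob_space (\<kappa> x)" for x using prob prob_space_imp_subprob_space by blast
      show "sets (\<kappa> x) = sets \<mu>" for x by (simp add: \<kappa>_def)
      fix E assume E: "E \<in> sets \<mu>"
      note ind_F[OF E, measurable]
      show "(\<lambda>x. emeasure (\<kappa> x) E) \<in> borel_measurable F"
        unfolding em[OF E] by measurable
    qed
  qed
  have char: "AE x in \<mu>. measure (\<kappa> x) E = real_cond_exp \<mu> F (indicator E) x" if E: "E \<in> sets \<mu>" for E
  proof -
    let ?g = "\<lambda>a x. indicator E (ins a x) :: real"
    have int: "integrable \<mu> (\<lambda>x. ?g a x * indicator {y. y 0 = a} x)" for a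
    proof (rule P.integrable_const_bound[where B=1])
      show "(\<lambda>x. ?g a x * indicator {y. y 0 = a} x) \<in> borel_measurable \<mu>"
        using Fmu[OF ind_F[OF E]] cyl by (intro borel_measurable_times) auto
    qed (auto simp: indicator_def)
    have h1: "AE x in \<mu>. real_cond_exp \<mu> F (\<lambda>x. \<Sum>a\<in>UNIV. ?g a x * indicator {y. y 0 = a} x) x
       = (\<Sum>a\<in>UNIV. real_cond_exp \<mu> F (\<lambda>x. ?g a x * indicator {y. y 0 = a} x) x)"
      by (rule S.real_cond_exp_sum[OF int])
    have h2: "AE x in \<mu>. \<forall>a. real_cond_exp \<mu> F (\<lambda>x. ?g a x * indicator {y. y 0 = a} x) x = ?g a x * p a x"
      unfolding p_def AE_all_countable
      using cyl by (intro allI S.real_cond_exp_mult ind_F[OF E] int) auto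
    have h3: "(\<lambda>x. \<Sum>a\<in>UNIV. ?g a x * indicator {y. y 0 = a} x) = (indicator E :: _ \<Rightarrow> real)"
    proof
      fix x :: "nat \<Rightarrow> 'a"
      have "(\<Sum>a\<in>UNIV. ?g a x * indicator {y. y 0 = a} x) = (\<Sum>a\<in>UNIV. if a = x 0 then ?g a x else 0)"
        by (intro sum.cong) (auto simp: indicator_def)
      also have "\<dots> = ?g (x 0) x" by simp
      also have "\<dots> = indicator E x" by (simp add: ins_def)
      finally show "(\<Sum>a\<in>UNIV. ?g a x * indicator {y. y 0 = a} x) = indicator E x" .
    qed
    from h1 h2 good_ae show ?thesis
    proof eventually_elim
      case (elim x)
      have "measure (\<kappa> x) E = (\<Sum>a\<in>UNIV. q a x * ?g a x)"
        unfolding measure_def em[OF E] by (intro enn2real_ennreal sum_nonneg mult_nonneg_nonneg q_nonneg) auto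
      also have "\<dots> = (\<Sum>a\<in>UNIV. ?g a x * p a x)"
        using elim by (simp add: q_def mult.commute)
      also have "\<dots> = (\<Sum>a\<in>UNIV. real_cond_exp \<mu> F (\<lambda>x. ?g a x * indicator {y. y 0 = a} x) x)"
        by (intro sum.cong refl) (simp only: elim(2)[rule_format])
      also have "\<dots> = real_cond_exp \<mu> F (indicator E) x"
        using elim(1) unfolding h3 by (rule sym)
      finally show ?case .
    qed
  qed
  show ?thesis
    unfolding conditional_probability_def using sub meas char unfolding F_def by blast
qed

section \<open>Bi-permutative cellular automata and the maps attached to an invariant measure\<close>

definition bipermutative_CA :: "((nat \<Rightarrow> 'a) \<Rightarrow> nat \<Rightarrow> 'a) \<Rightarrow> bool" where
  "bipermutative_CA \<tau> \<longleftrightarrow>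
     (\<exists>r. (\<forall>x i. \<tau> x i = r (x i) (x (Suc i))) \<and> (\<forall>a. bij (\<lambda>b. r b a) \<and> bij (\<lambda>b. r a b)))"

definition set_CA :: "((nat \<Rightarrow> 'a) \<Rightarrow> nat \<Rightarrow> 'a) \<Rightarrow> (nat \<Rightarrow> 'a set) \<Rightarrow> nat \<Rightarrow> 'a set" where
  "set_CA \<tau> A = (\<lambda>i. {\<tau> a i | a. \<forall>j. a j \<in> A j})"

text \<open>In the definitions of \<open>Lambda_set\<close>, \<open>pi_map\<close> and \<open>phi_map\<close>, \<open>\<kappa>\<close> is the conditional probability of \<open>\<mu>\<close> given the
  \<open>shift\<close>-preimage of the Borel \<open>\<sigma>\<close>-algebra, so that \<open>\<mu>\<close> itself enters only through \<open>\<kappa>\<close>.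
  The point \<open>x(0 := a)\<close> is \<open>(a, x\<^sub>1, x\<^sub>2, \<dots>)\<close>.\<close>

definition Lambda_set :: "((nat \<Rightarrow> 'a) \<Rightarrow> (nat \<Rightarrow> 'a) measure) \<Rightarrow> (nat \<Rightarrow> 'a) \<Rightarrow> 'a set" where
  "Lambda_set \<kappa> x = {a. measure (\<kappa> x) {x(0 := a)} > 0}"

definition pi_map ::
  "((nat \<Rightarrow> 'a) \<Rightarrow> (nat \<Rightarrow> 'a) measure) \<Rightarrow> (nat \<Rightarrow> 'a) \<Rightarrow> nat \<Rightarrow> 'a set" where
  "pi_map \<kappa> x = (\<lambda>i. Lambda_set \<kappa> ((shift ^^ i) x))"

definition phi_map ::
  "((nat \<Rightarrow> 'a) \<Rightarrow> (nat \<Rightarrow> 'a) measure) \<Rightarrow> (nat \<Rightarrow> 'a) \<Rightarrow> nat \<Rightarrow> 'a set \<times> 'a" where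
  "phi_map \<kappa> x = (\<lambda>i. (pi_map \<kappa> x i, x i))"

definition pi_measure ::
  "(nat \<Rightarrow> 'a) measure \<Rightarrow> ((nat \<Rightarrow> 'a) \<Rightarrow> (nat \<Rightarrow> 'a) measure) \<Rightarrow> (nat \<Rightarrow> 'a set) measure" where
  "pi_measure \<mu> \<kappa> = distr \<mu> (seq_space UNIV) (pi_map \<kappa>)"

definition pointed_subsets :: "('a set \<times> 'a) set" where
  "pointed_subsets = {(A, a). a \<in> A}"

text \<open>\<open>uniform_extension \<nu> \<nu>'\<close> is the defining property of the measure \<open>\<nu>'\<close> that lifts \<open>\<nu>\<close> by choosing
  a point of each subset uniformly and independently.  \<open>\<phi>\<^sub>\<mu>\<close> lands in the alphabet \<open>pointed_subsets\<close>
  only almost surely.\<close>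

definition uniform_extension ::
  "(nat \<Rightarrow> 'a set) measure \<Rightarrow> (nat \<Rightarrow> 'a set \<times> 'a) measure \<Rightarrow> bool" where
  "uniform_extension \<nu> \<nu>' \<longleftrightarrow>
     sets \<nu>' = sets (seq_space pointed_subsets) \<and>
     (\<forall>n A a. (\<forall>i\<le>n. a i \<in> A i) \<longrightarrow>
        emeasure \<nu>' {y \<in> space \<nu>'. \<forall>i\<le>n. y i = (A i, a i)} =
        ennreal (measure \<nu> {z \<in> space \<nu>. \<forall>i\<le>n. z i = A i} / (\<Prod>i\<le>n. real (card (A i)))))"

end

theory Submission
  imports Defs
begin

text \<open>Write \<open>k a x\<close> for the conditional probability of \<open>x\<^sub>0 = a\<close> given \<open>shift x\<close>. Since \<open>\<tau>\<close> preserves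
  \<open>\<mu>\<close> and commutes with the shift, a comparison of \<open>L\<^sup>2\<close> norms shows that \<open>\<tau>\<close> transports the weights:
  \<open>k (r a x\<^sub>1) (\<tau> x) = k a x\<close>. Hence \<open>x \<mapsto> k (x\<^sub>0) x\<close> is \<open>\<tau>\<close>-invariant. By bi-permutativity the words
  \<open>x\<^sub>0 \<dots> x\<^sub>n\<^sub>-\<^sub>1\<close> and the columns \<open>(\<tau>\<^sup>j x)\<^sub>0\<close>, \<open>j < n\<close>, determine each other, so the shift and \<open>\<tau>\<close> have the same
  entropy; as conditioning on \<open>\<tau>\<close>-invariant events does not lower the entropy of \<open>\<tau>\<close>, such events have
  zero entropy for the shift. Events of zero entropy lie, up to null sets, in the preimages of the
  \<open>\<sigma>\<close>-algebra under all powers of the shift. Applied to the sublevel sets of \<open>x \<mapsto> k (x\<^sub>0) x\<close> this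
  gives the uniformity of the conditional probabilities. Applied to the events depending on \<open>\<pi>\<^sub>\<mu> x\<close>, it shows
  that given \<open>\<pi>\<^sub>\<mu> x\<close> the coordinates of \<open>x\<close> are independent and uniform, which is (i), and then (ii) is
  a relative zero-one law. For (iii), \<open>\<Lambda>\<^sub>x\<close> and \<open>\<Lambda>\<^bsub>\<tau> x\<^esub> = r(\<Lambda>\<^sub>x, x\<^sub>1)\<close> do not depend on \<open>x\<^sub>1\<close>, so \<open>r(\<Lambda>\<^sub>x, b)\<close> is the
  same set for all \<open>b\<close> in \<open>\<Lambda>\<^bsub>shift x\<^esub>\<close>; comparing cardinalities gives (iv).\<close>

section \<open>Entropy of simple functions\<close>

text \<open>Neither conditional entropy nor martingale convergence appears: a conditional entropy is
  a difference of two values of \<open>shannon\<close>, and coarser functions are recognised by the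
  pointwise test that equal values of \<open>Y\<close> force equal values of \<open>X\<close>. As
  \<open>shannon\<close> is the expected information of the atom of \<open>X\<close> at
  \<open>x\<close>, entropy inequalities reduce to comparing atoms almost everywhere.

  The shift is not invertible, so events are only ever pushed into the future: a zero entropy event
  agrees almost surely with a condition on \<open>shift x\<close>, and this condition has zero
  entropy again. Facts about \<open>shift x\<close> return to \<open>x\<close> through invariance of
  the measure. The tail algebra that results is the hinge. The entropy hypothesis puts the events
  depending on \<open>pi_map\<close> into it, so a word can be peeled off symbol by symbol inside
  such an event, each symbol contributing the reciprocal of the size of its subset. Conversely, the
  law of a word given the tail is a function of \<open>pi_map\<close>, and this forces tail events
  to depend on \<open>pi_map\<close>. Zero entropy events, tail events and events of
  \<open>pi_map\<close> thus agree up to null sets.\<close>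

definition shannon :: "'x measure \<Rightarrow> ('x \<Rightarrow> 'c) \<Rightarrow> real" where
  "shannon M X = - (\<integral>x. ln (measure M (X -` {X x} \<inter> space M)) \<partial>M)"

context prob_space
begin

lemma integral_simple_function_comp:
  assumes X: "simple_function M X"
  shows "integrable M (\<lambda>x. g (X x) :: real)"
    and "(\<integral>x. g (X x) \<partial>M) = (\<Sum>v\<in>X ` space M. prob (X -` {v} \<inter> space M) * g v)"
proof -
  have fin: "finite (X ` space M)" and meas: "X -` {v} \<inter> space M \<in> sets M" for v
    using X by (auto simp: simple_functionD)
  have eq: "g (X x) = (\<Sum>v\<in>X ` space M. g v * indicator (X -` {v} \<inter> space M) x)" if "x \<in> space M" for x
  proof -
    have "(\<Sum>v\<in>X ` space M. g v * indicator (X -` {v} \<inter> space M) x) =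
        (\<Sum>v\<in>X ` space M. if v = X x then g v else 0)"
      using that by (intro sum.cong) auto
    also have "\<dots> = g (X x)"
      using that fin by (subst sum.delta) auto
    finally show ?thesis ..
  qed
  have int: "integrable M (\<lambda>x. \<Sum>v\<in>X ` space M. g v * indicator (X -` {v} \<inter> space M) x)"
    using meas by (intro Bochner_Integration.integrable_sum integrable_mult_right)
      (auto simp: less_top[symmetric])
  then show "integrable M (\<lambda>x. g (X x))"
    using eq by (subst Bochner_Integration.integrable_cong[OF refl, of M _ _]) auto
  have "(\<integral>x. g (X x) \<partial>M) = (\<integral>x. (\<Sum>v\<in>X ` space M. g v * indicator (X -` {v} \<inter> space M) x) \<partial>M)"
    using eq by (intro Bochner_Integration.integral_cong) auto
  also have "\<dots> = (\<Sum>v\<in>X ` space M. \<integral>x. g v * indicator (X -` {v} \<inter> space M) x \<partial>M)"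
    using meas by (intro Bochner_Integration.integral_sum integrable_mult_right)
      (auto simp: less_top[symmetric])
  also have "\<dots> = (\<Sum>v\<in>X ` space M. prob (X -` {v} \<inter> space M) * g v)"
    using meas by (intro sum.cong) (auto simp: mult.commute)
  finally show "(\<integral>x. g (X x) \<partial>M) = (\<Sum>v\<in>X ` space M. prob (X -` {v} \<inter> space M) * g v)" .
qed

lemma shannon_eq_sum:
  assumes X: "simple_function M X" and V: "finite V" "X ` space M \<subseteq> V"
  shows "shannon M X =
    - (\<Sum>v\<in>V. prob (X -` {v} \<inter> space M) * ln (prob (X -` {v} \<inter> space M)))"
proof -
  have "shannon M X =
    - (\<Sum>v\<in>X ` space M. prob (X -` {v} \<inter> space M) * ln (prob (X -` {v} \<inter> space M)))"
    unfolding shannon_def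
    by (subst integral_simple_function_comp(2)[OF X, of "\<lambda>v. ln (prob (X -` {v} \<inter> space M))"]) simp
  also have "(\<Sum>v\<in>X ` space M. prob (X -` {v} \<inter> space M) * ln (prob (X -` {v} \<inter> space M))) =
     (\<Sum>v\<in>V. prob (X -` {v} \<inter> space M) * ln (prob (X -` {v} \<inter> space M)))"
  proof (intro sum.mono_neutral_left V ballI)
    fix v assume "v \<in> V - X ` space M"
    then have "X -` {v} \<inter> space M = {}" by auto
    then show "prob (X -` {v} \<inter> space M) * ln (prob (X -` {v} \<inter> space M)) = 0" by simp
  qed
  finally show ?thesis .
qed

lemma AE_atom_pos:
  assumes X: "simple_function M X"
  shows "AE x in M. 0 < prob (X -` {X x} \<inter> space M)"
proof -
  let ?N = "{v \<in> X ` space M. prob (X -` {v} \<inter> space M) = 0}"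
  have fin: "finite ?N" using X by (auto simp: simple_functionD)
  have "(\<Union>v\<in>?N. X -` {v} \<inter> space M) \<in> null_sets M"
    using fin simple_functionD(2)[OF X] by (intro null_sets_UN' countable_finite)
      (auto simp: null_sets_def emeasure_eq_measure)
  then show ?thesis
    by (rule AE_I') (auto simp: not_less intro: antisym[OF _ measure_nonneg])
qed

text \<open>Choosing one point in each level set of \<open>Y\<close> writes \<open>X\<close> as a
  function of \<open>Y\<close>. This lets \<open>shannon_mono\<close> assume simplicity of the finer
  function alone.\<close>

lemma simple_function_determined:
  assumes Y: "simple_function M Y"
    and det: "\<And>x x'. x \<in> space M \<Longrightarrow> x' \<in> space M \<Longrightarrow> Y x = Y x' \<Longrightarrow> X x = X x'"
  shows "simple_function M X"
proof -
  define f where "f v = X (SOME x. x \<in> space M \<and> Y x = v)" for v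
  have "X x = f (Y x)" if "x \<in> space M" for x
  proof -
    have "\<exists>x'. x' \<in> space M \<and> Y x' = Y x" using that by blast
    from someI_ex[OF this] show ?thesis
      unfolding f_def using det that by metis
  qed
  then show ?thesis
    using simple_function_compose1[OF Y, of f] by (subst simple_function_cong) auto
qed

text \<open>The atom of \<open>Y\<close> at \<open>x\<close> lies in the atom of \<open>X\<close> at
  \<open>x\<close>, so it carries at least as much information. Atoms of measure zero, where
  \<open>ln\<close> is not monotone, are met with probability zero.\<close>

lemma shannon_mono:
  assumes Y: "simple_function M Y"
    and det: "\<And>x x'. x \<in> space M \<Longrightarrow> x' \<in> space M \<Longrightarrow> Y x = Y x' \<Longrightarrow> X x = X x'"
  shows "shannon M X \<le> shannon M Y"
proof -
  have X: "simple_function M X" by (rule simple_function_determined[OF Y det])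
  have "(\<integral>x. ln (prob (Y -` {Y x} \<inter> space M)) \<partial>M) \<le> (\<integral>x. ln (prob (X -` {X x} \<inter> space M)) \<partial>M)"
  proof (rule integral_mono_AE)
    show "integrable M (\<lambda>x. ln (prob (Y -` {Y x} \<inter> space M)))"
      by (rule integral_simple_function_comp(1)[OF Y, of "\<lambda>v. ln (prob (Y -` {v} \<inter> space M))"])
    show "integrable M (\<lambda>x. ln (prob (X -` {X x} \<inter> space M)))"
      by (rule integral_simple_function_comp(1)[OF X, of "\<lambda>v. ln (prob (X -` {v} \<inter> space M))"])
    show "AE x in M. ln (prob (Y -` {Y x} \<inter> space M)) \<le> ln (prob (X -` {X x} \<inter> space M))"
      using AE_atom_pos[OF Y] AE_space
    proof eventually_elim
      case (elim x)
      have "Y -` {Y x} \<inter> space M \<subseteq> X -` {X x} \<inter> space M"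
        using det[OF _ elim(2)] by blast
      then have "prob (Y -` {Y x} \<inter> space M) \<le> prob (X -` {X x} \<inter> space M)"
        using simple_functionD(2)[OF X] by (intro finite_measure_mono) auto
      then show ?case using elim(1) by simp
    qed
  qed
  then show ?thesis by (simp add: shannon_def)
qed

lemma shannon_nonneg: "simple_function M X \<Longrightarrow> 0 \<le> shannon M X"
  using shannon_mono[of X "\<lambda>_. ()"] by (simp add: shannon_def prob_space)

text \<open>This is nonnegativity of the conditional mutual information of \<open>X\<close> and
  \<open>Y\<close> given \<open>Z\<close>; base \<open>exp 1\<close> makes the library's
  \<open>log\<close> equal to \<open>ln\<close>.\<close>

lemma shannon_submodular:
  assumes X: "simple_function M X" and Y: "simple_function M Y" and Z: "simple_function M Z"
  shows "shannon M (\<lambda>x. (X x, Y x, Z x)) + shannon M Z \<le>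
    shannon M (\<lambda>x. (X x, Z x)) + shannon M (\<lambda>x. (Y x, Z x))"
proof -
  interpret information_space M "exp 1" by unfold_locales simp
  let ?P = "\<lambda>W v. prob (W -` {v} \<inter> space M)"
  let ?XZ = "\<lambda>x. (X x, Z x)" let ?YZ = "\<lambda>x. (Y x, Z x)" let ?XYZ = "\<lambda>x. (X x, Y x, Z x)"
  note XZ = simple_function_Pair[OF X Z] and YZ = simple_function_Pair[OF Y Z]
  note XYZ = simple_function_Pair[OF X YZ]
  note dist = simple_distributedI[OF _ measure_nonneg refl]
  let ?g = "\<lambda>(x, y, z). ln (?P ?XYZ (x, y, z) / (?P ?XZ (x, z) * (?P ?YZ (y, z) / ?P Z z)))"
  note int = integral_simple_function_comp(1)
  have log: "log (exp 1) = ln" by (auto simp: log_def)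
  have "0 \<le> conditional_mutual_information (exp 1) (count_space (X ` space M)) (count_space (Y ` space M))
      (count_space (Z ` space M)) X Y Z" by (rule conditional_mutual_information_nonneg[OF X Y Z])
  also have "\<dots> = (\<Sum>v\<in>?XYZ ` space M. ?P ?XYZ v * ?g v)"
    by (subst conditional_mutual_information_eq[OF dist[OF Z] dist[OF YZ] dist[OF XZ] dist[OF XYZ]])
      (auto intro!: sum.cong simp: log)
  also have "\<dots> = (\<integral>x. ?g (?XYZ x) \<partial>M)"
    by (rule integral_simple_function_comp(2)[OF XYZ, symmetric])
  also have "\<dots> = (\<integral>x. ln (?P ?XYZ (?XYZ x)) - ln (?P ?XZ (?XZ x)) - ln (?P ?YZ (?YZ x)) + ln (?P Z (Z x)) \<partial>M)"
  proof (rule integral_cong_AE)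
    show "AE x in M. ?g (?XYZ x) =
        ln (?P ?XYZ (?XYZ x)) - ln (?P ?XZ (?XZ x)) - ln (?P ?YZ (?YZ x)) + ln (?P Z (Z x))"
      using AE_atom_pos[OF XYZ] AE_atom_pos[OF XZ] AE_atom_pos[OF YZ] AE_atom_pos[OF Z]
      by eventually_elim (simp add: ln_mult ln_div)
  qed (intro borel_measurable_integrable int[OF XYZ, of ?g], intro borel_measurable_integrable
      Bochner_Integration.integrable_add Bochner_Integration.integrable_diff
      int[OF XYZ, of "\<lambda>v. ln (?P ?XYZ v)"] int[OF XZ, of "\<lambda>v. ln (?P ?XZ v)"]
      int[OF YZ, of "\<lambda>v. ln (?P ?YZ v)"] int[OF Z, of "\<lambda>v. ln (?P Z v)"])
  also have "\<dots> = - shannon M ?XYZ + shannon M ?XZ + shannon M ?YZ - shannon M Z"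
    unfolding shannon_def
    using int[OF XYZ, of "\<lambda>v. ln (?P ?XYZ v)"] int[OF XZ, of "\<lambda>v. ln (?P ?XZ v)"]
      int[OF YZ, of "\<lambda>v. ln (?P ?YZ v)"] int[OF Z, of "\<lambda>v. ln (?P Z v)"]
    by (simp add: Bochner_Integration.integral_add Bochner_Integration.integral_diff)
  finally show ?thesis by simp
qed

text \<open>Submodularity over a constant third function.\<close>

lemma shannon_Pair_le:
  assumes X: "simple_function M X" and Y: "simple_function M Y"
  shows "shannon M (\<lambda>x. (X x, Y x)) \<le> shannon M X + shannon M Y"
proof -
  have u: "simple_function M (\<lambda>_. ())" by simp
  have "shannon M (\<lambda>_. ()) = 0" by (simp add: shannon_def prob_space)
  moreover have "shannon M (\<lambda>x. (X x, Y x)) \<le> shannon M (\<lambda>x. (X x, Y x, ()))"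
    by (rule shannon_mono) (auto intro!: simple_function_Pair X Y)
  moreover have "shannon M (\<lambda>x. (X x, ())) \<le> shannon M X" "shannon M (\<lambda>x. (Y x, ())) \<le> shannon M Y"
    by (rule shannon_mono; use X Y in auto)+
  ultimately show ?thesis using shannon_submodular[OF X Y u] by linarith
qed

lemma shannon_AE_cong:
  assumes X: "simple_function M X" and Y: "simple_function M Y" and eq: "AE x in M. X x = Y x"
  shows "shannon M X = shannon M Y"
proof -
  have "prob (X -` {v} \<inter> space M) = prob (Y -` {v} \<inter> space M)" for v
    using eq by (intro measure_eq_AE simple_functionD X Y) auto
  then show ?thesis
    using shannon_eq_sum[OF X, of "X ` space M \<union> Y ` space M"]
      shannon_eq_sum[OF Y, of "X ` space M \<union> Y ` space M"] simple_functionD(1)[OF X]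
      simple_functionD(1)[OF Y] by simp
qed

lemma simple_function_vimage:
  assumes T: "T \<in> measurable M N" and X: "simple_function N X"
  shows "simple_function M (\<lambda>x. X (T x))"
  by (rule simple_function_comp[OF T X, unfolded comp_def])

lemma shannon_distr:
  assumes T: "T \<in> measurable M N" and X: "simple_function N X"
  shows "shannon (distr M N T) X = shannon M (\<lambda>x. X (T x))"
proof -
  interpret D: prob_space "distr M N T" by (rule prob_space_distr[OF T])
  have X': "simple_function (distr M N T) X"
    using X by (simp add: simple_function_def)
  have fin: "finite (X ` space N)" using X by (simp add: simple_functionD)
  have "D.prob (X -` {v} \<inter> space N) = prob ((\<lambda>x. X (T x)) -` {v} \<inter> space M)" for v
    using measurable_space[OF T] simple_functionD(2)[OF X, of "{v}"]
    by (subst measure_distr[OF T]) (auto intro!: arg_cong[where f=prob])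
  moreover have "(\<lambda>x. X (T x)) ` space M \<subseteq> X ` space N"
    using measurable_space[OF T] by auto
  ultimately show ?thesis
    using D.shannon_eq_sum[OF X' fin] shannon_eq_sum[OF simple_function_vimage[OF T X] fin] by simp
qed

end

section \<open>Entropy rates and tail events\<close>

definition itinerary :: "('x \<Rightarrow> 'x) \<Rightarrow> ('x \<Rightarrow> 'c) \<Rightarrow> nat \<Rightarrow> 'x \<Rightarrow> 'c list" where
  "itinerary T f n x = map (\<lambda>i. f ((T ^^ i) x)) [0..<n]"

lemma itinerary_eq_iff:
  "itinerary T f n x = itinerary U g n y \<longleftrightarrow> (\<forall>i<n. f ((T ^^ i) x) = g ((U ^^ i) y))"
  by (auto simp: itinerary_def)

definition entropy_rate :: "'x measure \<Rightarrow> ('x \<Rightarrow> 'x) \<Rightarrow> ('x \<Rightarrow> 'c) \<Rightarrow> real" where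
  "entropy_rate M T f = lim (\<lambda>n. shannon M (itinerary T f n) / real n)"

lemma simple_function_mem:
  assumes "A \<in> sets M"
  shows "simple_function M (\<lambda>x. x \<in> A)"
  using simple_function_compose1[OF simple_function_indicator[OF assms], of "\<lambda>r :: real. r = 1"]
  by (simp add: indicator_eq_1_iff)

text \<open>\<open>V\<close> is the majority vote: it predicts membership in \<open>A\<close> on the
  atoms of \<open>W\<close> of which \<open>A\<close> occupies at least half. Where the prediction
  fails, the actual outcome has conditional probability at most 1/2 and hence information at least
  \<open>ln 2\<close>; elsewhere the information is nonnegative. Its mean is the entropy difference
  on the right.\<close>

lemma (in prob_space) prob_mismatch_le_entropy_gap:
  assumes A: "A \<in> events" and W: "simple_function M W"
  obtains V where "prob {x \<in> space M. (x \<in> A) \<noteq> (W x \<in> V)} * ln 2 \<le>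
    shannon M (\<lambda>x. (x \<in> A, W x)) - shannon M W"
proof
  let ?Q = "\<lambda>x. (x \<in> A, W x)"
  let ?PQ = "\<lambda>v. prob (?Q -` {v} \<inter> space M)" and ?P = "\<lambda>w. prob (W -` {w} \<inter> space M)"
  let ?V = "{w. ?PQ (True, w) \<ge> ?P w / 2}"
  let ?E = "{x \<in> space M. (x \<in> A) \<noteq> (W x \<in> ?V)}"
  note Q = simple_function_Pair[OF simple_function_mem[OF A] W]
  have E: "?E \<in> events"
    using simple_functionD(2)[OF Q, of "{(a, w). a \<noteq> (w \<in> ?V)}"] by (simp add: vimage_def Int_def conj_commute)
  note int = integral_simple_function_comp(1)[OF Q, of "\<lambda>v. ln (?PQ v)"]
    integral_simple_function_comp(1)[OF W, of "\<lambda>v. ln (?P v)"]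
  have split: "?P w = ?PQ (True, w) + ?PQ (False, w)" for w
    using simple_functionD(2)[OF Q]
    by (subst finite_measure_Union[symmetric]) (auto intro!: arg_cong[where f = prob])
  have "prob ?E * ln 2 = (\<integral>x. indicator ?E x * (ln 2 :: real) \<partial>M)"
    using E by simp
  also have "\<dots> \<le> (\<integral>x. ln (?P (W x)) - ln (?PQ (?Q x)) \<partial>M)"
  proof (rule integral_mono_AE)
    show "integrable M (\<lambda>x. indicator ?E x * (ln 2 :: real))"
      using E by (intro integrable_mult_left) (auto simp: less_top[symmetric])
    show "integrable M (\<lambda>x. ln (?P (W x)) - ln (?PQ (?Q x)))"
      using int by (intro Bochner_Integration.integrable_diff)
    show "AE x in M. indicator ?E x * ln 2 \<le> ln (?P (W x)) - ln (?PQ (?Q x))"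
      using AE_atom_pos[OF Q] AE_space
    proof eventually_elim
      case (elim x)
      have pos: "0 < ?PQ (x \<in> A, W x)" using elim by simp
      have le: "?PQ (x \<in> A, W x) \<le> ?P (W x)"
        using split[of "W x"] by (cases "x \<in> A") (auto simp: measure_nonneg)
      show ?case
      proof (cases "x \<in> ?E")
        case True
        then have "2 * ?PQ (x \<in> A, W x) \<le> ?P (W x)"
          using split[of "W x"] by (cases "x \<in> A") auto
        moreover have "ln (2 * ?PQ (x \<in> A, W x)) = ln 2 + ln (?PQ (x \<in> A, W x))"
          using pos by (simp add: ln_mult)
        moreover have "ln (2 * ?PQ (x \<in> A, W x)) \<le> ln (?P (W x))"
          using pos \<open>2 * ?PQ (x \<in> A, W x) \<le> ?P (W x)\<close> by (subst ln_le_cancel_iff) auto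
        ultimately show ?thesis using True by (simp add: indicator_def)
      next
        case False
        then have "indicator ?E x = (0 :: real)" by (rule indicator_simps(2))
        moreover have "ln (?PQ (x \<in> A, W x)) \<le> ln (?P (W x))"
          using le pos by (subst ln_le_cancel_iff) auto
        ultimately show ?thesis by simp
      qed
    qed
  qed
  also have "\<dots> = shannon M ?Q - shannon M W"
    unfolding shannon_def using int by (simp add: Bochner_Integration.integral_diff)
  finally show "prob ?E * ln 2 \<le> shannon M ?Q - shannon M W" .
qed

text \<open>Via \<open>ln t \<le> t - 1\<close>, used at \<open>t = 1 / sqrt p\<close> and at \<open>t = 1 / (1 - p)\<close>.\<close>

lemma (in prob_space) shannon_mem_le:
  assumes A: "A \<in> events"
  shows "shannon M (\<lambda>x. x \<in> A) \<le> 3 * sqrt (prob A)"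
proof -
  let ?p = "prob A"
  have p: "0 \<le> ?p" "?p \<le> 1" by auto
  have "(\<lambda>x. x \<in> A) -` {False} \<inter> space M = space M - A" "(\<lambda>x. x \<in> A) -` {True} \<inter> space M = A"
    using sets.sets_into_space[OF A] by auto
  then have "shannon M (\<lambda>x. x \<in> A) = - (?p * ln ?p) - (1 - ?p) * ln (1 - ?p)"
    using shannon_eq_sum[OF simple_function_mem[OF A] finite subset_UNIV] prob_compl[OF A]
    by (simp add: UNIV_bool)
  moreover have "- (?p * ln ?p) \<le> 2 * sqrt ?p"
  proof (cases "?p = 0")
    case False
    then have s: "0 < sqrt ?p" by (simp add: zero_less_measure_iff)
    have "ln (1 / sqrt ?p) \<le> 1 / sqrt ?p - 1" using s by (intro ln_le_minus_one) simp
    moreover have "ln (1 / sqrt ?p) = - (ln ?p / 2)" using s by (simp add: ln_div ln_sqrt)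
    ultimately have "- ln ?p \<le> 2 / sqrt ?p" by simp
    then have "?p * (- ln ?p) \<le> ?p * (2 / sqrt ?p)" using p by (intro mult_left_mono) auto
    also have "\<dots> = 2 * (?p / sqrt ?p)" by simp
    also have "?p / sqrt ?p = sqrt ?p" by (rule real_div_sqrt) simp
    finally show ?thesis by simp
  qed simp
  moreover have "- ((1 - ?p) * ln (1 - ?p)) \<le> ?p"
  proof (cases "?p = 1")
    case False
    then have q: "0 < 1 - ?p" using p(2) by linarith
    have "ln (1 / (1 - ?p)) \<le> 1 / (1 - ?p) - 1" using q by (intro ln_le_minus_one) simp
    moreover have "ln (1 / (1 - ?p)) = - ln (1 - ?p)" using q by (simp add: ln_div)
    ultimately have "(1 - ?p) * (- ln (1 - ?p)) \<le> (1 - ?p) * (1 / (1 - ?p) - 1)"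
      using q by (intro mult_left_mono) auto
    also have "\<dots> = ?p" using q by (simp add: field_simps)
    finally show ?thesis by simp
  qed simp
  moreover have "?p \<le> sqrt ?p"
    using p by (intro real_le_rsqrt) (simp add: power2_eq_square mult_left_le)
  ultimately show ?thesis by linarith
qed

section \<open>Entropy rates of a measure preserving map, and their consequences for single
  events\<close>

locale stationary = prob_space M for M :: "'x measure" +
  fixes T :: "'x \<Rightarrow> 'x"
  assumes measurable_T[measurable]: "T \<in> measurable M M"
    and distr_T: "distr M M T = M"
begin

lemma measurable_T_pow[measurable]: "T ^^ n \<in> measurable M M"
  by (induction n) (auto intro: measurable_comp)

lemma distr_T_pow: "distr M M (T ^^ n) = M"
proof (induction n)
  case 0
  then show ?case by (simp add: distr_id[unfolded id_def] id_def)
next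
  case (Suc n)
  have "distr M M (T \<circ> (T ^^ n)) = distr (distr M M (T ^^ n)) M T"
    by (rule distr_distr[symmetric]) auto
  then show ?case by (simp add: Suc distr_T comp_def)
qed

lemma T_pow_space: "x \<in> space M \<Longrightarrow> (T ^^ n) x \<in> space M"
  by (rule measurable_space[OF measurable_T_pow])

lemma AE_T_pow: "AE x in M. P x \<Longrightarrow> AE x in M. P ((T ^^ n) x)"
  using AE_distrD[OF measurable_T_pow[of n], of P] unfolding distr_T_pow .

lemma AE_T: "AE x in M. P x \<Longrightarrow> AE x in M. P (T x)"
  using AE_T_pow[of P 1] by simp

lemma emeasure_T_pow_vimage:
  "A \<in> sets M \<Longrightarrow> emeasure M ((T ^^ n) -` A \<inter> space M) = emeasure M A"
  using emeasure_distr[OF measurable_T_pow, of A n] by (simp add: distr_T_pow)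

text \<open>The implication from left to right is the substitute for an inverse of \<open>T\<close>:
  a property known along the image orbit is pulled back to the starting point.\<close>

lemma AE_T_pow_iff:
  assumes P: "{x \<in> space M. P x} \<in> sets M"
  shows "(AE x in M. P ((T ^^ n) x)) \<longleftrightarrow> (AE x in M. P x)"
  using AE_distr_iff[OF measurable_T_pow[of n] P] unfolding distr_T_pow by (rule sym)

lemma shannon_T_pow: "simple_function M X \<Longrightarrow> shannon M (\<lambda>x. X ((T ^^ n) x)) = shannon M X"
  using shannon_distr[OF measurable_T_pow, of X n] by (simp add: distr_T_pow)

lemma shannon_T: "simple_function M X \<Longrightarrow> shannon M (\<lambda>x. X (T x)) = shannon M X"
  using shannon_T_pow[of X 1] by simp

lemma simple_function_itinerary:
  assumes f: "simple_function M f"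
  shows "simple_function M (itinerary T f n)"
proof (induction n)
  case 0
  then show ?case by (simp add: itinerary_def[abs_def])
next
  case (Suc n)
  have "simple_function M (\<lambda>x. (itinerary T f n x, f ((T ^^ n) x)))"
    using Suc simple_function_vimage[OF measurable_T_pow f] by (intro simple_function_Pair)
  from simple_function_compose1[OF this, of "\<lambda>(w, c). w @ [c]"] show ?case
    by (simp add: itinerary_def[abs_def])
qed

text \<open>A longer known stretch leaves less uncertainty. Submodularity is applied to time 0, time
  \<open>n + 1\<close> and the \<open>n\<close> times in between; by invariance each block has the
  entropy of the initial block of the same length.\<close>

lemma itinerary_gap_antimono:
  assumes f: "simple_function M f"
  shows "shannon M (itinerary T f (Suc (Suc n))) - shannon M (itinerary T f (Suc n)) \<le>
    shannon M (itinerary T f (Suc n)) - shannon M (itinerary T f n)"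
proof -
  let ?I = "itinerary T f"
  let ?Y = "\<lambda>x. f ((T ^^ Suc n) x)" and ?Z = "\<lambda>x. ?I n (T x)"
  note sI = simple_function_itinerary[OF f]
  have Y: "simple_function M ?Y" by (rule simple_function_vimage[OF measurable_T_pow f])
  have Z: "simple_function M ?Z" by (rule simple_function_vimage[OF measurable_T sI])
  have "shannon M (?I (Suc (Suc n))) \<le> shannon M (\<lambda>x. (f x, ?Y x, ?Z x))"
  proof (rule shannon_mono)
    fix x x' assume *: "(f x, ?Y x, ?Z x) = (f x', ?Y x', ?Z x')"
    have "f ((T ^^ i) x) = f ((T ^^ i) x')" if i: "i < Suc (Suc n)" for i
    proof (cases i)
      case (Suc j)
      then consider "i = Suc n" | "j < n" using i Suc by linarith
      then show ?thesis
        using * Suc by cases (auto simp: itinerary_eq_iff funpow_swap1)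
    qed (use * in simp)
    then show "?I (Suc (Suc n)) x = ?I (Suc (Suc n)) x'" by (simp add: itinerary_eq_iff)
  qed (intro simple_function_Pair f Y Z)
  moreover have "shannon M (\<lambda>x. (f x, ?Z x)) \<le> shannon M (?I (Suc n))"
  proof (rule shannon_mono[OF sI])
    fix x x' assume "?I (Suc n) x = ?I (Suc n) x'"
    then have *: "f ((T ^^ i) x) = f ((T ^^ i) x')" if "i < Suc n" for i
      using that by (simp add: itinerary_eq_iff)
    show "(f x, ?Z x) = (f x', ?Z x')"
      using *[of 0] *[of "Suc _"] by (auto simp: itinerary_eq_iff funpow_swap1)
  qed
  moreover have "shannon M (\<lambda>x. (?Y x, ?Z x)) \<le> shannon M (\<lambda>x. ?I (Suc n) (T x))"
    by (rule shannon_mono[OF simple_function_vimage[OF measurable_T sI]])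
      (auto simp: itinerary_eq_iff funpow_swap1)
  moreover note shannon_submodular[OF f Y Z] shannon_T[OF sI, of "Suc n"] shannon_T[OF sI, of n]
  ultimately show ?thesis by linarith
qed

lemma shannon_itinerary_0: "shannon M (itinerary T f 0) = 0"
  by (simp add: shannon_def itinerary_def[abs_def] prob_space)

text \<open>Decreasing gaps make \<open>H\<close> concave in \<open>n\<close>, so the averages
  \<open>H n / n\<close> decrease from \<open>n = 1\<close> on and converge to their infimum. The
  infimum property is the third claim.\<close>

lemma entropy_rate_limit:
  assumes f: "simple_function M f"
  shows "(\<lambda>n. shannon M (itinerary T f n) / real n) \<longlonglongrightarrow> entropy_rate M T f"
    and "0 \<le> entropy_rate M T f"
    and "real n * entropy_rate M T f \<le> shannon M (itinerary T f n)"
proof -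
  define H where "H n = shannon M (itinerary T f n)" for n
  have H0: "H 0 = 0" by (simp add: H_def shannon_itinerary_0)
  have nonneg: "0 \<le> H n" for n
    unfolding H_def by (rule shannon_nonneg[OF simple_function_itinerary[OF f]])
  have gap: "H (Suc (Suc n)) - H (Suc n) \<le> H (Suc n) - H n" for n
    unfolding H_def by (rule itinerary_gap_antimono[OF f])
  \<comment> \<open>The next gap is at most the mean of the first \<open>n\<close> gaps, whose sum
    is \<open>H n\<close>.\<close>
  have key: "real n * (H (Suc n) - H n) \<le> H n" for n
  proof (induction n)
    case (Suc n)
    have "real (Suc n) * (H (Suc (Suc n)) - H (Suc n)) \<le> real (Suc n) * (H (Suc n) - H n)"
      using gap by (intro mult_left_mono) auto
    also have "\<dots> \<le> H (Suc n)" using Suc by (simp add: algebra_simps)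
    finally show ?case .
  qed (simp add: H0)
  \<comment> \<open>The index starts at 1: the quotient at 0 is 0 by the convention for division and
    would spoil monotonicity.\<close>
  have dec: "decseq (\<lambda>n. H (Suc n) / real (Suc n))"
  proof (rule decseq_SucI)
    fix n
    show "H (Suc (Suc n)) / real (Suc (Suc n)) \<le> H (Suc n) / real (Suc n)"
      using key[of "Suc n"] by (simp add: divide_simps) (simp add: algebra_simps)
  qed
  obtain L where L: "(\<lambda>n. H (Suc n) / real (Suc n)) \<longlonglongrightarrow> L" "\<And>n. L \<le> H (Suc n) / real (Suc n)"
    using decseq_convergent[OF dec, of 0] nonneg by auto
  from L(1) have lim: "(\<lambda>n. H n / real n) \<longlonglongrightarrow> L"
    using LIMSEQ_imp_Suc[of "\<lambda>n. H n / real n" L] by simp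
  have L_eq: "L = entropy_rate M T f"
    unfolding entropy_rate_def using limI[OF lim] by (simp add: H_def)
  show "(\<lambda>n. shannon M (itinerary T f n) / real n) \<longlonglongrightarrow> entropy_rate M T f"
    using lim by (simp add: L_eq[symmetric] H_def)
  show "0 \<le> entropy_rate M T f"
    unfolding L_eq[symmetric] using L(1) by (rule LIMSEQ_le_const) (auto intro!: exI[of _ 0] divide_nonneg_nonneg nonneg)
  show "real n * entropy_rate M T f \<le> shannon M (itinerary T f n)"
  proof (cases n)
    case (Suc m)
    then show ?thesis using L(2)[of m] by (simp add: L_eq H_def field_simps)
  qed (simp add: shannon_itinerary_0)
qed

text \<open>The bridge from entropies of partitions, in which the theorem is stated, to itineraries:
  cells of the refined partition are level sets of the boolean itinerary.\<close>

lemma partition_entropy_eq_rate: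
  assumes A: "A \<in> sets M"
  shows "partition_entropy M T {A, space M - A} = entropy_rate M T (\<lambda>x. x \<in> A)"
proof -
  have "static_entropy M (refined_partition M T {A, space M - A} n) =
      shannon M (itinerary T (\<lambda>x. x \<in> A) n)" for n
  proof -
    let ?I = "itinerary T (\<lambda>x. x \<in> A) n"
    let ?cell = "\<lambda>w. ?I -` {w} \<inter> space M"
    let ?W = "{w :: bool list. length w = n}"
    have fin: "finite ?W" using finite_lists_length_eq[of "UNIV :: bool set" n] by simp
    have cell: "?cell w = {x \<in> space M. \<forall>i<n. (T ^^ i) x \<in> f i}"
      if w: "length w = n" and f: "\<And>i. i < n \<Longrightarrow> f i = (if w ! i then A else space M - A)" for w f
    proof (rule set_eqI)
      fix x
      have "?I x = w \<longleftrightarrow> (\<forall>i<n. (T ^^ i) x \<in> f i)" if x: "x \<in> space M"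
      proof -
        have "?I x = w \<longleftrightarrow> (\<forall>i<n. ((T ^^ i) x \<in> A) = w ! i)"
          using w by (simp add: itinerary_def list_eq_iff_nth_eq)
        moreover have "((T ^^ i) x \<in> A) = w ! i \<longleftrightarrow> (T ^^ i) x \<in> f i" if "i < n" for i
          using T_pow_space[OF x, of i] f[OF that] by (cases "w ! i") auto
        ultimately show ?thesis by blast
      qed
      then show "x \<in> ?cell w \<longleftrightarrow> x \<in> {x \<in> space M. \<forall>i<n. (T ^^ i) x \<in> f i}"
        by blast
    qed
    have "refined_partition M T {A, space M - A} n = ?cell ` ?W"
    proof (intro equalityI subsetI)
      fix C assume "C \<in> refined_partition M T {A, space M - A} n"
      then obtain f where f: "C = {x \<in> space M. \<forall>i<n. (T ^^ i) x \<in> f i}"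
          "\<forall>i<n. f i \<in> {A, space M - A}"
        unfolding refined_partition_def by auto
      have "C = ?cell (map (\<lambda>i. f i = A) [0..<n])"
        unfolding f(1) by (rule cell[symmetric]) (use f(2) in auto)
      then show "C \<in> ?cell ` ?W" by (rule image_eqI) simp
    next
      fix C assume "C \<in> ?cell ` ?W"
      then obtain w where w: "length w = n" "C = ?cell w" by auto
      show "C \<in> refined_partition M T {A, space M - A} n"
        unfolding refined_partition_def w(2)
        by (intro CollectI exI[of _ "\<lambda>i. if w ! i then A else space M - A"] conjI cell[OF w(1)]) auto
    qed
    then have "static_entropy M (refined_partition M T {A, space M - A} n) =
        - (\<Sum>C\<in>?cell ` ?W. prob C * ln (prob C))"
      by (simp add: static_entropy_def)
    also have "(\<Sum>C\<in>?cell ` ?W. prob C * ln (prob C)) = (\<Sum>w\<in>?W. prob (?cell w) * ln (prob (?cell w)))"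
    \<comment> \<open>Different words give the same cell only if that cell is empty, and then its
      term is 0.\<close>
    proof (rule sum.reindex_nontrivial[OF fin, unfolded comp_def])
      fix v w :: "bool list" assume "v \<noteq> w" "?cell v = ?cell w"
      then have "?cell v = {}" by blast
      then show "prob (?cell v) * ln (prob (?cell v)) = 0" by simp
    qed
    also have "- \<dots> = shannon M ?I"
      by (rule shannon_eq_sum[symmetric, OF simple_function_itinerary[OF simple_function_mem[OF A]] fin])
        (auto simp: itinerary_def)
    finally show ?thesis .
  qed
  then show ?thesis by (simp add: partition_entropy_def entropy_rate_def)
qed

text \<open>If all gaps were at least \<open>e / 2\<close>, so would be the rate. A small gap is a
  small conditional entropy of \<open>x \<in> A\<close> given the itinerary of \<open>T x\<close>,
  and the majority vote turns it into a prediction of \<open>A\<close> from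
  \<open>T x\<close>.\<close>

lemma zero_rate_approx:
  assumes A: "A \<in> sets M" and zero: "entropy_rate M T (\<lambda>x. x \<in> A) = 0" and e: "0 < e"
  obtains B where "B \<in> sets M" "prob {x \<in> space M. (x \<in> A) \<noteq> (T x \<in> B)} < e"
proof -
  let ?I = "itinerary T (\<lambda>x. x \<in> A)"
  let ?H = "\<lambda>n. shannon M (?I n)"
  note sA = simple_function_mem[OF A] and sI = simple_function_itinerary[OF simple_function_mem[OF A]]
  have "\<exists>n. ?H (Suc n) - ?H n < e / 2"
  proof (rule ccontr)
    assume "\<nexists>n. ?H (Suc n) - ?H n < e / 2"
    then have step: "e / 2 \<le> ?H (Suc n) - ?H n" for n by (simp add: not_less)
    have "real n * (e / 2) \<le> ?H n" for n
    proof (induction n)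
      case (Suc n)
      then show ?case using step[of n] by (simp add: algebra_simps)
    qed (simp add: shannon_itinerary_0)
    then have "e / 2 \<le> ?H n / real n" if "1 \<le> n" for n
      using that by (simp add: field_simps)
    then have "e / 2 \<le> entropy_rate M T (\<lambda>x. x \<in> A)"
      by (intro LIMSEQ_le_const[OF entropy_rate_limit(1)[OF sA]]) auto
    then show False using zero e by simp
  qed
  then obtain n where n: "?H (Suc n) - ?H n < e / 2" by blast
  let ?W = "\<lambda>x. ?I n (T x)"
  have W: "simple_function M ?W" by (rule simple_function_vimage[OF measurable_T sI])
  obtain V where V: "prob {x \<in> space M. (x \<in> A) \<noteq> (?W x \<in> V)} * ln 2 \<le>
      shannon M (\<lambda>x. (x \<in> A, ?W x)) - shannon M ?W"
    using prob_mismatch_le_entropy_gap[OF A W] by blast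
  have "shannon M (\<lambda>x. (x \<in> A, ?W x)) \<le> ?H (Suc n)"
  proof (rule shannon_mono[OF sI])
    fix x x' assume "?I (Suc n) x = ?I (Suc n) x'"
    then have *: "((T ^^ i) x \<in> A) = ((T ^^ i) x' \<in> A)" if "i < Suc n" for i
      using that by (simp add: itinerary_eq_iff)
    show "(x \<in> A, ?W x) = (x' \<in> A, ?W x')"
      using *[of 0] *[of "Suc _"] by (auto simp: itinerary_eq_iff funpow_swap1)
  qed
  then have le: "prob {x \<in> space M. (x \<in> A) \<noteq> (?W x \<in> V)} * ln 2 < e / 2"
    using V n shannon_T[OF sI, of n] by linarith
  \<comment> \<open>The crude bound \<open>ln 2 \<ge> 1 / 2\<close> is the reason for asking for a
    gap below \<open>e / 2\<close>.\<close>
  have "1 / 2 \<le> ln (2 :: real)" using ln_le_minus_one[of "1 / 2 :: real"] by (simp add: ln_div)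
  then have "prob {x \<in> space M. (x \<in> A) \<noteq> (?W x \<in> V)} * (1 / 2) \<le>
      prob {x \<in> space M. (x \<in> A) \<noteq> (?W x \<in> V)} * ln 2"
    by (intro mult_left_mono) auto
  then have "prob {x \<in> space M. (x \<in> A) \<noteq> (?W x \<in> V)} < e" using le by linarith
  moreover have "{x \<in> space M. (x \<in> A) \<noteq> (?W x \<in> V)} =
      {x \<in> space M. (x \<in> A) \<noteq> (T x \<in> ?I n -` V \<inter> space M)}"
    using measurable_space[OF measurable_T] by auto
  ultimately show thesis
    using that[of "?I n -` V \<inter> space M"] simple_functionD(2)[OF sI] by simp
qed

lemma entropy_rate_AE_T:
  assumes A: "A \<in> sets M" and B: "B \<in> sets M" and eq: "AE x in M. x \<in> A \<longleftrightarrow> T x \<in> B"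
  shows "entropy_rate M T (\<lambda>x. x \<in> B) = entropy_rate M T (\<lambda>x. x \<in> A)"
proof -
  have "shannon M (itinerary T (\<lambda>x. x \<in> A) n) = shannon M (itinerary T (\<lambda>x. x \<in> B) n)" for n
  proof -
    note sA = simple_function_itinerary[OF simple_function_mem[OF A]]
    note sB = simple_function_itinerary[OF simple_function_mem[OF B]]
    have "AE x in M. \<forall>i. (T ^^ i) x \<in> A \<longleftrightarrow> (T ^^ i) (T x) \<in> B"
      unfolding AE_all_countable using AE_T_pow[OF eq] by (simp add: funpow_swap1)
    then have "AE x in M. itinerary T (\<lambda>x. x \<in> A) n x = itinerary T (\<lambda>x. x \<in> B) n (T x)"
      by eventually_elim (simp add: itinerary_def)
    then show ?thesis
      using shannon_AE_cong[OF sA simple_function_vimage[OF measurable_T sB]] shannon_T[OF sB] by simp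
  qed
  then show ?thesis by (simp add: entropy_rate_def)
qed

text \<open>The predictions \<open>B n\<close> have error below \<open>(1 / 2) ^ n\<close>, a
  summable sequence, so by Borel-Cantelli almost every \<open>x\<close> is eventually predicted
  correctly and the lower limit \<open>C\<close> of the \<open>B n\<close> predicts exactly. The
  orbit of \<open>T x\<close> relative to \<open>C\<close> repeats that of \<open>x\<close> relative
  to \<open>A\<close>, so \<open>C\<close> has zero rate too and the step can be iterated.\<close>

lemma zero_rate_future:
  assumes A: "A \<in> sets M" and zero: "entropy_rate M T (\<lambda>x. x \<in> A) = 0"
  obtains B where "B \<in> sets M" "AE x in M. x \<in> A \<longleftrightarrow> T x \<in> B" "entropy_rate M T (\<lambda>x. x \<in> B) = 0"
proof -
  have "\<exists>B. B \<in> sets M \<and> prob {x \<in> space M. (x \<in> A) \<noteq> (T x \<in> B)} < (1 / 2) ^ n" for n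
    using zero_rate_approx[OF A zero, of "(1 / 2) ^ n"] by auto
  then obtain B where B: "\<And>n. B n \<in> sets M"
      "\<And>n. prob {x \<in> space M. (x \<in> A) \<noteq> (T x \<in> B n)} < (1 / 2) ^ n"
    by metis
  have [measurable]: "A \<in> sets M" "B n \<in> sets M" for n by (fact A, fact B(1))
  define C where "C = {x \<in> space M. \<exists>N. \<forall>n\<ge>N. x \<in> B n}"
  have C: "C \<in> sets M" unfolding C_def by measurable
  have "AE x in M. eventually (\<lambda>n. x \<in> space M - {x \<in> space M. (x \<in> A) \<noteq> (T x \<in> B n)}) sequentially"
  proof (rule borel_cantelli_AE1)
    show "{x \<in> space M. (x \<in> A) \<noteq> (T x \<in> B n)} \<in> sets M" for n by measurable
    show "emeasure M {x \<in> space M. (x \<in> A) \<noteq> (T x \<in> B n)} < \<infinity>" for n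
      by (simp add: less_top[symmetric])
    show "summable (\<lambda>n. prob {x \<in> space M. (x \<in> A) \<noteq> (T x \<in> B n)})"
    proof (rule summable_comparison_test'[of "\<lambda>n. (1 / 2) ^ n" 0])
      show "norm (prob {x \<in> space M. (x \<in> A) \<noteq> (T x \<in> B n)}) \<le> (1 / 2) ^ n" for n
        using B(2)[of n] by simp
    qed (simp add: summable_geometric)
  qed
  then have AE: "AE x in M. x \<in> A \<longleftrightarrow> T x \<in> C"
  proof (rule AE_mp, intro AE_I2 impI)
    fix x assume x: "x \<in> space M"
      and "eventually (\<lambda>n. x \<in> space M - {x \<in> space M. (x \<in> A) \<noteq> (T x \<in> B n)}) sequentially"
    then obtain N where N: "\<And>n. n \<ge> N \<Longrightarrow> (x \<in> A) = (T x \<in> B n)"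
      unfolding eventually_sequentially by auto
    then show "x \<in> A \<longleftrightarrow> T x \<in> C"
      using measurable_space[OF measurable_T x] by (auto simp: C_def) (metis max.cobounded1 max.cobounded2)
  qed
  show thesis
    using that[OF C AE] entropy_rate_AE_T[OF A C AE] zero by simp
qed

lemma shannon_itinerary_le:
  assumes f: "simple_function M f"
  shows "shannon M (itinerary T f n) \<le> real n * shannon M f"
proof (induction n)
  case (Suc n)
  note sI = simple_function_itinerary[OF f] and sf = simple_function_vimage[OF measurable_T_pow f]
  have "shannon M (itinerary T f (Suc n)) \<le> shannon M (\<lambda>x. (itinerary T f n x, f ((T ^^ n) x)))"
    by (rule shannon_mono[OF simple_function_Pair[OF sI sf]]) (auto simp: itinerary_def)
  also have "\<dots> \<le> shannon M (itinerary T f n) + shannon M f"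
    using shannon_Pair_le[OF sI sf] shannon_T_pow[OF f] by simp
  also have "\<dots> \<le> real (Suc n) * shannon M f"
    using Suc by (simp add: algebra_simps)
  finally show ?case .
qed (simp add: shannon_itinerary_0)

lemma shannon_itinerary_add_le:
  assumes f: "simple_function M f"
  shows "shannon M (itinerary T f (n + m)) \<le> shannon M (itinerary T f n) + shannon M (itinerary T f m)"
proof -
  note sI = simple_function_itinerary[OF f]
  note sI' = simple_function_vimage[OF measurable_T_pow sI]
  have "shannon M (itinerary T f (n + m)) \<le>
      shannon M (\<lambda>x. (itinerary T f n x, itinerary T f m ((T ^^ n) x)))"
  proof (rule shannon_mono[OF simple_function_Pair[OF sI sI']])
    fix x x' assume "(itinerary T f n x, itinerary T f m ((T ^^ n) x)) =
      (itinerary T f n x', itinerary T f m ((T ^^ n) x'))"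
    then have 1: "\<And>i. i < n \<Longrightarrow> f ((T ^^ i) x) = f ((T ^^ i) x')"
      and 2: "\<And>i. i < m \<Longrightarrow> f ((T ^^ (i + n)) x) = f ((T ^^ (i + n)) x')"
      by (auto simp: itinerary_eq_iff funpow_add)
    have "f ((T ^^ i) x) = f ((T ^^ i) x')" if "i < n + m" for i
      using 1[of i] 2[of "i - n"] that by (cases "i < n") auto
    then show "itinerary T f (n + m) x = itinerary T f (n + m) x'" by (simp add: itinerary_eq_iff)
  qed
  also have "\<dots> \<le> shannon M (itinerary T f n) + shannon M (itinerary T f m)"
    using shannon_Pair_le[OF sI sI'] shannon_T_pow[OF sI] by simp
  finally show ?thesis .
qed

text \<open>The intersection of the preimage algebras of all powers of \<open>T\<close>, each
  completed by null sets; the witness \<open>B\<close> may change with \<open>n\<close>.\<close>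

definition tail_event :: "'x set \<Rightarrow> bool" where
  "tail_event A \<longleftrightarrow> A \<in> sets M \<and> (\<forall>n. \<exists>B\<in>sets M. AE x in M. x \<in> A \<longleftrightarrow> (T ^^ n) x \<in> B)"

text \<open>Iteration of \<open>zero_rate_future\<close>, whose output again has zero rate.\<close>

lemma zero_rate_tail_event:
  assumes A: "A \<in> sets M" and zero: "entropy_rate M T (\<lambda>x. x \<in> A) = 0"
  shows "tail_event A"
proof -
  have "\<exists>B\<in>sets M. (AE x in M. x \<in> A \<longleftrightarrow> (T ^^ n) x \<in> B) \<and> entropy_rate M T (\<lambda>x. x \<in> B) = 0" for n
  proof (induction n)
    case 0
    then show ?case using A zero by (intro bexI[of _ A]) auto
  next
    case (Suc n)
    then obtain B where B: "B \<in> sets M" "AE x in M. x \<in> A \<longleftrightarrow> (T ^^ n) x \<in> B"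
        "entropy_rate M T (\<lambda>x. x \<in> B) = 0" by blast
    obtain C where C: "C \<in> sets M" "AE x in M. x \<in> B \<longleftrightarrow> T x \<in> C"
        "entropy_rate M T (\<lambda>x. x \<in> C) = 0"
      by (rule zero_rate_future[OF B(1,3)])
    have "AE x in M. x \<in> A \<longleftrightarrow> (T ^^ Suc n) x \<in> C"
      using B(2) AE_T_pow[OF C(2), of n] by eventually_elim simp
    then show ?case using C by blast
  qed
  then show ?thesis using A unfolding tail_event_def by blast
qed

end

section \<open>Entropy of invariant events\<close>

lemma shift_pow: "(shift ^^ n) x i = x (i + n)"
  by (induction n arbitrary: i) (auto simp: shift_def)

locale shift_system = stationary \<mu> shift for \<mu> :: "(nat \<Rightarrow> 'a::finite) measure" +
  assumes sets_\<mu>: "sets \<mu> = sets (seq_space UNIV)"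
begin

lemma space_\<mu>[simp]: "space \<mu> = UNIV"
  using sets_eq_imp_space_eq[OF sets_\<mu>] by (simp add: space_seq_space)

lemma measurable_coord[measurable]: "(\<lambda>x. x i) \<in> measurable \<mu> (count_space UNIV)"
  unfolding measurable_cong_sets[OF sets_\<mu> refl] seq_space_def by measurable

lemma simple_function_coord: "simple_function \<mu> (\<lambda>x. x i)"
  by (simp add: simple_function_eq_measurable)

abbreviation word :: "nat \<Rightarrow> (nat \<Rightarrow> 'a) \<Rightarrow> 'a list" where
  "word n \<equiv> itinerary shift (\<lambda>x. x 0) n"

lemma word_eq: "word n x = map x [0..<n]"
  by (simp add: itinerary_def shift_pow)

lemma simple_function_word: "simple_function \<mu> (word n)"
  by (rule simple_function_itinerary[OF simple_function_coord])

lemma sets_word: "{x. word n x \<in> W} \<in> sets \<mu>"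
  using simple_functionD(2)[OF simple_function_word, of n W] by (simp add: vimage_def)

section \<open>Approximation of events by conditions on finite words\<close>

definition cylinder_approx :: "(nat \<Rightarrow> 'a) set \<Rightarrow> bool" where
  "cylinder_approx E \<longleftrightarrow> E \<in> sets \<mu> \<and> (\<forall>e>0. \<exists>n W. prob {x. (x \<in> E) \<noteq> (word n x \<in> W)} < e)"

lemma sets_mismatch: "E \<in> sets \<mu> \<Longrightarrow> {x. (x \<in> E) \<noteq> (word n x \<in> W)} \<in> sets \<mu>"
proof -
  assume E: "E \<in> sets \<mu>"
  have "{x. (x \<in> E) \<noteq> (word n x \<in> W)} = (E - {x. word n x \<in> W}) \<union> ({x. word n x \<in> W} - E)" by auto
  then show ?thesis using E sets_word[of n W] by auto
qed

lemma cylinder_approx_Un: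
  assumes "cylinder_approx A" "cylinder_approx B"
  shows "cylinder_approx (A \<union> B)"
  unfolding cylinder_approx_def
proof (intro conjI allI impI)
  have A: "A \<in> sets \<mu>" and B: "B \<in> sets \<mu>" using assms by (auto simp: cylinder_approx_def)
  then show "A \<union> B \<in> sets \<mu>" by simp
  fix e :: real assume "0 < e"
  then have "0 < e / 2" by simp
  obtain m V where V: "prob {x. (x \<in> A) \<noteq> (word m x \<in> V)} < e / 2"
    using assms(1) \<open>0 < e / 2\<close> unfolding cylinder_approx_def by blast
  obtain n W where W: "prob {x. (x \<in> B) \<noteq> (word n x \<in> W)} < e / 2"
    using assms(2) \<open>0 < e / 2\<close> unfolding cylinder_approx_def by blast
  let ?U = "{w. take m w \<in> V \<or> take n w \<in> W}"
  have "prob {x. (x \<in> A \<union> B) \<noteq> (word (m + n) x \<in> ?U)} \<le>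
      prob ({x. (x \<in> A) \<noteq> (word m x \<in> V)} \<union> {x. (x \<in> B) \<noteq> (word n x \<in> W)})"
    using sets_mismatch A B by (intro finite_measure_mono) (auto simp: word_eq take_map)
  also have "\<dots> \<le> prob {x. (x \<in> A) \<noteq> (word m x \<in> V)} + prob {x. (x \<in> B) \<noteq> (word n x \<in> W)}"
    using sets_mismatch A B by (intro measure_Un_le)
  also have "\<dots> < e" using V W by simp
  finally show "\<exists>n W. prob {x. (x \<in> A \<union> B) \<noteq> (word n x \<in> W)} < e" by blast
qed

text \<open>Induction over the generation of the product \<sigma>-algebra. For a countable union,
  half of \<open>e\<close> pays for truncation to a finite union and half for approximating the
  latter.\<close>

lemma cylinder_approx:
  assumes "E \<in> sets \<mu>"
  shows "cylinder_approx E"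
proof -
  have "E \<in> sigma_sets (UNIV \<rightarrow>\<^sub>E UNIV) {{f \<in> UNIV \<rightarrow>\<^sub>E UNIV. f i \<in> A} | i A. i \<in> UNIV \<and> A \<in> sets (count_space (UNIV :: 'a set))}"
    using assms unfolding sets_\<mu> seq_space_def sets_PiM_single by simp
  then show ?thesis
  proof (induction rule: sigma_sets.induct)
    case (Basic a)
    then obtain i A where a: "a = {x. x i \<in> A}" by auto
    have "a = {x. word (Suc i) x \<in> {w. w ! i \<in> A}}"
      by (auto simp: a word_eq nth_append)
    then show ?case
      using sets_word[of "Suc i" "{w. w ! i \<in> A}"] unfolding cylinder_approx_def
      by (intro conjI allI impI exI[of _ "Suc i"] exI[of _ "{w. w ! i \<in> A}"]) auto
  next
    case Empty
    show ?case unfolding cylinder_approx_def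
      by (intro conjI allI impI exI[of _ 0] exI[of _ "{} :: 'a list set"]) auto
  next
    case (Compl a)
    show ?case unfolding cylinder_approx_def
    proof (intro conjI allI impI)
      show "(UNIV \<rightarrow>\<^sub>E UNIV) - a \<in> sets \<mu>"
        using Compl sets.compl_sets[of a \<mu>] by (auto simp: cylinder_approx_def)
      fix e :: real assume "0 < e"
      then obtain n W where W: "prob {x. (x \<in> a) \<noteq> (word n x \<in> W)} < e"
        using Compl unfolding cylinder_approx_def by blast
      have eq: "{x. (x \<in> (UNIV \<rightarrow>\<^sub>E UNIV) - a) \<noteq> (word n x \<in> - W)} =
          {x. (x \<in> a) \<noteq> (word n x \<in> W)}" by auto
      show "\<exists>n W. prob {x. (x \<in> (UNIV \<rightarrow>\<^sub>E UNIV) - a) \<noteq> (word n x \<in> W)} < e"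
        by (intro exI[of _ n] exI[of _ "- W"]) (unfold eq, rule W)
    qed
  next
    case (Union a)
    have a: "a i \<in> sets \<mu>" for i using Union by (auto simp: cylinder_approx_def)
    have fin: "cylinder_approx (\<Union>i\<le>N. a i)" for N :: nat
      by (induction N) (use Union in \<open>auto simp: atMost_Suc intro: cylinder_approx_Un\<close>)
    show ?case unfolding cylinder_approx_def
    proof (intro conjI allI impI)
      show Ua: "(\<Union>i. a i) \<in> sets \<mu>" using a by auto
      fix e :: real assume e: "0 < e"
      have "(\<lambda>N. prob (\<Union>i\<le>N. a i)) \<longlonglongrightarrow> prob (\<Union>N. \<Union>i\<le>N. a i)"
        using a by (intro finite_Lim_measure_incseq) (auto simp: incseq_def intro: order_trans)
      moreover have "(\<Union>N. \<Union>i\<le>N. a i) = (\<Union>i. a i)" by auto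
      ultimately have "(\<lambda>N. prob (\<Union>i\<le>N. a i)) \<longlonglongrightarrow> prob (\<Union>i. a i)" by simp
      then have "\<forall>\<^sub>F N in sequentially. prob (\<Union>i. a i) - e / 2 < prob (\<Union>i\<le>N. a i)"
        by (rule order_tendstoD) (use e in simp)
      then obtain N where N: "prob (\<Union>i. a i) - e / 2 < prob (\<Union>i\<le>N. a i)"
        unfolding eventually_sequentially by blast
      obtain n W where W: "prob {x. (x \<in> (\<Union>i\<le>N. a i)) \<noteq> (word n x \<in> W)} < e / 2"
        using fin[of N] e half_gt_zero[OF e] unfolding cylinder_approx_def by blast
      have Na: "(\<Union>i\<le>N. a i) \<in> sets \<mu>" using a by auto
      have "prob {x. (x \<in> (\<Union>i. a i)) \<noteq> (word n x \<in> W)} \<le>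
          prob (((\<Union>i. a i) - (\<Union>i\<le>N. a i)) \<union> {x. (x \<in> (\<Union>i\<le>N. a i)) \<noteq> (word n x \<in> W)})"
        using sets_mismatch[OF Na] Ua Na by (intro finite_measure_mono) auto
      also have "\<dots> \<le> prob ((\<Union>i. a i) - (\<Union>i\<le>N. a i)) + prob {x. (x \<in> (\<Union>i\<le>N. a i)) \<noteq> (word n x \<in> W)}"
        using sets_mismatch[OF Na] Ua Na by (intro measure_Un_le) auto
      also have "prob ((\<Union>i. a i) - (\<Union>i\<le>N. a i)) = prob (\<Union>i. a i) - prob (\<Union>i\<le>N. a i)"
        using Ua Na by (intro finite_measure_Diff) auto
      finally show "\<exists>n W. prob {x. (x \<in> (\<Union>i. a i)) \<noteq> (word n x \<in> W)} < e"
        using N W by (intro exI[of _ n] exI[of _ W]) linarith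
    qed
  qed
qed

end

section \<open>Words, columns and events invariant under the automaton\<close>

locale ca_system = shift_system \<mu> + CA: stationary \<mu> \<tau>
  for \<mu> :: "(nat \<Rightarrow> 'a::finite) measure" and \<tau> +
  fixes r :: "'a \<Rightarrow> 'a \<Rightarrow> 'a"
  assumes \<tau>_eq: "\<tau> x i = r (x i) (x (Suc i))"
    and bij_left: "bij (\<lambda>b. r b a)"
    and bij_right: "bij (\<lambda>b. r a b)"
begin

lemma r_left_cancel: "r b a = r b' a \<longleftrightarrow> b = b'"
  using bij_is_inj[OF bij_left[of a]] by (auto dest: injD)

lemma r_right_cancel: "r a b = r a b' \<longleftrightarrow> b = b'"
  using bij_is_inj[OF bij_right[of a]] by (auto dest: injD)

lemma \<tau>_shift: "\<tau> (shift x) = shift (\<tau> x)"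
  by (auto simp: \<tau>_eq shift_def)

lemma \<tau>_shift_pow: "\<tau> ((shift ^^ n) x) = (shift ^^ n) (\<tau> x)"
  by (induction n) (auto simp: \<tau>_shift)

lemma \<tau>_pow_shift: "(\<tau> ^^ m) (shift x) = shift ((\<tau> ^^ m) x)"
  by (induction m) (auto simp: \<tau>_shift)

lemma \<tau>_pow_Suc: "(\<tau> ^^ Suc j) x i = r ((\<tau> ^^ j) x i) ((\<tau> ^^ j) x (Suc i))"
  by (simp add: \<tau>_eq[of "(\<tau> ^^ j) x"])

abbreviation column :: "nat \<Rightarrow> (nat \<Rightarrow> 'a) \<Rightarrow> 'a list" where
  "column n \<equiv> itinerary \<tau> (\<lambda>x. x 0) n"

text \<open>Row \<open>j\<close> at position \<open>i\<close> depends only on the coordinates from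
  \<open>i\<close> to \<open>i + j\<close>, so the triangle above a word of length \<open>n\<close>
  is known.\<close>

lemma column_determined:
  assumes "word n x = word n x'"
  shows "column n x = column n x'"
proof -
  have *: "x i = x' i" if "i < n" for i
    using assms that by (simp add: itinerary_eq_iff shift_pow)
  have "i + j < n \<Longrightarrow> (\<tau> ^^ j) x i = (\<tau> ^^ j) x' i" for i j
    by (induction j arbitrary: i) (auto simp: \<tau>_eq *)
  from this[of 0] show ?thesis by (simp add: itinerary_eq_iff)
qed

text \<open>Permutativity in the right argument fills the triangle sideways: two consecutive entries
  of column \<open>i\<close> determine, by cancelling in \<open>r\<close>, the entry of column
  \<open>i + 1\<close> next to the first of them.\<close>

lemma word_determined:
  assumes "column n x = column n x'"
  shows "word n x = word n x'"
proof -
  have *: "(\<tau> ^^ j) x 0 = (\<tau> ^^ j) x' 0" if "j < n" for j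
    using assms that by (simp add: itinerary_eq_iff)
  have "i + j < n \<Longrightarrow> (\<tau> ^^ j) x i = (\<tau> ^^ j) x' i" for i j
  proof (induction i arbitrary: j)
    case (Suc i)
    have "(\<tau> ^^ Suc j) x i = (\<tau> ^^ Suc j) x' i" and "(\<tau> ^^ j) x i = (\<tau> ^^ j) x' i"
      using Suc.IH[of "Suc j"] Suc.IH[of j] Suc.prems by auto
    then show ?case unfolding \<tau>_pow_Suc by (simp add: r_right_cancel)
  qed (simp add: *)
  from this[of _ 0] show ?thesis by (simp add: itinerary_eq_iff shift_pow)
qed

lemma simple_function_column: "simple_function \<mu> (column n)"
  by (rule CA.simple_function_itinerary[OF simple_function_coord])

lemma shannon_column: "shannon \<mu> (column n) = shannon \<mu> (word n)"
  by (intro antisym shannon_mono simple_function_word simple_function_column)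
    (auto intro: column_determined word_determined)

abbreviation "h \<equiv> entropy_rate \<mu> shift (\<lambda>x. x 0)"

text \<open>A column of length \<open>n * k\<close> splits into \<open>k\<close> blocks that have the same joint distribution with the
  invariant function \<open>g\<close>, and for large \<open>k\<close> the bounded loss \<open>shannon \<mu> g\<close> is negligible per block.\<close>

lemma column_entropy_invariant:
  assumes g: "simple_function \<mu> g" and inv: "AE x in \<mu>. g (\<tau> x) = g x"
  shows "real n * h \<le> shannon \<mu> (\<lambda>x. (column n x, g x)) - shannon \<mu> g" (is "_ \<le> ?D")
proof -
  have inv_pow: "AE x in \<mu>. g ((\<tau> ^^ m) x) = g x" for m
  proof (induction m)
    case (Suc m)
    show ?case using Suc CA.AE_T_pow[OF inv, of m] by eventually_elim simp
  qed simp
  note sC = simple_function_column and sC' = simple_function_vimage[OF CA.measurable_T_pow simple_function_column]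
  \<comment> \<open>Submodularity over \<open>g\<close> splits off the first \<open>n\<close>
    entries. Since \<open>g\<close> is invariant, the remaining \<open>n * k\<close> entries
    together with \<open>g\<close> have the law of the initial column of that length with
    \<open>g\<close>, so each block adds at most \<open>?D\<close>.\<close>
  have block: "shannon \<mu> (\<lambda>x. (column (n * k) x, g x)) - shannon \<mu> g \<le> real k * ?D" for k
  proof (induction k)
    case 0
    have "shannon \<mu> (\<lambda>x. (column 0 x, g x)) \<le> shannon \<mu> g"
      by (rule shannon_mono[OF g]) (auto simp: itinerary_def)
    then show ?case by simp
  next
    case (Suc k)
    let ?Y = "\<lambda>x. column (n * k) ((\<tau> ^^ n) x)"
    have "shannon \<mu> (\<lambda>x. (column (n * Suc k) x, g x)) \<le> shannon \<mu> (\<lambda>x. (column n x, ?Y x, g x))"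
    proof (rule shannon_mono[OF simple_function_Pair[OF sC simple_function_Pair[OF sC' g]]])
      fix x x' assume "(column n x, ?Y x, g x) = (column n x', ?Y x', g x')"
      then have 1: "\<And>i. i < n \<Longrightarrow> (\<tau> ^^ i) x 0 = (\<tau> ^^ i) x' 0"
        and 2: "\<And>i. i < n * k \<Longrightarrow> (\<tau> ^^ (i + n)) x 0 = (\<tau> ^^ (i + n)) x' 0" and 3: "g x = g x'"
        by (auto simp: itinerary_eq_iff funpow_add)
      have "(\<tau> ^^ i) x 0 = (\<tau> ^^ i) x' 0" if "i < n * Suc k" for i
        using 1[of i] 2[of "i - n"] that by (cases "i < n") auto
      then show "(column (n * Suc k) x, g x) = (column (n * Suc k) x', g x')"
        using 3 by (simp add: itinerary_eq_iff)
    qed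
    moreover have "shannon \<mu> (\<lambda>x. (?Y x, g x)) = shannon \<mu> (\<lambda>x. (column (n * k) x, g x))"
    proof -
      let ?Q = "\<lambda>x. (column (n * k) x, g x)"
      note sQ = simple_function_Pair[OF sC g]
      have "shannon \<mu> (\<lambda>x. (?Y x, g x)) = shannon \<mu> (\<lambda>x. ?Q ((\<tau> ^^ n) x))"
        using inv_pow[of n]
        by (intro shannon_AE_cong simple_function_Pair sC' g simple_function_vimage[OF CA.measurable_T_pow g]) auto
      then show ?thesis using CA.shannon_T_pow[OF sQ] by simp
    qed
    moreover note shannon_submodular[OF sC sC' g, of n "n * k" n] Suc
    ultimately show ?case by (simp add: algebra_simps)
  qed
  have bound: "real k * (real n * h - ?D) \<le> shannon \<mu> g" for k
  proof -
    have "real (n * k) * h \<le> shannon \<mu> (column (n * k))"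
      using entropy_rate_limit(3)[OF simple_function_coord, of "n * k"] by (simp add: shannon_column)
    also have "\<dots> \<le> shannon \<mu> (\<lambda>x. (column (n * k) x, g x))"
      by (rule shannon_mono[OF simple_function_Pair[OF sC g]]) simp
    finally show ?thesis using block[of k] by (simp add: algebra_simps)
  qed
  show ?thesis
  proof (rule ccontr)
    assume "\<not> ?thesis"
    then have "0 < real n * h - ?D" by simp
    from reals_Archimedean3[OF this] obtain k where "shannon \<mu> g < real k * (real n * h - ?D)"
      by blast
    then show False using bound[of k] by simp
  qed
qed

text \<open>As \<tau> commutes with the shift, the whole itinerary \<open>?G n\<close> of
  \<open>E\<close> under the shift is \<tau>-invariant, so column and \<open>?G n\<close> together
  have entropy at least \<open>n * h\<close> plus that of \<open>?G n\<close>. But both are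
  determined by a word of length \<open>n + m\<close> and the times at which a guess of
  \<open>E\<close> from \<open>m\<close> symbols fails, which costs about \<open>n * h\<close> plus
  \<open>n * e\<close>. Hence \<open>?G n\<close> has entropy rate at most \<open>e\<close>.\<close>

lemma invariant_zero_rate:
  assumes E: "E \<in> sets \<mu>" and inv: "AE x in \<mu>. \<tau> x \<in> E \<longleftrightarrow> x \<in> E"
  shows "entropy_rate \<mu> shift (\<lambda>x. x \<in> E) = 0"
proof -
  let ?G = "itinerary shift (\<lambda>x. x \<in> E)"
  note sE = simple_function_mem[OF E]
  note sG = simple_function_itinerary[OF sE] and sW = simple_function_word and sC = simple_function_column
  have le: "entropy_rate \<mu> shift (\<lambda>x. x \<in> E) \<le> e" if e: "0 < e" for e
  proof -
    \<comment> \<open>Chosen so that the bound \<open>3 * sqrt\<close> of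
      \<open>shannon_mem_le\<close> gives entropy at most \<open>e\<close> for the failure event
      \<open>D\<close>.\<close>
    have "0 < (e / 3)\<^sup>2" using e by simp
    then obtain m W where W: "prob {x. (x \<in> E) \<noteq> (word m x \<in> W)} < (e / 3)\<^sup>2"
      using cylinder_approx[OF E] unfolding cylinder_approx_def by blast
    define D where "D = {x. (x \<in> E) \<noteq> (word m x \<in> W)}"
    have D: "D \<in> sets \<mu>" unfolding D_def by (rule sets_mismatch[OF E])
    note sD = simple_function_mem[OF D]
    have "sqrt (prob D) < e / 3"
      using W e unfolding D_def[symmetric] by (intro real_less_lsqrt) auto
    then have HD: "shannon \<mu> (\<lambda>x. x \<in> D) \<le> e"
      using shannon_mem_le[OF D] by simp
    have key: "shannon \<mu> (?G n) / real n \<le> shannon \<mu> (word n) / real n - h + shannon \<mu> (word m) / real n + e"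
      if n: "1 \<le> n" for n
    proof -
      have G_inv: "AE x in \<mu>. ?G n (\<tau> x) = ?G n x"
      proof -
        have "AE x in \<mu>. \<forall>i. (shift ^^ i) (\<tau> x) \<in> E \<longleftrightarrow> (shift ^^ i) x \<in> E"
          unfolding AE_all_countable using AE_T_pow[OF inv] by (simp add: \<tau>_shift_pow)
        then show ?thesis by eventually_elim (simp add: itinerary_def)
      qed
      have "real n * h \<le> shannon \<mu> (\<lambda>x. (column n x, ?G n x)) - shannon \<mu> (?G n)"
        by (rule column_entropy_invariant[OF sG G_inv])
      also have "shannon \<mu> (\<lambda>x. (column n x, ?G n x)) \<le>
          shannon \<mu> (\<lambda>x. (word (n + m) x, itinerary shift (\<lambda>x. x \<in> D) n x))"
      proof (rule shannon_mono[OF simple_function_Pair[OF sW simple_function_itinerary[OF sD]]])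
        fix x x' assume "(word (n + m) x, itinerary shift (\<lambda>x. x \<in> D) n x) =
            (word (n + m) x', itinerary shift (\<lambda>x. x \<in> D) n x')"
        then have w: "\<And>i. i < n + m \<Longrightarrow> x i = x' i"
          and d: "\<And>i. i < n \<Longrightarrow> (shift ^^ i) x \<in> D \<longleftrightarrow> (shift ^^ i) x' \<in> D"
          by (auto simp: itinerary_eq_iff shift_pow)
        have "word m ((shift ^^ i) x) = word m ((shift ^^ i) x')" if "i < n" for i
          using w that by (simp add: itinerary_eq_iff shift_pow)
        then have "(shift ^^ i) x \<in> E \<longleftrightarrow> (shift ^^ i) x' \<in> E" if "i < n" for i
          using d[OF that] that unfolding D_def by auto
        moreover have "word n x = word n x'" using w by (simp add: itinerary_eq_iff shift_pow)
        then have "column n x = column n x'" by (rule column_determined)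
        ultimately show "(column n x, ?G n x) = (column n x', ?G n x')"
          by (simp add: itinerary_eq_iff)
      qed
      also have "\<dots> \<le> shannon \<mu> (word (n + m)) + shannon \<mu> (itinerary shift (\<lambda>x. x \<in> D) n)"
        by (rule shannon_Pair_le[OF sW simple_function_itinerary[OF sD]])
      also have "\<dots> \<le> shannon \<mu> (word n) + shannon \<mu> (word m) + real n * e"
      proof -
        have "real n * shannon \<mu> (\<lambda>x. x \<in> D) \<le> real n * e"
          using HD by (intro mult_left_mono) auto
        then show ?thesis
          using shannon_itinerary_add_le[OF simple_function_coord[of 0], of n m] shannon_itinerary_le[OF sD, of n]
          by linarith
      qed
      finally show ?thesis using n by (simp add: field_simps)
    qed
    have "(\<lambda>n. shannon \<mu> (word n) / real n - h + shannon \<mu> (word m) / real n + e) \<longlonglongrightarrow> h - h + 0 + e"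
      by (intro tendsto_intros entropy_rate_limit(1)[OF simple_function_coord] lim_const_over_n)
    then have "(\<lambda>n. shannon \<mu> (word n) / real n - h + shannon \<mu> (word m) / real n + e) \<longlonglongrightarrow> e"
      by simp
    then show ?thesis
      by (rule LIMSEQ_le[OF entropy_rate_limit(1)[OF sE]]) (use key in blast)
  qed
  have "entropy_rate \<mu> shift (\<lambda>x. x \<in> E) \<le> 0"
    by (rule field_le_epsilon) (use le in simp)
  then show ?thesis using entropy_rate_limit(2)[OF sE] by simp
qed

end

section \<open>Conditional probabilities given the future\<close>

lemma eq_upd_0_iff: "y = x(0 := a) \<longleftrightarrow> y 0 = a \<and> (\<forall>i. y (Suc i) = x (Suc i))"
proof (intro iffI ext)
  fix i assume "y 0 = a \<and> (\<forall>i. y (Suc i) = x (Suc i))"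
  then show "y i = (x(0 := a)) i" by (cases i) auto
qed auto

locale shift_kernel = shift_system \<mu> for \<mu> :: "(nat \<Rightarrow> 'a::finite) measure" +
  fixes \<kappa> :: "(nat \<Rightarrow> 'a) \<Rightarrow> (nat \<Rightarrow> 'a) measure"
  assumes cond_prob: "conditional_probability \<mu> (shift_preimage_algebra \<mu>) \<kappa>"
begin

definition F :: "(nat \<Rightarrow> 'a) measure" where "F = shift_preimage_algebra \<mu>"

lemma space_F[simp]: "space F = UNIV"
  by (simp add: F_def)

lemma subalgebra_F: "subalgebra \<mu> F" and measurable_\<kappa>: "\<kappa> \<in> measurable F (prob_algebra \<mu>)"
  and cond_prob_AE: "E \<in> sets \<mu> \<Longrightarrow> AE x in \<mu>. measure (\<kappa> x) E = real_cond_exp \<mu> F (indicator E) x"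
  using cond_prob unfolding conditional_probability_def F_def by blast+

sublocale cond: finite_measure_subalgebra \<mu> F
  by unfold_locales (rule subalgebra_F)

lemma measurable_F_imp[measurable_dest]: "f \<in> measurable F N \<Longrightarrow> f \<in> measurable \<mu> N"
  by (rule measurable_from_subalg[OF subalgebra_F])

lemma measurable_shift_F[measurable]: "shift \<in> measurable F \<mu>"
  unfolding F_def by (rule measurable_vimage_algebra1) simp

lemma measurable_coord_F[measurable]: "(\<lambda>x. x (Suc i)) \<in> measurable F (count_space UNIV)"
  using measurable_compose[OF measurable_shift_F measurable_coord, of i] by (simp add: shift_def)

lemma prob_space_\<kappa>: "prob_space (\<kappa> x)" and sets_\<kappa>: "sets (\<kappa> x) = sets \<mu>"
  using measurable_space[OF measurable_\<kappa>, of x] by (auto simp: space_prob_algebra)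

lemma space_\<kappa>[simp]: "space (\<kappa> x) = UNIV"
  using sets_eq_imp_space_eq[OF sets_\<kappa>, of x] by simp

text \<open>Taking the mass of a single point makes \<open>a \<in> Lambda_set \<kappa> x\<close>
  equivalent to \<open>0 < k a x\<close> at every \<open>x\<close>. That this is the conditional
  probability of the symbol \<open>a\<close> holds almost surely, see
  \<open>k_eq_\<kappa>\<close>.\<close>

definition k :: "'a \<Rightarrow> (nat \<Rightarrow> 'a) \<Rightarrow> real" where
  "k a x = measure (\<kappa> x) {x(0 := a)}"

text \<open>The measured point moves with \<open>x\<close>, so measurability of \<kappa> at fixed
  events is not enough; the graph of the moving point is a measurable subset of the product.\<close>

lemma measurable_k[measurable]: "k a \<in> borel_measurable F"
proof -
  have 1: "(SIGMA x:space F. {x(0 := a)}) =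
      {p \<in> space (F \<Otimes>\<^sub>M \<mu>). snd p 0 = a \<and> (\<forall>i. snd p (Suc i) = fst p (Suc i))}"
    by (auto simp: space_pair_measure eq_upd_0_iff)
  have "(SIGMA x:space F. {x(0 := a)}) \<in> sets (F \<Otimes>\<^sub>M \<mu>)"
    unfolding 1 by measurable
  moreover have "\<kappa> \<in> measurable F (subprob_algebra \<mu>)"
    by (rule measurable_prob_algebraD[OF measurable_\<kappa>])
  ultimately show ?thesis
    unfolding k_def[abs_def] by (rule measure_measurable_subprob_algebra2)
qed

text \<open>Events determined by \<open>shift\<close> have conditional probability 0 or 1, according
  to whether they hold at \<open>x\<close>. Countably many word events separate the values of
  \<open>shift\<close>, so one null set serves them all.\<close>

lemma AE_\<kappa>_fiber: "AE x in \<mu>. AE y in \<kappa> x. shift y = shift x"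
proof -
  have S: "{y. word n (shift y) = w} \<in> sets F" for n w
    using measurable_sets[OF measurable_shift_F sets_word[of n "{w}"]] by (simp add: vimage_def)
  have "AE x in \<mu>. \<forall>n w. measure (\<kappa> x) {y. word n (shift y) = w} = indicator {y. word n (shift y) = w} x"
    unfolding AE_all_countable
  proof (intro allI)
    fix n w
    let ?S = "{y. word n (shift y) = w}"
    have "AE x in \<mu>. real_cond_exp \<mu> F (indicator ?S) x = indicator ?S x"
    proof (rule cond.real_cond_exp_F_meas)
      have "?S \<in> sets \<mu>" using S subalgebra_F by (auto simp: subalgebra_def)
      then show "integrable \<mu> (indicator ?S :: _ \<Rightarrow> real)" by (simp add: less_top[symmetric])
      show "(indicator ?S :: _ \<Rightarrow> real) \<in> borel_measurable F"
        using S by (rule borel_measurable_indicator)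
    qed
    moreover have "AE x in \<mu>. measure (\<kappa> x) ?S = real_cond_exp \<mu> F (indicator ?S) x"
      using S subalgebra_F by (intro cond_prob_AE) (auto simp: subalgebra_def)
    ultimately show "AE x in \<mu>. measure (\<kappa> x) ?S = indicator ?S x"
      by eventually_elim simp
  qed
  then show ?thesis
  proof eventually_elim
    case (elim x)
    interpret K: prob_space "\<kappa> x" by (rule prob_space_\<kappa>)
    have "AE y in \<kappa> x. \<forall>n. word n (shift y) = word n (shift x)"
      unfolding AE_all_countable
    proof
      fix n
      have "{y. word n (shift y) = word n (shift x)} \<in> sets (\<kappa> x)"
        using S[of n "word n (shift x)"] subalgebra_F by (auto simp: subalgebra_def sets_\<kappa>)
      moreover have "K.prob {y. word n (shift y) = word n (shift x)} = 1"
        using elim by simp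
      ultimately show "AE y in \<kappa> x. word n (shift y) = word n (shift x)"
        using K.prob_Collect_eq_1[of "\<lambda>y. word n (shift y) = word n (shift x)"] by simp
    qed
    then show ?case
    proof eventually_elim
      case (elim y)
      show ?case
      proof
        fix i show "shift y i = shift x i"
          using elim[rule_format, of "Suc i"] by (simp add: itinerary_eq_iff shift_pow)
      qed
    qed
  qed
qed

lemma sets_coord: "{x. x i = a} \<in> sets \<mu>"
  using measurable_sets[OF measurable_coord[of i], of "{a}"] by (simp add: vimage_def)

text \<open>On the fibre of \<open>shift x\<close>, fixing the symbol at 0 fixes the point.\<close>

lemma k_eq_\<kappa>: "AE x in \<mu>. \<forall>a. k a x = measure (\<kappa> x) {y. y 0 = a}"
  using AE_\<kappa>_fiber
proof eventually_elim
  case (elim x)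
  interpret K: prob_space "\<kappa> x" by (rule prob_space_\<kappa>)
  show ?case
  proof
    fix a
    have "{y \<in> space \<mu>. y 0 = a \<and> (\<forall>i. y (Suc i) = x (Suc i))} \<in> sets \<mu>" by measurable
    moreover have "{x(0 := a)} = {y \<in> space \<mu>. y 0 = a \<and> (\<forall>i. y (Suc i) = x (Suc i))}"
      by (auto simp: eq_upd_0_iff)
    ultimately have 1: "{x(0 := a)} \<in> sets (\<kappa> x)" by (simp add: sets_\<kappa>)
    show "k a x = measure (\<kappa> x) {y. y 0 = a}"
      unfolding k_def
    proof (rule K.finite_measure_eq_AE)
      show "AE y in \<kappa> x. y \<in> {x(0 := a)} \<longleftrightarrow> y \<in> {y. y 0 = a}"
        using elim
      proof eventually_elim
        case (elim y)
        then have "y (Suc i) = x (Suc i)" for i by (metis shift_def)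
        then have "y = x(0 := a)" if "y 0 = a"
          using that by (simp add: eq_upd_0_iff)
        then show ?case by auto
      qed
    qed (use 1 sets_coord[of 0 a] in \<open>simp_all add: sets_\<kappa>\<close>)
  qed
qed

lemma k_nonneg: "0 \<le> k a x" and k_le_1: "k a x \<le> 1"
  unfolding k_def using prob_space.prob_le_1[OF prob_space_\<kappa>] by auto

lemma AE_sum_k: "AE x in \<mu>. (\<Sum>a\<in>UNIV. k a x) = 1"
  using k_eq_\<kappa>
proof eventually_elim
  case (elim x)
  interpret K: prob_space "\<kappa> x" by (rule prob_space_\<kappa>)
  have "(\<Sum>a\<in>UNIV. k a x) = (\<Sum>a\<in>UNIV. K.prob {y. y 0 = a})" using elim by simp
  also have "\<dots> = K.prob (\<Union>a\<in>UNIV. {y. y 0 = a})"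
    by (rule K.finite_measure_finite_Union[symmetric])
      (auto simp: disjoint_family_on_def sets_\<kappa> intro: sets_coord)
  also have "(\<Union>a\<in>UNIV. {y. y 0 = a}) = space (\<kappa> x)" by auto
  finally show ?case by (simp only: K.prob_space)
qed

lemma bounded_integrable:
  fixes g :: "(nat \<Rightarrow> 'a) \<Rightarrow> real"
  assumes "g \<in> borel_measurable \<mu>" "\<And>x. \<bar>g x\<bar> \<le> B"
  shows "integrable \<mu> g"
  by (rule integrable_const_bound[where B = B]) (use assms in auto)

lemma integral_k:
  assumes g[measurable]: "g \<in> borel_measurable F" and B: "\<And>x. \<bar>g x\<bar> \<le> B"
  shows "(\<integral>x. g x * k a x \<partial>\<mu>) = (\<integral>x. g x * of_bool (x 0 = a) \<partial>\<mu>)"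
proof -
  let ?i = "indicator {x. x 0 = a} :: _ \<Rightarrow> real"
  have i[measurable]: "?i \<in> borel_measurable \<mu>" using sets_coord[of 0 a] by simp
  have "AE x in \<mu>. k a x = real_cond_exp \<mu> F ?i x"
    using k_eq_\<kappa> cond_prob_AE[OF sets_coord[of 0 a]] by eventually_elim simp
  then have "(\<integral>x. g x * k a x \<partial>\<mu>) = (\<integral>x. g x * real_cond_exp \<mu> F ?i x \<partial>\<mu>)"
    by (intro integral_cong_AE) auto
  also have "\<dots> = (\<integral>x. g x * ?i x \<partial>\<mu>)"
  proof (rule cond.real_cond_exp_intg(2)[OF _ g i])
    show "integrable \<mu> (\<lambda>x. g x * ?i x)"
    proof (rule bounded_integrable[where B = B])
      show "\<bar>g x * ?i x\<bar> \<le> B" for x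
        using B[of x] by (auto simp: indicator_def intro: order_trans[OF abs_ge_zero])
    qed measurable
  qed
  also have "\<dots> = (\<integral>x. g x * of_bool (x 0 = a) \<partial>\<mu>)"
    by (intro Bochner_Integration.integral_cong) (auto simp: indicator_def)
  finally show ?thesis .
qed

text \<open>Turns a fact about the symbol actually seen into one about all symbols of the fibre: by
  \<open>integral_k\<close> the mean of \<open>k a\<close> over the future event \<open>P\<close> is
  the probability of \<open>P\<close> together with \<open>x 0 = a\<close>, which is 0.\<close>

lemma AE_k_zero:
  assumes P[measurable]: "Measurable.pred F P" and AE: "AE x in \<mu>. x 0 = a \<longrightarrow> \<not> P x"
  shows "AE x in \<mu>. P x \<longrightarrow> k a x = 0"
proof -
  have "(\<integral>x. of_bool (P x) * k a x \<partial>\<mu>) = (\<integral>x. of_bool (P x) * of_bool (x 0 = a) \<partial>\<mu>)"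
    by (rule integral_k[where B = 1]) auto
  also have "\<dots> = (\<integral>x. 0 \<partial>\<mu>)"
    using AE by (intro integral_cong_AE) auto
  finally have "(\<integral>x. of_bool (P x) * k a x \<partial>\<mu>) = 0" by simp
  moreover have "integrable \<mu> (\<lambda>x. of_bool (P x) * k a x)"
    by (rule bounded_integrable[where B = 1]) (use k_nonneg k_le_1 in \<open>auto simp: abs_of_nonneg\<close>)
  ultimately have "AE x in \<mu>. of_bool (P x) * k a x = 0"
    using k_nonneg by (subst (asm) integral_nonneg_eq_0_iff_AE) auto
  then show ?thesis by eventually_elim auto
qed

text \<open>Testing \<open>integral_k\<close> against the future event \<open>k a x = 0\<close>
  shows that there the symbol \<open>a\<close> is almost never seen.\<close>

lemma AE_k_pos: "AE x in \<mu>. 0 < k (x 0) x"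
proof -
  have "AE x in \<mu>. x 0 = a \<longrightarrow> k a x \<noteq> 0" for a
  proof -
    have "(\<integral>x. of_bool (k a x = 0) * of_bool (x 0 = a) \<partial>\<mu>) = (\<integral>x. of_bool (k a x = 0) * k a x \<partial>\<mu>)"
      by (rule integral_k[where B = 1, symmetric]) auto
    also have "\<dots> = (\<integral>x. 0 \<partial>\<mu>)"
      by (intro Bochner_Integration.integral_cong) auto
    finally have "(\<integral>x. of_bool (k a x = 0) * of_bool (x 0 = a) \<partial>\<mu>) = (0 :: real)" by simp
    moreover have "integrable \<mu> (\<lambda>x. of_bool (k a x = 0) * of_bool (x 0 = a) :: real)"
      by (rule bounded_integrable[where B = 1]) auto
    ultimately have "AE x in \<mu>. of_bool (k a x = 0) * of_bool (x 0 = a) = (0 :: real)"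
      by (subst (asm) integral_nonneg_eq_0_iff_AE) auto
    then show ?thesis by eventually_elim auto
  qed
  then have "AE x in \<mu>. \<forall>a. x 0 = a \<longrightarrow> k a x \<noteq> 0" unfolding AE_all_countable by blast
  then show ?thesis by eventually_elim (use k_nonneg in \<open>auto simp: less_le\<close>)
qed

end

section \<open>Transport of the conditional weights by the automaton, and their uniformity\<close>

locale ca_kernel = ca_system \<mu> \<tau> r + shift_kernel \<mu> \<kappa>
  for \<mu> :: "(nat \<Rightarrow> 'a::finite) measure" and \<tau> r \<kappa>
begin

text \<open>\<open>shift (\<tau> x)\<close> equals \<open>\<tau> (shift x)\<close> and is therefore
  known once \<open>shift x\<close> is.\<close>

lemma measurable_\<tau>_F[measurable]: "\<tau> \<in> measurable F F"
  unfolding F_def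
proof (rule measurable_vimage_algebra2)
  show "(\<lambda>x. shift (\<tau> x)) \<in> measurable (shift_preimage_algebra \<mu>) \<mu>"
    unfolding \<tau>_shift[symmetric] F_def[symmetric]
    by (rule measurable_compose[OF measurable_shift_F CA.measurable_T])
qed auto

text \<open>The conditional distribution of \<open>(\<tau> x)\<^sub>0\<close> given \<open>shift (\<tau> x)\<close> is a projection of the one given
  the finer information \<open>shift x\<close>; as both have the same \<open>L\<^sup>2\<close> norm by invariance, they coincide.\<close>

lemma AE_k_\<tau>: "AE x in \<mu>. \<forall>a. k (r a (x 1)) (\<tau> x) = k a x"
proof -
  let ?r = "\<lambda>a b x. of_bool (r a (x (Suc 0)) = b) :: real"
  \<comment> \<open>Both are conditional probabilities of \<open>\<tau> x 0 = b\<close>: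
    \<open>Z\<close> given \<open>shift (\<tau> x)\<close>, \<open>Q\<close> given
    \<open>shift x\<close>. The latter is explicit, since \<open>x 1\<close> is known there.\<close>
  define Z where "Z b x = k b (\<tau> x)" for b x
  define Q where "Q b x = (\<Sum>a\<in>UNIV. ?r a b x * k a x)" for b x
  have [measurable]: "Z b \<in> borel_measurable F" "Q b \<in> borel_measurable F" for b
    unfolding Z_def[abs_def] Q_def[abs_def] by measurable
  have Zb: "\<bar>Z b x\<bar> \<le> 1" for b x
    using k_nonneg[of b "\<tau> x"] k_le_1[of b "\<tau> x"] by (simp add: Z_def)
  have Q_r: "Q (r a (x (Suc 0))) x = k a x" for a x
    unfolding Q_def r_left_cancel by (simp add: of_bool_def if_distrib[of "\<lambda>c. c * _"] sum.delta cong: if_cong)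
  have surj: "\<exists>a. b = r a c" for b c
    using bij_is_surj[OF bij_left[of c]] by (auto simp: surj_def)
  have Q_val: "\<exists>a. Q b x = k a x" for b x
    using surj[of b "x (Suc 0)"] Q_r by metis
  have Qb: "\<bar>Q b x\<bar> \<le> 1" for b x
    using Q_val[of b x] k_nonneg k_le_1 by (metis abs_of_nonneg)
  have prod_le: "\<bar>u * v\<bar> \<le> 1" if "\<bar>u\<bar> \<le> 1" "\<bar>v\<bar> \<le> (1 :: real)" for u v
    using mult_mono[OF that] by (simp add: abs_mult)
  have kb: "\<bar>k b x\<bar> \<le> 1" for b x using k_nonneg[of b x] k_le_1[of b x] by simp
  have int: "integrable \<mu> (\<lambda>x. Z b x * Z b x)" "integrable \<mu> (\<lambda>x. Z b x * Q b x)"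
    "integrable \<mu> (\<lambda>x. Q b x * Q b x)" "integrable \<mu> (\<lambda>x. k b x * k b x)" for b
    by (auto intro!: bounded_integrable[OF _ prod_le] Zb Qb kb simp del: abs_mult abs_mult_self_eq)
  have comp: "(\<integral>x. f (\<tau> x) \<partial>\<mu>) = (\<integral>x. f x \<partial>\<mu>)" if "f \<in> borel_measurable \<mu>" for f :: "_ \<Rightarrow> real"
    using integral_distr[OF CA.measurable_T that] by (simp add: CA.distr_T)
  have ZZ: "(\<integral>x. Z b x * Z b x \<partial>\<mu>) = (\<integral>x. k b x * k b x \<partial>\<mu>)" for b
    using comp[of "\<lambda>x. k b x * k b x"] by (simp add: Z_def)
  \<comment> \<open>As \<open>Z\<close> and the factors \<open>?r\<close> are
    \<open>F\<close>-measurable, each weight \<open>k a\<close> in \<open>Q\<close> may be replaced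
    by the event \<open>x 0 = a\<close>, which gives the event \<open>\<tau> x 0 = b\<close>.
    Invariance under \<tau> removes \<tau>, and \<open>integral_k\<close> is then read
    backwards.\<close>
  have ZQ: "(\<integral>x. Z b x * Q b x \<partial>\<mu>) = (\<integral>x. k b x * k b x \<partial>\<mu>)" for b
  proof -
    have rb: "\<bar>Z b x * ?r a b x\<bar> \<le> 1" for a x
      by (rule prod_le[OF Zb]) simp
    have "(\<integral>x. Z b x * Q b x \<partial>\<mu>) = (\<integral>x. (\<Sum>a\<in>UNIV. (Z b x * ?r a b x) * k a x) \<partial>\<mu>)"
      by (simp only: Q_def sum_distrib_left mult.assoc)
    also have "\<dots> = (\<Sum>a\<in>UNIV. \<integral>x. (Z b x * ?r a b x) * k a x \<partial>\<mu>)"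
      using prod_le[OF rb kb] by (intro Bochner_Integration.integral_sum bounded_integrable[where B = 1]) auto
    also have "\<dots> = (\<Sum>a\<in>UNIV. \<integral>x. (Z b x * ?r a b x) * of_bool (x 0 = a) \<partial>\<mu>)"
      using rb by (intro sum.cong refl integral_k[where B = 1]) auto
    also have "\<dots> = (\<integral>x. (\<Sum>a\<in>UNIV. (Z b x * ?r a b x) * of_bool (x 0 = a)) \<partial>\<mu>)"
    proof (rule Bochner_Integration.integral_sum[symmetric], rule bounded_integrable)
      show "\<bar>(Z b x * ?r a b x) * of_bool (x 0 = a)\<bar> \<le> 1" for a x
        by (rule prod_le[OF rb]) simp
    qed measurable
    also have "\<dots> = (\<integral>x. Z b x * of_bool (\<tau> x 0 = b) \<partial>\<mu>)"
      by (intro Bochner_Integration.integral_cong)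
        (auto simp: \<tau>_eq of_bool_def if_distrib[of "\<lambda>c. _ * c"] sum.delta cong: if_cong)
    also have "\<dots> = (\<integral>x. k b x * of_bool (x 0 = b) \<partial>\<mu>)"
      unfolding Z_def by (rule comp[of "\<lambda>x. k b x * of_bool (x 0 = b)"]) measurable
    also have "\<dots> = (\<integral>x. k b x * k b x \<partial>\<mu>)"
      using kb by (intro integral_k[where B = 1, symmetric]) auto
    finally show ?thesis .
  qed
  \<comment> \<open>For fixed \<open>x\<close> the values \<open>Q b x\<close> are a permutation of
    the values \<open>k b x\<close>, by left permutativity; so the norms are compared only after
    summing over \<open>b\<close>.\<close>
  have QQ: "(\<Sum>b\<in>UNIV. \<integral>x. Q b x * Q b x \<partial>\<mu>) = (\<Sum>b\<in>UNIV. \<integral>x. k b x * k b x \<partial>\<mu>)"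
  proof -
    have eq: "(\<Sum>b\<in>UNIV. Q b x * Q b x) = (\<Sum>b\<in>UNIV. k b x * k b x)" for x
      by (subst sum.reindex_bij_betw[OF bij_left[of "x (Suc 0)"], symmetric]) (simp add: Q_r)
    have "(\<Sum>b\<in>UNIV. \<integral>x. Q b x * Q b x \<partial>\<mu>) = (\<integral>x. (\<Sum>b\<in>UNIV. Q b x * Q b x) \<partial>\<mu>)"
      by (rule Bochner_Integration.integral_sum[symmetric], rule int(3))
    also have "\<dots> = (\<Sum>b\<in>UNIV. \<integral>x. k b x * k b x \<partial>\<mu>)"
      unfolding eq by (rule Bochner_Integration.integral_sum, rule int(4))
    finally show ?thesis .
  qed
  have "(\<Sum>b\<in>UNIV. \<integral>x. (Z b x - Q b x)\<^sup>2 \<partial>\<mu>) =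
      (\<Sum>b\<in>UNIV. (\<integral>x. Z b x * Z b x \<partial>\<mu>) - 2 * (\<integral>x. Z b x * Q b x \<partial>\<mu>) + (\<integral>x. Q b x * Q b x \<partial>\<mu>))"
  proof (intro sum.cong refl)
    fix b
    have "(\<integral>x. (Z b x - Q b x)\<^sup>2 \<partial>\<mu>) = (\<integral>x. Z b x * Z b x - 2 * (Z b x * Q b x) + Q b x * Q b x \<partial>\<mu>)"
      by (intro Bochner_Integration.integral_cong) (auto simp: power2_eq_square algebra_simps)
    also have "\<dots> = (\<integral>x. Z b x * Z b x \<partial>\<mu>) - 2 * (\<integral>x. Z b x * Q b x \<partial>\<mu>) + (\<integral>x. Q b x * Q b x \<partial>\<mu>)"
      using int[of b] by simp
    finally show "(\<integral>x. (Z b x - Q b x)\<^sup>2 \<partial>\<mu>) = \<dots>" .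
  qed
  also have "\<dots> = 0"
    unfolding sum.distrib sum_subtractf QQ ZZ ZQ by (simp add: sum_distrib_left[symmetric])
  finally have "(\<Sum>b\<in>UNIV. \<integral>x. (Z b x - Q b x)\<^sup>2 \<partial>\<mu>) = 0" .
  then have zero: "(\<integral>x. (Z b x - Q b x)\<^sup>2 \<partial>\<mu>) = 0" for b
    by (subst (asm) sum_nonneg_eq_0_iff) auto
  have "AE x in \<mu>. Z b x = Q b x" for b
  proof -
    have "integrable \<mu> (\<lambda>x. (Z b x - Q b x)\<^sup>2)"
      using int[of b] by (simp add: power2_diff power2_eq_square[of "Z b _"] power2_eq_square[of "Q b _"] mult.assoc)
    then have "AE x in \<mu>. (Z b x - Q b x)\<^sup>2 = 0"
      using zero[of b] by (subst (asm) integral_nonneg_eq_0_iff_AE) auto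
    then show ?thesis by eventually_elim simp
  qed
  then have "AE x in \<mu>. \<forall>b. Z b x = Q b x" by (simp add: AE_all_countable)
  then show ?thesis
    by eventually_elim (simp add: Z_def Q_r)
qed

text \<open>The sublevel sets of \<open>x \<mapsto> k (x 0) x\<close> are \<open>\<tau>\<close>-invariant, hence of zero entropy, hence they do not
  depend on the coordinate \<open>x 0\<close>.\<close>

lemma AE_k_uniform: "AE x in \<mu>. \<forall>a b. 0 < k a x \<longrightarrow> 0 < k b x \<longrightarrow> k a x = k b x"
proof -
  \<comment> \<open>The witness \<open>s\<close> is \<open>shift x \<in> B\<close>: the future alone
    decides on which side of \<open>c\<close> the weight of the actual symbol lies, so by
    \<open>AE_k_zero\<close> all positive weights of the fibre lie on that side.\<close>
  have dich: "AE x in \<mu>. \<exists>s. \<forall>a. (\<not> s \<and> k a x \<le> c \<longrightarrow> k a x = 0) \<and> (s \<and> c < k a x \<longrightarrow> k a x = 0)" for c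
  proof -
    define E where "E = {x \<in> space \<mu>. \<forall>a. x 0 = a \<longrightarrow> k a x \<le> c}"
    have E: "E \<in> sets \<mu>" unfolding E_def by measurable
    have E_iff: "x \<in> E \<longleftrightarrow> k (x 0) x \<le> c" for x by (simp add: E_def)
    have "AE x in \<mu>. \<tau> x \<in> E \<longleftrightarrow> x \<in> E"
      using AE_k_\<tau> by eventually_elim (simp add: E_iff \<tau>_eq)
    then have "entropy_rate \<mu> shift (\<lambda>x. x \<in> E) = 0" by (rule invariant_zero_rate[OF E])
    then obtain B where B[measurable]: "B \<in> sets \<mu>" and EB: "AE x in \<mu>. x \<in> E \<longleftrightarrow> shift x \<in> B"
      by (rule zero_rate_future[OF E])
    have "AE x in \<mu>. shift x \<notin> B \<and> k a x \<le> c \<longrightarrow> k a x = 0" for a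
    proof (rule AE_k_zero)
      show "AE x in \<mu>. x 0 = a \<longrightarrow> \<not> (shift x \<notin> B \<and> k a x \<le> c)"
        using EB by eventually_elim (auto simp: E_iff)
    qed measurable
    moreover have "AE x in \<mu>. shift x \<in> B \<and> c < k a x \<longrightarrow> k a x = 0" for a
    proof (rule AE_k_zero)
      show "AE x in \<mu>. x 0 = a \<longrightarrow> \<not> (shift x \<in> B \<and> c < k a x)"
        using EB by eventually_elim (auto simp: E_iff)
    qed measurable
    ultimately have "AE x in \<mu>. \<forall>a. (shift x \<notin> B \<and> k a x \<le> c \<longrightarrow> k a x = 0) \<and>
        (shift x \<in> B \<and> c < k a x \<longrightarrow> k a x = 0)"
      unfolding AE_all_countable by simp
    then show ?thesis by eventually_elim (rule exI)
  qed
  \<comment> \<open>Rational thresholds suffice to separate two different weights and keep the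
    exceptional sets countable in number.\<close>
  have "AE x in \<mu>. \<forall>q :: rat. \<exists>s. \<forall>a. (\<not> s \<and> k a x \<le> of_rat q \<longrightarrow> k a x = 0) \<and>
      (s \<and> of_rat q < k a x \<longrightarrow> k a x = 0)"
    unfolding AE_all_countable using dich by blast
  then show ?thesis
  proof eventually_elim
    case (elim x)
    have False if ab: "0 < k a x" "k a x < k b x" for a b
    proof -
      obtain q where q: "k a x < of_rat q" "of_rat q < k b x"
        using of_rat_dense[OF ab(2)] by blast
      obtain s where s: "\<And>a. (\<not> s \<and> k a x \<le> of_rat q \<longrightarrow> k a x = 0) \<and> (s \<and> of_rat q < k a x \<longrightarrow> k a x = 0)"
        using elim by blast
      show False using s[of a] s[of b] q ab by (cases s) auto
    qed
    then show ?case by (metis linorder_less_linear)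
  qed
qed

text \<open>Equal positive weights with sum 1 are reciprocals of their number. This discharges the
  assumption of \<open>uniform_kernel\<close>.\<close>

lemma AE_k_Lambda:
  "AE x in \<mu>. Lambda_set \<kappa> x \<noteq> {} \<and> x 0 \<in> Lambda_set \<kappa> x \<and>
    (\<forall>a. k a x = (if a \<in> Lambda_set \<kappa> x then 1 / real (card (Lambda_set \<kappa> x)) else 0))"
  using AE_k_uniform AE_sum_k AE_k_pos
proof eventually_elim
  case (elim x)
  let ?L = "Lambda_set \<kappa> x"
  have L: "a \<in> ?L \<longleftrightarrow> 0 < k a x" for a by (simp add: Lambda_set_def k_def)
  have "1 = (\<Sum>b\<in>?L. k b x)"
    unfolding elim(2)[symmetric] using L k_nonneg
    by (intro sum.mono_neutral_right) (auto intro: antisym)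
  then have "k a x = 1 / real (card ?L)" if a: "a \<in> ?L" for a
  proof -
    have "(\<Sum>b\<in>?L. k b x) = (\<Sum>b\<in>?L. k a x)"
      using elim(1) L a by (intro sum.cong) auto
    moreover have "0 < card ?L" using a by (auto simp: card_gt_0_iff)
    ultimately show ?thesis using \<open>1 = (\<Sum>b\<in>?L. k b x)\<close> a by (subst eq_divide_eq) (auto simp: mult.commute)
  qed
  moreover have "k a x = 0" if "a \<notin> ?L" for a using that L k_nonneg[of a x] by auto
  ultimately show ?case using elim(3) L by auto
qed

end

section \<open>Tail events and the alphabet map\<close>

context stationary
begin

lemma sigma_algebra_tail_event: "sigma_algebra (space M) {A. tail_event A}"
  unfolding sigma_algebra_iff2
proof (intro conjI ballI allI impI)
  show "{A. tail_event A} \<subseteq> Pow (space M)"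
    using sets.sets_into_space by (auto simp: tail_event_def)
  show "{} \<in> {A. tail_event A}"
    by (auto simp: tail_event_def intro!: bexI[of _ "{}"])
next
  fix A assume A: "A \<in> {A. tail_event A}"
  have "\<exists>B\<in>sets M. AE x in M. x \<in> space M - A \<longleftrightarrow> (T ^^ n) x \<in> B" for n
  proof -
    obtain B where B: "B \<in> sets M" "AE x in M. x \<in> A \<longleftrightarrow> (T ^^ n) x \<in> B"
      using A by (auto simp: tail_event_def)
    have "AE x in M. x \<in> space M - A \<longleftrightarrow> (T ^^ n) x \<in> space M - B"
      using B(2) AE_space by eventually_elim (auto simp: T_pow_space)
    then show ?thesis using B(1) by blast
  qed
  then show "space M - A \<in> {A. tail_event A}" using A by (auto simp: tail_event_def)
next
  fix A :: "nat \<Rightarrow> 'x set" assume A: "range A \<subseteq> {A. tail_event A}"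
  have "\<exists>B\<in>sets M. AE x in M. x \<in> (\<Union>i. A i) \<longleftrightarrow> (T ^^ n) x \<in> B" for n
  proof -
    have "\<forall>i. \<exists>B. B \<in> sets M \<and> (AE x in M. x \<in> A i \<longleftrightarrow> (T ^^ n) x \<in> B)"
      using A by (auto simp: tail_event_def)
    from choice[OF this] obtain B where B: "\<And>i. B i \<in> sets M"
        "\<And>i. AE x in M. x \<in> A i \<longleftrightarrow> (T ^^ n) x \<in> B i" by blast
    have "AE x in M. \<forall>i. x \<in> A i \<longleftrightarrow> (T ^^ n) x \<in> B i"
      using B(2) by (simp add: AE_all_countable)
    then have "AE x in M. x \<in> (\<Union>i. A i) \<longleftrightarrow> (T ^^ n) x \<in> (\<Union>i. B i)"
      by eventually_elim auto
    then show ?thesis using B(1) by blast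
  qed
  moreover have "(\<Union>i. A i) \<in> sets M" using A by (auto simp: tail_event_def)
  ultimately show "(\<Union>i. A i) \<in> {A. tail_event A}" by (auto simp: tail_event_def)
qed

definition tail_algebra :: "'x measure" where
  "tail_algebra = sigma (space M) {A. tail_event A}"

lemma space_tail_algebra[simp]: "space tail_algebra = space M"
  and sets_tail_algebra: "sets tail_algebra = {A. tail_event A}"
proof -
  interpret S: sigma_algebra "space M" "{A. tail_event A}" by (rule sigma_algebra_tail_event)
  show "space tail_algebra = space M" "sets tail_algebra = {A. tail_event A}"
    unfolding tail_algebra_def by (auto simp: space_measure_of[OF S.space_closed] S.sets_measure_of_eq)
qed

lemma subalgebra_tail_algebra: "subalgebra M tail_algebra"
  unfolding subalgebra_def sets_tail_algebra by (auto simp: tail_event_def)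

lemma tail_algebra_imp_sets: "A \<in> sets tail_algebra \<Longrightarrow> A \<in> sets M"
  by (auto simp: sets_tail_algebra tail_event_def)

text \<open>The witness \<open>B\<close> for one step is itself a tail event: the witness of
  \<open>A\<close> for \<open>n + 1\<close> steps describes \<open>B\<close> after \<open>n\<close>
  steps along \<open>T x\<close>, and invariance carries this over to \<open>x\<close>.\<close>

lemma tail_event_step:
  assumes A: "A \<in> sets tail_algebra"
  obtains B where "B \<in> sets tail_algebra" "AE x in M. x \<in> A \<longleftrightarrow> T x \<in> B"
proof -
  have tail: "tail_event A" using A by (simp add: sets_tail_algebra)
  obtain B where B: "B \<in> sets M" "AE x in M. x \<in> A \<longleftrightarrow> (T ^^ 1) x \<in> B"
    using tail unfolding tail_event_def by blast
  have "\<exists>C\<in>sets M. AE x in M. x \<in> B \<longleftrightarrow> (T ^^ n) x \<in> C" for n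
  proof -
    obtain C where C[measurable]: "C \<in> sets M" and AC: "AE x in M. x \<in> A \<longleftrightarrow> (T ^^ Suc n) x \<in> C"
      using tail unfolding tail_event_def by blast
    note B(1)[measurable]
    have "AE x in M. (T ^^ 1) x \<in> B \<longleftrightarrow> (T ^^ n) ((T ^^ 1) x) \<in> C"
      using B(2) AC by eventually_elim (simp add: funpow_swap1)
    then have "AE x in M. x \<in> B \<longleftrightarrow> (T ^^ n) x \<in> C"
      by (subst (asm) AE_T_pow_iff) measurable
    then show ?thesis using C by blast
  qed
  then have "B \<in> sets tail_algebra" using B(1) by (simp add: sets_tail_algebra tail_event_def)
  then show thesis using that B(2) by simp
qed

text \<open>Preimages under \<open>S\<close> of the witnesses of \<open>A\<close> are witnesses for
  the preimage of \<open>A\<close>. Used with \<open>S\<close> the automaton.\<close>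

lemma measurable_tail_algebra_commuting:
  assumes S: "stationary M S" and comm: "\<And>x. S (T x) = T (S x)"
  shows "S \<in> measurable tail_algebra tail_algebra"
proof (rule measurableI)
  interpret S: stationary M S by (rule S)
  have comm_pow: "(T ^^ n) (S x) = S ((T ^^ n) x)" for n x
    by (induction n) (auto simp: comm)
  show "S x \<in> space tail_algebra" if "x \<in> space tail_algebra" for x
    using measurable_space[OF S.measurable_T] that by simp
  fix A assume "A \<in> sets tail_algebra"
  then have A: "tail_event A" by (simp add: sets_tail_algebra)
  have "\<exists>B\<in>sets M. AE x in M. x \<in> S -` A \<inter> space M \<longleftrightarrow> (T ^^ n) x \<in> B" for n
  proof -
    obtain B where B: "B \<in> sets M" "AE x in M. x \<in> A \<longleftrightarrow> (T ^^ n) x \<in> B"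
      using A unfolding tail_event_def by blast
    have "AE x in M. x \<in> S -` A \<inter> space M \<longleftrightarrow> (T ^^ n) x \<in> S -` B \<inter> space M"
      using S.AE_T[OF B(2)] AE_space by eventually_elim (auto simp: comm_pow T_pow_space)
    then show ?thesis using measurable_sets[OF S.measurable_T B(1)] by blast
  qed
  moreover have "S -` A \<inter> space M \<in> sets M"
    using A measurable_sets[OF S.measurable_T] by (auto simp: tail_event_def)
  ultimately show "S -` A \<inter> space tail_algebra \<in> sets tail_algebra"
    by (auto simp: sets_tail_algebra tail_event_def)
qed

end

lemma measurable_shift_seq_space[measurable]: "shift \<in> measurable (seq_space S) (seq_space S)"
  unfolding seq_space_def shift_def[abs_def] by (rule measurable_PiM_single') (auto simp: space_PiM)

lemma measurable_seq_spaceI: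
  assumes "\<And>i. (\<lambda>x. f x i) \<in> measurable M (count_space S)"
  shows "f \<in> measurable M (seq_space S)"
proof -
  have "f x i \<in> S" if "x \<in> space M" for x i
    using measurable_space[OF assms that] by simp
  then show ?thesis
    unfolding seq_space_def by (intro measurable_PiM_single' assms) (auto simp: PiE_def)
qed

lemma measurable_seq_space_coord: "(\<lambda>x. x i) \<in> measurable (seq_space S) (count_space S)"
  unfolding seq_space_def by measurable

lemma pi_map_nth: "pi_map \<kappa> x i = Lambda_set \<kappa> ((shift ^^ i) x)"
  by (simp add: pi_map_def)

lemma pi_map_shift: "pi_map \<kappa> (shift x) = shift (pi_map \<kappa> x)"
  by (simp add: pi_map_def shift_def[of "\<lambda>i. _ i"] funpow_swap1)

context shift_kernel
begin

lemma measurable_Lambda_F[measurable]: "Lambda_set \<kappa> \<in> measurable F (count_space UNIV)"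
proof -
  have "Lambda_set \<kappa> -` {A} \<inter> space F \<in> sets F" for A
  proof -
    have "Lambda_set \<kappa> -` {A} \<inter> space F = {x \<in> space F. \<forall>a. a \<in> A \<longleftrightarrow> 0 < k a x}"
      by (auto simp: Lambda_set_def k_def)
    also have "\<dots> \<in> sets F" by measurable
    finally show ?thesis .
  qed
  then show ?thesis by (subst measurable_count_space_eq2_countable) auto
qed

lemma measurable_pi_map[measurable]: "pi_map \<kappa> \<in> measurable \<mu> (seq_space UNIV)"
  unfolding pi_map_def
  by (rule measurable_seq_spaceI, rule measurable_compose[OF measurable_T_pow measurable_F_imp])
    (rule measurable_Lambda_F)

lemma stationary_pi_measure: "stationary (pi_measure \<mu> \<kappa>) shift"
proof -
  have "prob_space (pi_measure \<mu> \<kappa>)"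
    unfolding pi_measure_def by (rule prob_space_distr) measurable
  moreover have "shift \<in> measurable (pi_measure \<mu> \<kappa>) (pi_measure \<mu> \<kappa>)"
    unfolding pi_measure_def by measurable
  moreover have "distr (pi_measure \<mu> \<kappa>) (pi_measure \<mu> \<kappa>) shift = pi_measure \<mu> \<kappa>"
  proof -
    have "distr (pi_measure \<mu> \<kappa>) (pi_measure \<mu> \<kappa>) shift = distr (pi_measure \<mu> \<kappa>) (seq_space UNIV) shift"
      by (rule distr_cong) (auto simp: pi_measure_def)
    also have "\<dots> = distr \<mu> (seq_space UNIV) (\<lambda>x. shift (pi_map \<kappa> x))"
      unfolding pi_measure_def by (subst distr_distr) (auto simp: comp_def)
    also have "\<dots> = distr \<mu> (seq_space UNIV) (pi_map \<kappa> \<circ> shift)"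
      by (simp add: comp_def pi_map_shift)
    also have "\<dots> = distr (distr \<mu> \<mu> shift) (seq_space UNIV) (pi_map \<kappa>)"
      by (rule distr_distr[symmetric]) auto
    finally show ?thesis by (simp add: distr_T pi_measure_def)
  qed
  ultimately show ?thesis by (simp add: stationary_def stationary_axioms_def)
qed

end

section \<open>The entropy hypothesis and the law of words inside tail events\<close>

locale zero_entropy_kernel = shift_kernel +
  assumes pi_entropy: "mt_entropy (pi_measure \<mu> \<kappa>) shift = 0"
begin

interpretation N: stationary "pi_measure \<mu> \<kappa>" shift
  by (rule stationary_pi_measure)

text \<open>The entropy hypothesis enters here, through two-set partitions of the factor.
  Itineraries pull back exactly because \<open>pi_map\<close> commutes with the shift at every
  point.\<close>

lemma pi_vimage_zero_rate:
  assumes D: "D \<in> sets (seq_space UNIV)"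
  shows "entropy_rate \<mu> shift (\<lambda>x. x \<in> pi_map \<kappa> -` D) = 0"
proof -
  let ?N = "pi_measure \<mu> \<kappa>"
  have D': "D \<in> sets ?N" using D by (simp add: pi_measure_def)
  have "finite_measurable_partition ?N {D, space ?N - D}"
    using D' sets.sets_into_space[OF D'] by (auto simp: finite_measurable_partition_def disjoint_def)
  then have "ereal (partition_entropy ?N shift {D, space ?N - D}) \<le> mt_entropy ?N shift"
    unfolding mt_entropy_def by (intro SUP_upper) simp
  then have "entropy_rate ?N shift (\<lambda>z. z \<in> D) \<le> 0"
    by (simp add: pi_entropy N.partition_entropy_eq_rate[OF D'])
  moreover have "0 \<le> entropy_rate ?N shift (\<lambda>z. z \<in> D)"
    by (rule N.entropy_rate_limit(2)[OF simple_function_mem[OF D']])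
  moreover have "shannon ?N (itinerary shift (\<lambda>z. z \<in> D) n) =
      shannon \<mu> (itinerary shift (\<lambda>x. x \<in> pi_map \<kappa> -` D) n)" for n
  proof -
    have "(shift ^^ i) (pi_map \<kappa> x) = pi_map \<kappa> ((shift ^^ i) x)" for i x
      by (induction i) (auto simp: pi_map_shift)
    then have eq: "itinerary shift (\<lambda>z. z \<in> D) n (pi_map \<kappa> x) =
        itinerary shift (\<lambda>x. x \<in> pi_map \<kappa> -` D) n x" for x
      by (simp add: itinerary_def)
    have "simple_function (seq_space UNIV) (itinerary shift (\<lambda>z. z \<in> D) n)"
      using N.simple_function_itinerary[OF simple_function_mem[OF D'], of n]
      by (simp add: simple_function_def pi_measure_def)
    then show ?thesis
      unfolding pi_measure_def by (subst shannon_distr) (auto simp: eq)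
  qed
  ultimately show ?thesis by (simp add: entropy_rate_def)
qed

lemma measurable_pi_map_tail[measurable]: "pi_map \<kappa> \<in> measurable tail_algebra (seq_space UNIV)"
proof (rule measurableI)
  fix D :: "(nat \<Rightarrow> 'a set) set" assume D: "D \<in> sets (seq_space UNIV)"
  have "pi_map \<kappa> -` D \<in> sets \<mu>" using measurable_sets[OF measurable_pi_map D] by simp
  then show "pi_map \<kappa> -` D \<inter> space tail_algebra \<in> sets tail_algebra"
    using zero_rate_tail_event[OF _ pi_vimage_zero_rate[OF D]] by (simp add: sets_tail_algebra)
qed (simp add: space_seq_space)

lemma measurable_pi_map_nth_tail[measurable]:
  "(\<lambda>x. pi_map \<kappa> x i) \<in> measurable tail_algebra (count_space UNIV)"
  by (rule measurable_compose[OF measurable_pi_map_tail measurable_seq_space_coord])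

lemma measurable_Lambda_tail[measurable]: "Lambda_set \<kappa> \<in> measurable tail_algebra (count_space UNIV)"
  using measurable_pi_map_nth_tail[of 0] by (simp add: pi_map_nth)

lemma measurable_tail_imp[measurable_dest]: "f \<in> measurable tail_algebra K \<Longrightarrow> f \<in> measurable \<mu> K"
  by (rule measurable_from_subalg[OF subalgebra_tail_algebra])

end

text \<open>The locale assumption is the only consequence of \<open>\<tau>\<close>-invariance that parts (i) and (ii) need.\<close>

locale uniform_kernel = zero_entropy_kernel +
  assumes AE_Lambda: "AE x in \<mu>. Lambda_set \<kappa> x \<noteq> {} \<and> x 0 \<in> Lambda_set \<kappa> x \<and>
    (\<forall>a. k a x = (if a \<in> Lambda_set \<kappa> x then 1 / real (card (Lambda_set \<kappa> x)) else 0))"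
begin

lemma sets_coords: "{x. \<forall>i<n. x i = w i} \<in> sets \<mu>"
proof -
  have "{x \<in> space \<mu>. \<forall>i<n. x i = w i} \<in> sets \<mu>" by measurable
  then show ?thesis by simp
qed

text \<open>Writing \<open>S\<close> as a condition \<open>S'\<close> on \<open>shift x\<close>
  makes everything except \<open>x 0 = w 0\<close> depend on the future only. Then
  \<open>integral_k\<close> replaces that symbol by its weight, which is
  \<open>1 / card (A 0)\<close> on \<open>S\<close>, and the shift reduces the rest to a shorter
  word inside the tail event \<open>S'\<close>.\<close>

lemma prob_word_Int_tail:
  assumes "S \<in> sets tail_algebra" and "AE x in \<mu>. x \<in> S \<longrightarrow> (\<forall>i<n. pi_map \<kappa> x i = A i)"
    and "\<And>i. i < n \<Longrightarrow> w i \<in> A i"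
  shows "prob ({x. \<forall>i<n. x i = w i} \<inter> S) = prob S / (\<Prod>i<n. real (card (A i)))"
  using assms
proof (induction n arbitrary: S A w)
  case 0
  then show ?case by simp
next
  case (Suc n)
  let ?C = "{x. \<forall>i<n. x i = w (Suc i)}"
  obtain S' where S': "S' \<in> sets tail_algebra" and SS': "AE x in \<mu>. x \<in> S \<longleftrightarrow> shift x \<in> S'"
    by (rule tail_event_step[OF Suc.prems(1)])
  have S[measurable]: "S \<in> sets \<mu>" "S' \<in> sets \<mu>"
    using tail_algebra_imp_sets Suc.prems(1) S' by auto
  note sets_coords[of n "\<lambda>i. w (Suc i)", measurable]
  define g where "g x = (of_bool (shift x \<in> ?C \<inter> S') :: real)" for x
  have g[measurable]: "g \<in> borel_measurable F" unfolding g_def[abs_def] by measurable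
  have shift_prob: "prob {x. shift x \<in> B} = prob B" if "B \<in> sets \<mu>" for B
    using emeasure_T_pow_vimage[OF that, of 1] by (simp add: measure_def vimage_def)
  have "prob ({x. \<forall>i<Suc n. x i = w i} \<inter> S) = (\<integral>x. indicator ({x. \<forall>i<Suc n. x i = w i} \<inter> S) x \<partial>\<mu>)"
    using sets_coords by simp
  also have "\<dots> = (\<integral>x. g x * of_bool (x 0 = w 0) \<partial>\<mu>)"
  proof (rule integral_cong_AE)
    show "AE x in \<mu>. indicator ({x. \<forall>i<Suc n. x i = w i} \<inter> S) x = g x * of_bool (x 0 = w 0)"
      using SS' by eventually_elim (auto simp: g_def indicator_def All_less_Suc2 shift_def)
  qed (use sets_coords in measurable)
  also have "\<dots> = (\<integral>x. g x * k (w 0) x \<partial>\<mu>)"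
    by (rule integral_k[where B = 1, symmetric]) (auto simp: g_def)
  also have "\<dots> = (\<integral>x. g x / real (card (A 0)) \<partial>\<mu>)"
  proof (rule integral_cong_AE)
    show "AE x in \<mu>. g x * k (w 0) x = g x / real (card (A 0))"
      using AE_Lambda SS' Suc.prems(2)
    proof eventually_elim
      case (elim x)
      show ?case
      proof (cases "x \<in> S")
        case True
        then have "Lambda_set \<kappa> x = A 0" using elim(3) by (auto simp: pi_map_nth)
        then show ?thesis using elim(1) Suc.prems(3)[of 0] by simp
      qed (use elim(2) in \<open>simp add: g_def\<close>)
    qed
  qed measurable
  also have "\<dots> = prob {x. shift x \<in> ?C \<inter> S'} / real (card (A 0))"
  proof -
    have m: "{x. shift x \<in> ?C \<inter> S'} \<in> sets \<mu>"
      using measurable_sets[OF measurable_T, of "?C \<inter> S'"] sets_coords S by (simp add: vimage_def)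
    have "(\<integral>x. g x \<partial>\<mu>) = (\<integral>x. indicator {x. shift x \<in> ?C \<inter> S'} x \<partial>\<mu>)"
      by (intro Bochner_Integration.integral_cong) (auto simp: g_def indicator_def)
    then show ?thesis using m by simp
  qed
  also have "prob {x. shift x \<in> ?C \<inter> S'} = prob (?C \<inter> S')"
    using sets_coords S by (intro shift_prob) auto
  also have "\<dots> = prob S' / (\<Prod>i<n. real (card (A (Suc i))))"
  proof (rule Suc.IH[OF S'])
    have "AE x in \<mu>. shift x \<in> S' \<longrightarrow> (\<forall>i<n. pi_map \<kappa> (shift x) i = A (Suc i))"
      using SS' Suc.prems(2) by eventually_elim (auto simp: pi_map_shift shift_def[of "pi_map \<kappa> _"])
    then have "AE x in \<mu>. (shift ^^ 1) x \<in> S' \<longrightarrow> (\<forall>i<n. pi_map \<kappa> ((shift ^^ 1) x) i = A (Suc i))"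
      by simp
    then show "AE x in \<mu>. x \<in> S' \<longrightarrow> (\<forall>i<n. pi_map \<kappa> x i = A (Suc i))"
      by (subst (asm) AE_T_pow_iff) measurable
  qed (use Suc.prems(3) in auto)
  also have "prob S' = prob S"
  proof -
    have "prob S = prob {x. shift x \<in> S'}"
      using SS' measurable_sets[OF measurable_T S(2)] by (intro measure_eq_AE) (auto simp: vimage_def)
    then show ?thesis using shift_prob[OF S(2)] by simp
  qed
  finally show ?case by (simp add: prod.lessThan_Suc_shift del: prod.lessThan_Suc)
qed

lemma AE_mem_pi_map: "AE x in \<mu>. \<forall>i. x i \<in> pi_map \<kappa> x i"
proof -
  have "AE x in \<mu>. x 0 \<in> Lambda_set \<kappa> x" using AE_Lambda by eventually_elim simp
  from AE_T_pow[OF this] show ?thesis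
    unfolding AE_all_countable by (simp add: pi_map_nth shift_pow)
qed

end

section \<open>The action of the automaton on subsets and their cardinalities\<close>

locale ca_uniform_kernel = ca_kernel \<mu> \<tau> r \<kappa> + uniform_kernel \<mu> \<kappa>
  for \<mu> :: "(nat \<Rightarrow> 'a::finite) measure" and \<tau> r \<kappa>
begin

lemma measurable_\<tau>_tail[measurable]: "\<tau> \<in> measurable tail_algebra tail_algebra"
  by (rule measurable_tail_algebra_commuting[OF CA.stationary_axioms \<tau>_shift])

text \<open>For the symbol \<open>b = x 1\<close> the formula is the transport of weights. For fixed
  \<open>b\<close>, its failure is a tail event and so ignores \<open>x 1\<close>; since it excludes
  \<open>x 1 = b\<close>, it can occur only where \<open>b\<close> has weight zero at
  \<open>shift x\<close>.\<close>

lemma AE_Lambda_\<tau>: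
  "AE x in \<mu>. \<forall>b\<in>Lambda_set \<kappa> (shift x). Lambda_set \<kappa> (\<tau> x) = (\<lambda>a. r a b) ` Lambda_set \<kappa> x"
proof -
  let ?L = "Lambda_set \<kappa>"
  have L: "a \<in> ?L x \<longleftrightarrow> 0 < k a x" for a x by (simp add: Lambda_set_def k_def)
  have own: "AE x in \<mu>. ?L (\<tau> x) = (\<lambda>a. r a (x 1)) ` ?L x"
    using AE_k_\<tau>
  proof eventually_elim
    case (elim x)
    show ?case
    proof (intro equalityI subsetI)
      fix b assume b: "b \<in> ?L (\<tau> x)"
      obtain a where a: "b = r a (x 1)"
        using bij_is_surj[OF bij_left[of "x 1"]] by (auto simp: surj_def)
      show "b \<in> (\<lambda>a. r a (x 1)) ` ?L x"
        using b elim by (auto simp: a L)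
    qed (use elim in \<open>auto simp: L\<close>)
  qed
  have "AE x in \<mu>. b \<in> ?L (shift x) \<longrightarrow> ?L (\<tau> x) = (\<lambda>a. r a b) ` ?L x" for b
  proof -
    have shift_0: "shift x 0 = x (Suc 0)" for x :: "nat \<Rightarrow> 'a" by (simp add: shift_def)
    define X where "X = {x \<in> space tail_algebra. ?L (\<tau> x) \<noteq> (\<lambda>a. r a b) ` ?L x}"
    have X: "X \<in> sets tail_algebra" unfolding X_def by measurable
    obtain Y where Y: "Y \<in> sets tail_algebra" "AE x in \<mu>. x \<in> X \<longleftrightarrow> shift x \<in> Y"
      by (rule tail_event_step[OF X])
    obtain Z where Z: "Z \<in> sets tail_algebra" "AE x in \<mu>. x \<in> Y \<longleftrightarrow> shift x \<in> Z"
      by (rule tail_event_step[OF Y(1)])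
    have [measurable]: "Z \<in> sets \<mu>" by (rule tail_algebra_imp_sets[OF Z(1)])
    \<comment> \<open>Two shifts are taken because \<open>x 1\<close> is the leading symbol of
      \<open>shift x\<close>, so \<open>AE_k_zero\<close> at \<open>shift x\<close> needs an event
      decided by \<open>shift (shift x)\<close>.\<close>
    have XZ: "AE x in \<mu>. x \<in> X \<longleftrightarrow> shift (shift x) \<in> Z"
      using Y(2) AE_T[OF Z(2)] by eventually_elim simp
    have "AE x in \<mu>. (shift ^^ 1) x 0 = b \<longrightarrow> \<not> shift ((shift ^^ 1) x) \<in> Z"
      using XZ own by eventually_elim (auto simp: X_def shift_0)
    then have "AE x in \<mu>. x 0 = b \<longrightarrow> \<not> shift x \<in> Z"
      by (subst (asm) AE_T_pow_iff) measurable
    then have "AE x in \<mu>. shift x \<in> Z \<longrightarrow> k b x = 0"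
      by (intro AE_k_zero) measurable
    from AE_T[OF this] XZ show ?thesis
      by eventually_elim (auto simp: X_def L)
  qed
  then have "AE x in \<mu>. \<forall>b. b \<in> ?L (shift x) \<longrightarrow> ?L (\<tau> x) = (\<lambda>a. r a b) ` ?L x"
    by (simp add: AE_all_countable)
  then show ?thesis by eventually_elim blast
qed

lemma AE_pi_map_\<tau>: "AE x in \<mu>. pi_map \<kappa> (\<tau> x) = set_CA \<tau> (pi_map \<kappa> x)"
proof -
  have "AE x in \<mu>. \<forall>i. \<forall>b\<in>pi_map \<kappa> x (Suc i). pi_map \<kappa> (\<tau> x) i = (\<lambda>a. r a b) ` pi_map \<kappa> x i"
    using AE_T_pow[OF AE_Lambda_\<tau>] unfolding AE_all_countable by (simp add: pi_map_nth \<tau>_shift_pow)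
  moreover have "AE x in \<mu>. \<forall>i. x i \<in> pi_map \<kappa> x i" by (rule AE_mem_pi_map)
  ultimately show ?thesis
  proof eventually_elim
    case (elim x)
    show ?case
    proof
      fix i
      have "set_CA \<tau> (pi_map \<kappa> x) i = (\<Union>b\<in>pi_map \<kappa> x (Suc i). (\<lambda>a. r a b) ` pi_map \<kappa> x i)" (is "?l = ?r")
      proof (intro equalityI subsetI)
        fix c assume "c \<in> ?l"
        then obtain y where y: "\<And>j. y j \<in> pi_map \<kappa> x j" "c = \<tau> y i" by (auto simp: set_CA_def)
        then show "c \<in> ?r" by (auto simp: \<tau>_eq)
      next
        fix c assume "c \<in> ?r"
        then obtain a b where ab: "b \<in> pi_map \<kappa> x (Suc i)" "a \<in> pi_map \<kappa> x i" "c = r a b" by auto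
        \<comment> \<open>A selector must meet all the subsets, not just those at \<open>i\<close>
          and \<open>i + 1\<close>; the point \<open>x\<close> itself supplies the other
          entries.\<close>
        let ?y = "x(i := a, Suc i := b)"
        have "\<tau> ?y i = c" by (simp add: \<tau>_eq ab)
        moreover have "\<forall>j. ?y j \<in> pi_map \<kappa> x j" using ab elim(2) by auto
        ultimately show "c \<in> ?l" unfolding set_CA_def by blast
      qed
      also have "\<dots> = (\<Union>b\<in>pi_map \<kappa> x (Suc i). pi_map \<kappa> (\<tau> x) i)"
        using elim(1) by (intro SUP_cong refl) simp
      also have "\<dots> = pi_map \<kappa> (\<tau> x) i" using elim(2)[rule_format, of "Suc i"] by auto
      finally show "pi_map \<kappa> (\<tau> x) i = set_CA \<tau> (pi_map \<kappa> x) i" ..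
    qed
  qed
qed

text \<open>Fixing \<open>a\<close> in the first subset embeds the subset at \<open>shift x\<close>
  into the one at \<open>\<tau> x\<close> by the injective \<open>r a\<close>, so cardinalities
  cannot grow along the shift. Their means agree by invariance, so they are constant along
  it.\<close>

lemma AE_card_Lambda:
  "AE x in \<mu>. card (Lambda_set \<kappa> (\<tau> x)) = card (Lambda_set \<kappa> x) \<and>
    card (Lambda_set \<kappa> (shift x)) = card (Lambda_set \<kappa> x)"
proof -
  let ?L = "Lambda_set \<kappa>" and ?c = "\<lambda>x. real (card (Lambda_set \<kappa> x))"
  have card_r: "card ((\<lambda>a. r a b) ` A) = card A" "card (r a ` A) = card A" for a b A
    by (auto intro!: card_image inj_onI simp: r_left_cancel r_right_cancel)
  have le: "AE x in \<mu>. card (?L (\<tau> x)) = card (?L x) \<and> card (?L (shift x)) \<le> card (?L x)"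
    using AE_Lambda_\<tau> AE_Lambda AE_T[OF AE_Lambda]
  proof eventually_elim
    case (elim x)
    obtain a b where a: "a \<in> ?L x" and b: "b \<in> ?L (shift x)" using elim by blast
    have 1: "card (?L (\<tau> x)) = card (?L x)" using elim(1) b card_r by auto
    have "r a ` ?L (shift x) \<subseteq> ?L (\<tau> x)" using elim(1) a by blast
    then have "card (r a ` ?L (shift x)) \<le> card (?L (\<tau> x))" by (intro card_mono) auto
    then show ?case using 1 card_r by simp
  qed
  have [measurable]: "?c \<in> borel_measurable \<mu>" by measurable
  have bound: "\<bar>?c x\<bar> \<le> real (card (UNIV :: 'a set))" for x by (simp add: card_mono)
  have int: "integrable \<mu> ?c" "integrable \<mu> (\<lambda>x. ?c (shift x))"
    by (rule bounded_integrable[OF _ bound]; measurable)+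
  have "(\<integral>x. ?c x - ?c (shift x) \<partial>\<mu>) = 0"
    using integral_distr[OF measurable_T, of ?c] int by (simp add: distr_T)
  then have "AE x in \<mu>. ?c x - ?c (shift x) = 0"
    using int le by (subst (asm) integral_nonneg_eq_0_iff_AE) auto
  with le show ?thesis by eventually_elim simp
qed

text \<open>An almost invariant event \<open>E\<close> is replaced by the event that all sufficiently late points of the
  joint orbit lie in \<open>E\<close>; it is invariant because \<open>\<tau>\<close> and the shift commute.\<close>

lemma jointly_ergodic_AE:
  assumes erg: "jointly_ergodic \<mu> shift \<tau>" and E[measurable]: "E \<in> sets \<mu>"
    and inv: "AE x in \<mu>. (shift x \<in> E \<longleftrightarrow> x \<in> E) \<and> (\<tau> x \<in> E \<longleftrightarrow> x \<in> E)"
  shows "prob E = 0 \<or> prob E = 1"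
proof -
  let ?orb = "\<lambda>m n x. (shift ^^ m) ((\<tau> ^^ n) x)"
  define E' where "E' = {x \<in> space \<mu>. \<exists>N. \<forall>m\<ge>N. \<forall>n\<ge>N. ?orb m n x \<in> E}"
  have E'[measurable]: "E' \<in> sets \<mu>" unfolding E'_def by measurable
  have s: "?orb m n (shift x) = ?orb (Suc m) n x" for m n x
    by (simp add: \<tau>_pow_shift funpow_swap1)
  have t: "?orb m n (\<tau> x) = ?orb m (Suc n) x" for m n x by (simp add: funpow_swap1)
  have "shift -` E' \<inter> space \<mu> = E'"
  proof (intro set_eqI iffI)
    fix x assume "x \<in> shift -` E' \<inter> space \<mu>"
    then obtain N where N: "\<And>m n. N \<le> m \<Longrightarrow> N \<le> n \<Longrightarrow> ?orb (Suc m) n x \<in> E" by (auto simp: E'_def s simp del: funpow.simps)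
    have "?orb m n x \<in> E" if "Suc N \<le> m" "Suc N \<le> n" for m n
      using N[of "m - 1" n] that by (cases m) auto
    then show "x \<in> E'" unfolding E'_def by auto
  next
    fix x assume "x \<in> E'"
    then obtain N where N: "\<And>m n. N \<le> m \<Longrightarrow> N \<le> n \<Longrightarrow> ?orb m n x \<in> E" by (auto simp: E'_def)
    have "?orb m n (shift x) \<in> E" if "N \<le> m" "N \<le> n" for m n
      unfolding s using N[of "Suc m" n] that by simp
    then show "x \<in> shift -` E' \<inter> space \<mu>" unfolding E'_def by auto
  qed
  moreover have "\<tau> -` E' \<inter> space \<mu> = E'"
  proof (intro set_eqI iffI)
    fix x assume "x \<in> \<tau> -` E' \<inter> space \<mu>"
    then obtain N where N: "\<And>m n. N \<le> m \<Longrightarrow> N \<le> n \<Longrightarrow> ?orb m (Suc n) x \<in> E" by (auto simp: E'_def t simp del: funpow.simps)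
    have "?orb m n x \<in> E" if "Suc N \<le> m" "Suc N \<le> n" for m n
      using N[of m "n - 1"] that by (cases n) auto
    then show "x \<in> E'" unfolding E'_def by auto
  next
    fix x assume "x \<in> E'"
    then obtain N where N: "\<And>m n. N \<le> m \<Longrightarrow> N \<le> n \<Longrightarrow> ?orb m n x \<in> E" by (auto simp: E'_def)
    have "?orb m n (\<tau> x) \<in> E" if "N \<le> m" "N \<le> n" for m n
      unfolding t using N[of m "Suc n"] that by simp
    then show "x \<in> \<tau> -` E' \<inter> space \<mu>" unfolding E'_def by auto
  qed
  ultimately have "prob E' = 0 \<or> prob E' = 1"
    using erg E' unfolding jointly_ergodic_def by blast
  moreover have "prob E' = prob E"
  proof (rule measure_eq_AE)
    have t_inv: "AE x in \<mu>. (\<tau> ^^ n) x \<in> E \<longleftrightarrow> x \<in> E" for n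
    proof (induction n)
      case (Suc n)
      show ?case using CA.AE_T_pow[OF inv, of n] Suc by eventually_elim simp
    qed simp
    have "AE x in \<mu>. ?orb m n x \<in> E \<longleftrightarrow> x \<in> E" for m n
    proof (induction m)
      case (Suc m)
      have "AE x in \<mu>. ?orb (Suc m) n x \<in> E \<longleftrightarrow> ?orb m n x \<in> E"
        using CA.AE_T_pow[OF AE_T_pow[OF inv, of m], of n] by eventually_elim simp
      then show ?case using Suc by eventually_elim simp
    qed (simp add: t_inv)
    then have "AE x in \<mu>. \<forall>m n. ?orb m n x \<in> E \<longleftrightarrow> x \<in> E" by (simp add: AE_all_countable)
    then show "AE x in \<mu>. x \<in> E' \<longleftrightarrow> x \<in> E"
      by eventually_elim (auto simp: E'_def)
  qed auto
  ultimately show ?thesis by simp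
qed

lemma AE_card_pi_map:
  assumes erg: "jointly_ergodic \<mu> shift \<tau>"
  obtains k where "1 \<le> k" "k \<le> card (UNIV :: 'a set)" "AE x in \<mu>. \<forall>i. card (pi_map \<kappa> x i) = k"
proof -
  let ?E = "\<lambda>m. {x \<in> space \<mu>. card (Lambda_set \<kappa> x) = m}"
  have E[measurable]: "?E m \<in> sets \<mu>" for m by measurable
  have "\<exists>m. prob (?E m) \<noteq> 0"
  proof (rule ccontr)
    assume "\<nexists>m. prob (?E m) \<noteq> 0"
    then have "AE x in \<mu>. card (Lambda_set \<kappa> x) \<noteq> m" for m
      using prob_eq_0[OF E[of m]] by simp
    then have "AE x in \<mu>. \<forall>m. card (Lambda_set \<kappa> x) \<noteq> m" unfolding AE_all_countable by blast
    then have "AE x in \<mu>. False" by eventually_elim simp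
    then show False by simp
  qed
  then obtain m where m: "prob (?E m) \<noteq> 0" by blast
  have "AE x in \<mu>. (shift x \<in> ?E m \<longleftrightarrow> x \<in> ?E m) \<and> (\<tau> x \<in> ?E m \<longleftrightarrow> x \<in> ?E m)"
    using AE_card_Lambda by eventually_elim simp
  from jointly_ergodic_AE[OF erg E this] m have "prob (?E m) = 1" by simp
  then have AE_m: "AE x in \<mu>. card (Lambda_set \<kappa> x) = m"
    using prob_Collect_eq_1[OF E[of m]] by simp
  have "AE x in \<mu>. 1 \<le> m \<and> m \<le> card (UNIV :: 'a set)"
    using AE_m AE_Lambda by eventually_elim (auto simp: Suc_le_eq card_gt_0_iff intro: card_mono)
  then have "1 \<le> m" "m \<le> card (UNIV :: 'a set)" by simp_all
  moreover have "AE x in \<mu>. \<forall>i. card (pi_map \<kappa> x i) = m"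
    unfolding AE_all_countable pi_map_nth using AE_T_pow[OF AE_m] by blast
  ultimately show thesis by (rule that)
qed

end

section \<open>The isomorphism and the Pinsker factor\<close>

lemma sets_seq_space_cylinder:
  fixes w :: "nat \<Rightarrow> 'b::countable"
  assumes M: "sets M = sets (seq_space S)"
  shows "{y \<in> space M. \<forall>i\<le>n. y i = w i} \<in> sets M"
proof -
  have [measurable]: "(\<lambda>y. y i) \<in> measurable M (count_space UNIV)" for i
    unfolding measurable_cong_sets[OF M refl]
    by (rule measurable_compose[OF measurable_seq_space_coord measurable_count_space])
  have "{y \<in> space M. \<forall>i\<in>{..n}. y i = w i} \<in> sets M" by measurable
  then show ?thesis by (simp only: Ball_def atMost_iff)
qed

text \<open>Over a finite alphabet, a box restricting the first coordinates is a finite disjoint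
  union of cylinders, and boxes determine a finite measure. Finiteness of \<open>M1\<close> itself
  comes from the cylinders of length 1.\<close>

lemma seq_space_measure_eqI:
  fixes M1 M2 :: "(nat \<Rightarrow> 'b::finite) measure"
  assumes M1: "sets M1 = sets (seq_space S)" and M2: "sets M2 = sets (seq_space S)"
    and eq: "\<And>n w. (\<And>i. i \<le> n \<Longrightarrow> w i \<in> S) \<Longrightarrow>
      emeasure M1 {y \<in> space M1. \<forall>i\<le>n. y i = w i} = emeasure M2 {y \<in> space M2. \<forall>i\<le>n. y i = w i}"
    and fin: "\<And>n w. (\<And>i. i \<le> n \<Longrightarrow> w i \<in> S) \<Longrightarrow> emeasure M1 {y \<in> space M1. \<forall>i\<le>n. y i = w i} \<noteq> \<infinity>"
  shows "M1 = M2"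
proof -
  define cyl where "cyl n w = {y \<in> UNIV \<rightarrow> S. \<forall>i\<le>n. y i = w i}" for n :: nat and w :: "nat \<Rightarrow> 'b"
  have sp: "space M1 = UNIV \<rightarrow> S" "space M2 = UNIV \<rightarrow> S"
    using sets_eq_imp_space_eq[OF M1] sets_eq_imp_space_eq[OF M2] by (simp_all add: space_seq_space)
  have cyl_sets: "cyl n w \<in> sets M1" "cyl n w \<in> sets M2" for n w
    unfolding cyl_def
    by (subst sp(1)[symmetric], rule sets_seq_space_cylinder[OF M1])
      (subst sp(2)[symmetric], rule sets_seq_space_cylinder[OF M2])
  have cyl_eq: "emeasure M1 (cyl n w) = emeasure M2 (cyl n w)" "emeasure M1 (cyl n w) \<noteq> \<infinity>"
    if w: "w \<in> Pi\<^sub>E {..n} B" and B: "\<And>i. B i \<subseteq> S" for n w B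
  proof -
    have wS: "w i \<in> S" if "i \<le> n" for i
      using PiE_mem[OF w, of i] B[of i] that by auto
    have cyl_alt: "cyl n w = {y \<in> space M1. \<forall>i\<le>n. y i = w i}" "cyl n w = {y \<in> space M2. \<forall>i\<le>n. y i = w i}"
      by (auto simp: cyl_def sp)
    show "emeasure M1 (cyl n w) = emeasure M2 (cyl n w)"
      by (subst cyl_alt(1), subst cyl_alt(2), rule eq[OF wS])
    show "emeasure M1 (cyl n w) \<noteq> \<infinity>"
      by (subst cyl_alt(1), rule fin[OF wS])
  qed
  have box: "emeasure M (Pi\<^sub>E UNIV B) = (\<Sum>w\<in>Pi\<^sub>E {..n} B. emeasure M (cyl n w))"
    if B: "\<And>i. B i \<subseteq> S" "\<And>i. n < i \<Longrightarrow> B i = S" and c: "\<And>w. cyl n w \<in> sets M"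
    for M :: "(nat \<Rightarrow> 'b) measure" and n B
  proof -
    have un: "(Pi\<^sub>E UNIV B) = (\<Union>w\<in>Pi\<^sub>E {..n} B. cyl n w)"
    proof (intro equalityI subsetI)
      fix y assume y: "y \<in> Pi\<^sub>E UNIV B"
      then have "y \<in> cyl n (restrict y {..n})" using B(1) by (auto simp: cyl_def)
      moreover have "restrict y {..n} \<in> Pi\<^sub>E {..n} B" using y by auto
      ultimately show "y \<in> (\<Union>w\<in>Pi\<^sub>E {..n} B. cyl n w)" by blast
    next
      fix y assume "y \<in> (\<Union>w\<in>Pi\<^sub>E {..n} B. cyl n w)"
      then obtain w where w: "w \<in> Pi\<^sub>E {..n} B" "y \<in> cyl n w" by blast
      have "y i \<in> B i" for i
      proof (cases "i \<le> n")
        case True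
        then show ?thesis using w by (auto simp: cyl_def PiE_def Pi_def)
      next
        case False
        then show ?thesis using w B(2)[of i] by (auto simp: cyl_def)
      qed
      then show "y \<in> Pi\<^sub>E UNIV B" by auto
    qed
    have "disjoint_family_on (cyl n) (Pi\<^sub>E {..n} B)"
    proof (unfold disjoint_family_on_def, intro ballI impI)
      fix v w assume vw: "v \<in> Pi\<^sub>E {..n} B" "w \<in> Pi\<^sub>E {..n} B" "v \<noteq> w"
      have "v = w" if "y \<in> cyl n v \<inter> cyl n w" for y
        by (rule PiE_ext[OF vw(1,2)]) (use that in \<open>auto simp: cyl_def\<close>)
      then show "cyl n v \<inter> cyl n w = {}" using vw(3) by blast
    qed
    then show ?thesis
      unfolding un using c by (intro sum_emeasure[symmetric] finite_PiE) auto
  qed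
  show ?thesis
  proof (rule measure_eqI_PiM_infinite[OF M1[unfolded seq_space_def] M2[unfolded seq_space_def]])
    fix A :: "nat \<Rightarrow> 'b set" and J :: "nat set"
    assume J: "finite J" and A: "\<And>i. i \<in> J \<Longrightarrow> A i \<in> sets (count_space S)"
    define B where "B i = (if i \<in> J then A i else S)" for i
    obtain n where n: "\<And>j. j \<in> J \<Longrightarrow> j \<le> n"
      using J finite_nat_set_iff_bounded_le by auto
    have B: "\<And>i. B i \<subseteq> S" "\<And>i. n < i \<Longrightarrow> B i = S"
      using A n by (auto simp: B_def dest: leD)
    have "prod_emb UNIV (\<lambda>i. count_space S) J (Pi\<^sub>E J A) = Pi\<^sub>E UNIV B"
    proof (intro equalityI subsetI)
      fix y assume "y \<in> prod_emb UNIV (\<lambda>i. count_space S) J (Pi\<^sub>E J A)"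
      then have "\<And>i. y i \<in> S" "\<And>i. i \<in> J \<Longrightarrow> y i \<in> A i"
        by (auto simp: prod_emb_def PiE_def Pi_def extensional_def)
      then show "y \<in> Pi\<^sub>E UNIV B" by (auto simp: B_def)
    next
      fix y assume "y \<in> Pi\<^sub>E UNIV B"
      then have *: "\<And>i. y i \<in> B i" by auto
      then have "\<And>i. y i \<in> S" "\<And>i. i \<in> J \<Longrightarrow> y i \<in> A i"
        using B(1) by (blast, metis B_def)
      then show "y \<in> prod_emb UNIV (\<lambda>i. count_space S) J (Pi\<^sub>E J A)"
        by (auto simp: prod_emb_def)
    qed
    moreover have "emeasure M1 (Pi\<^sub>E UNIV B) = (\<Sum>w\<in>Pi\<^sub>E {..n} B. emeasure M1 (cyl n w))"
      by (rule box[OF B cyl_sets(1)])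
    moreover have "\<dots> = (\<Sum>w\<in>Pi\<^sub>E {..n} B. emeasure M2 (cyl n w))"
      by (intro sum.cong refl cyl_eq(1)[where B = B] B(1))
    moreover have "\<dots> = emeasure M2 (Pi\<^sub>E UNIV B)"
      by (rule box[OF B cyl_sets(2), symmetric])
    ultimately show "emeasure M1 (prod_emb UNIV (\<lambda>i. count_space S) J (Pi\<^sub>E J A)) =
        emeasure M2 (prod_emb UNIV (\<lambda>i. count_space S) J (Pi\<^sub>E J A))"
      by simp
  next
    show "finite_measure M1"
    proof
      have "emeasure M1 (Pi\<^sub>E UNIV (\<lambda>_. S)) = (\<Sum>w\<in>Pi\<^sub>E {..0} (\<lambda>_. S). emeasure M1 (cyl 0 w))"
        by (rule box) (use cyl_sets in simp_all)
      also have "\<dots> < \<infinity>"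
      proof -
        have "finite (Pi\<^sub>E {..0 :: nat} (\<lambda>_. S))" by (intro finite_PiE) auto
        then show ?thesis
          unfolding infinity_ennreal_def
          by (subst ennreal_sum_less_top) (use cyl_eq(2)[of _ 0 "\<lambda>_. S"] in \<open>auto simp: less_top\<close>)
      qed
      finally have "emeasure M1 (Pi\<^sub>E UNIV (\<lambda>_. S)) \<noteq> \<infinity>" by simp
      then show "emeasure M1 (space M1) \<noteq> \<infinity>" by (simp add: sp PiE_def)
    qed
  qed
qed

text \<open>The pairs \<open>(A i, a i)\<close> with \<open>a i \<in> A i\<close> are exactly the
  letters of \<open>pointed_subsets\<close>, so all cylinders are prescribed.\<close>

lemma uniform_extension_unique:
  fixes \<nu> :: "(nat \<Rightarrow> 'a::finite set) measure"
  assumes M1: "uniform_extension \<nu> M1" and M2: "uniform_extension \<nu> M2"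
  shows "M1 = M2"
proof (rule seq_space_measure_eqI)
  show "sets M1 = sets (seq_space pointed_subsets)" "sets M2 = sets (seq_space pointed_subsets)"
    using M1 M2 by (auto simp: uniform_extension_def)
  fix n and w :: "nat \<Rightarrow> 'a set \<times> 'a" assume w: "\<And>i. i \<le> n \<Longrightarrow> w i \<in> pointed_subsets"
  have *: "emeasure M {y \<in> space M. \<forall>i\<le>n. y i = w i} =
      ennreal (measure \<nu> {z \<in> space \<nu>. \<forall>i\<le>n. z i = fst (w i)} / (\<Prod>i\<le>n. real (card (fst (w i)))))"
    if "uniform_extension \<nu> M" for M
    using that[unfolded uniform_extension_def, THEN conjunct2, rule_format, of n "\<lambda>i. snd (w i)" "\<lambda>i. fst (w i)"] w
    by (auto simp: pointed_subsets_def split_beta)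
  show "emeasure M1 {y \<in> space M1. \<forall>i\<le>n. y i = w i} = emeasure M2 {y \<in> space M2. \<forall>i\<le>n. y i = w i}"
    and "emeasure M1 {y \<in> space M1. \<forall>i\<le>n. y i = w i} \<noteq> \<infinity>"
    using *[OF M1] *[OF M2] by simp_all
qed

lemma stationary_iff: "stationary M T \<longleftrightarrow> measure_preserving_system M T"
  by (simp add: stationary_def stationary_axioms_def measure_preserving_system_def)

lemma phi_map_shift: "phi_map \<kappa> (shift x) = shift (phi_map \<kappa> x)"
  by (rule ext) (simp add: phi_map_def pi_map_shift, simp add: shift_def)

section \<open>The lifted measure, the isomorphism, and the relative zero-one law\<close>

context uniform_kernel
begin

definition X :: "(nat \<Rightarrow> 'a) set" where
  "X = {x \<in> space \<mu>. \<forall>i. x i \<in> pi_map \<kappa> x i}"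

text \<open>Restriction to \<open>X\<close> is needed for a measurable map into this space:
  \<open>phi_map\<close> takes values over \<open>pointed_subsets\<close> precisely on
  \<open>X\<close>, see \<open>phi_map_in_space\<close>.\<close>

definition lift :: "(nat \<Rightarrow> 'a set \<times> 'a) measure" where
  "lift = distr (restrict_space \<mu> X) (seq_space pointed_subsets) (phi_map \<kappa>)"

lemma measurable_pi_map_nth[measurable]: "(\<lambda>x. pi_map \<kappa> x i) \<in> measurable \<mu> (count_space UNIV)"
  by (rule measurable_tail_imp[OF measurable_pi_map_nth_tail])

lemma X_sets[measurable]: "X \<in> sets \<mu>"
  unfolding X_def by measurable

lemma AE_X: "AE x in \<mu>. x \<in> X"
  using AE_mem_pi_map by eventually_elim (simp add: X_def)

lemma phi_map_in_space: "phi_map \<kappa> x \<in> UNIV \<rightarrow> pointed_subsets \<longleftrightarrow> x \<in> X"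
  by (auto simp: phi_map_def pointed_subsets_def X_def)

lemma space_lift: "space lift = UNIV \<rightarrow> pointed_subsets" and sets_lift: "sets lift = sets (seq_space pointed_subsets)"
  by (simp_all add: lift_def space_seq_space)

lemma measurable_phi_map: "phi_map \<kappa> \<in> measurable (restrict_space \<mu> X) lift"
  unfolding measurable_cong_sets[OF refl sets_lift]
proof (rule measurable_seq_spaceI)
  fix i
  have "(\<lambda>x. phi_map \<kappa> x i) \<in> measurable \<mu> (count_space UNIV)"
  proof -
    have "(\<lambda>x. phi_map \<kappa> x i) -` {p} \<inter> space \<mu> \<in> sets \<mu>" for p
    proof -
      have "(\<lambda>x. phi_map \<kappa> x i) -` {p} \<inter> space \<mu> = {x \<in> space \<mu>. pi_map \<kappa> x i = fst p \<and> x i = snd p}"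
        by (auto simp: phi_map_def)
      also have "\<dots> \<in> sets \<mu>" by measurable
      finally show ?thesis .
    qed
    then show ?thesis by (subst measurable_count_space_eq2_countable) auto
  qed
  then have "(\<lambda>x. phi_map \<kappa> x i) \<in> measurable (restrict_space \<mu> X) (count_space UNIV)"
    by (rule measurable_restrict_space1)
  moreover have "(\<lambda>x. phi_map \<kappa> x i) \<in> space (restrict_space \<mu> X) \<rightarrow> pointed_subsets"
    by (auto simp: phi_map_def pointed_subsets_def X_def space_restrict_space)
  ultimately have "(\<lambda>x. phi_map \<kappa> x i) \<in>
      measurable (restrict_space \<mu> X) (restrict_space (count_space UNIV) pointed_subsets)"
    by (intro measurable_restrict_space2)
  then show "(\<lambda>x. phi_map \<kappa> x i) \<in> measurable (restrict_space \<mu> X) (count_space pointed_subsets)"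
    by (simp add: restrict_count_space)
qed

text \<open>Points outside \<open>X\<close> are sent outside \<open>space lift\<close>, so plain
  preimages already lie in \<open>X\<close> and the restriction in \<open>lift\<close> disappears
  from the formula.\<close>

lemma vimage_phi_map:
  assumes B: "B \<in> sets lift"
  shows "phi_map \<kappa> -` B \<subseteq> X" and "phi_map \<kappa> -` B \<in> sets \<mu>"
    and "emeasure lift B = emeasure \<mu> (phi_map \<kappa> -` B)"
proof -
  show 1: "phi_map \<kappa> -` B \<subseteq> X"
    using sets.sets_into_space[OF B] phi_map_in_space by (auto simp: space_lift)
  have "phi_map \<kappa> -` B \<inter> space (restrict_space \<mu> X) \<in> sets (restrict_space \<mu> X)"
    by (rule measurable_sets[OF measurable_phi_map B])
  moreover have 2: "phi_map \<kappa> -` B \<inter> space (restrict_space \<mu> X) = phi_map \<kappa> -` B"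
    using 1 by (auto simp: space_restrict_space)
  ultimately show 3: "phi_map \<kappa> -` B \<in> sets \<mu>"
    by (simp add: sets_restrict_space_iff)
  have "emeasure lift B = emeasure (restrict_space \<mu> X) (phi_map \<kappa> -` B)"
    using measurable_phi_map B 2 unfolding lift_def
    by (subst emeasure_distr) (auto simp: measurable_cong_sets[OF refl sets_lift] sets_lift)
  also have "\<dots> = emeasure \<mu> (phi_map \<kappa> -` B)"
    by (rule emeasure_restrict_space) (use 1 in auto)
  finally show "emeasure lift B = emeasure \<mu> (phi_map \<kappa> -` B)" .
qed

lemma uniform_extension_lift: "uniform_extension (pi_measure \<mu> \<kappa>) lift"
  unfolding uniform_extension_def
proof (intro conjI sets_lift allI impI)
  fix n A and a :: "nat \<Rightarrow> 'a" assume a: "\<forall>i\<le>n. a i \<in> A i"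
  let ?B = "{y \<in> space lift. \<forall>i\<le>n. y i = (A i, a i)}"
  let ?P = "{x \<in> space tail_algebra. \<forall>i\<in>{..<Suc n}. pi_map \<kappa> x i = A i}"
  have B: "?B \<in> sets lift"
    by (rule sets_seq_space_cylinder[OF sets_lift])
  have P: "?P \<in> sets tail_algebra" by measurable
  have "emeasure lift ?B = ennreal (prob (phi_map \<kappa> -` ?B))"
    using vimage_phi_map[OF B] by (simp add: emeasure_eq_measure)
  \<comment> \<open>A cylinder of pairs is a word condition inside the tail event that prescribes
    the subsets, which is the setting of \<open>prob_word_Int_tail\<close> with length
    \<open>n + 1\<close>.\<close>
  also have "prob (phi_map \<kappa> -` ?B) = prob ({x. \<forall>i<Suc n. x i = a i} \<inter> ?P)"
  proof (rule measure_eq_AE)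
    show "AE x in \<mu>. x \<in> phi_map \<kappa> -` ?B \<longleftrightarrow> x \<in> {x. \<forall>i<Suc n. x i = a i} \<inter> ?P"
      using AE_X by eventually_elim (simp add: space_lift phi_map_in_space, auto simp: phi_map_def less_Suc_eq_le)
  qed (use vimage_phi_map(2)[OF B] sets_coords tail_algebra_imp_sets[OF P] in auto)
  also have "\<dots> = prob ?P / (\<Prod>i<Suc n. real (card (A i)))"
    using P a by (intro prob_word_Int_tail) auto
  also have "prob ?P = measure (pi_measure \<mu> \<kappa>) {z \<in> space (pi_measure \<mu> \<kappa>). \<forall>i\<le>n. z i = A i}"
  proof -
    have sp: "space (pi_measure \<mu> \<kappa>) = UNIV" by (simp add: pi_measure_def space_seq_space)
    have Z: "{z. \<forall>i\<le>n. z i = A i} \<in> sets (seq_space UNIV)"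
      using sets_seq_space_cylinder[OF refl, of UNIV n A] by (simp add: space_seq_space)
    have "measure (pi_measure \<mu> \<kappa>) {z. \<forall>i\<le>n. z i = A i} = prob (pi_map \<kappa> -` {z. \<forall>i\<le>n. z i = A i} \<inter> space \<mu>)"
      unfolding pi_measure_def by (rule measure_distr[OF measurable_pi_map Z])
    also have "pi_map \<kappa> -` {z. \<forall>i\<le>n. z i = A i} \<inter> space \<mu> = ?P"
      by (auto simp: less_Suc_eq_le)
    finally show ?thesis by (simp add: sp)
  qed
  finally show "emeasure lift ?B = ennreal (measure (pi_measure \<mu> \<kappa>)
      {z \<in> space (pi_measure \<mu> \<kappa>). \<forall>i\<le>n. z i = A i} / (\<Prod>i\<le>n. real (card (A i))))"
    by (simp only: lessThan_Suc_atMost)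
qed

lemma measure_preserving_lift: "measure_preserving_system lift shift"
  unfolding measure_preserving_system_def
proof (intro conjI)
  have shift_lift: "shift \<in> measurable lift lift"
    unfolding measurable_cong_sets[OF sets_lift sets_lift] by (rule measurable_shift_seq_space)
  then show "shift \<in> measurable lift lift" .
  have "phi_map \<kappa> -` space lift = X" by (auto simp: space_lift phi_map_in_space)
  then have "emeasure lift (space lift) = emeasure \<mu> X"
    using vimage_phi_map(3)[OF sets.top] by simp
  also have "\<dots> = 1" using prob_Collect_eq_1[of "\<lambda>x. x \<in> X"] AE_X by (simp add: emeasure_eq_measure)
  finally show "prob_space lift" by (rule prob_spaceI)
  show "distr lift lift shift = lift"
  proof (rule measure_eqI)
    fix B assume "B \<in> sets (distr lift lift shift)"
    then have B: "B \<in> sets lift" by simp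
    note SB = measurable_sets[OF shift_lift B]
    have "emeasure (distr lift lift shift) B = emeasure lift (shift -` B \<inter> space lift)"
      by (rule emeasure_distr[OF shift_lift B])
    also have "\<dots> = emeasure \<mu> (phi_map \<kappa> -` (shift -` B \<inter> space lift))"
      by (rule vimage_phi_map(3)[OF SB])
    also have "\<dots> = emeasure \<mu> (shift -` (phi_map \<kappa> -` B) \<inter> space \<mu>)"
    proof (rule emeasure_eq_AE)
      show "AE x in \<mu>. x \<in> phi_map \<kappa> -` (shift -` B \<inter> space lift) \<longleftrightarrow>
          x \<in> shift -` (phi_map \<kappa> -` B) \<inter> space \<mu>"
        using AE_X by eventually_elim (auto simp: phi_map_shift space_lift phi_map_in_space)
    qed (use vimage_phi_map(2)[OF SB] measurable_sets[OF measurable_T vimage_phi_map(2)[OF B]] in auto)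
    also have "\<dots> = emeasure lift B"
      using emeasure_T_pow_vimage[OF vimage_phi_map(2)[OF B], of 1] vimage_phi_map(3)[OF B] by simp
    finally show "emeasure (distr lift lift shift) B = emeasure lift B" .
  qed simp
qed

text \<open>The inverse \<open>g\<close> forgets the subsets. It inverts on \<open>Y\<close>, the
  sequences whose subsets are those that \<open>pi_map\<close> recomputes from their points.\<close>

lemma mt_isomorphism_lift: "mt_isomorphism \<mu> shift lift shift (phi_map \<kappa>)"
proof -
  define g :: "(nat \<Rightarrow> 'a set \<times> 'a) \<Rightarrow> nat \<Rightarrow> 'a" where "g y = (\<lambda>i. snd (y i))" for y
  define Y where "Y = {y \<in> space lift. \<forall>i. fst (y i) = pi_map \<kappa> (g y) i}"
  have coord[measurable]: "(\<lambda>y. y i) \<in> measurable lift (count_space UNIV)" for i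
    unfolding measurable_cong_sets[OF sets_lift refl]
    by (rule measurable_compose[OF measurable_seq_space_coord measurable_count_space])
  have g[measurable]: "g \<in> measurable lift \<mu>"
    unfolding measurable_cong_sets[OF refl sets_\<mu>] g_def[abs_def]
    by (intro measurable_seq_spaceI measurable_compose[OF coord measurable_count_space])
  have fst_coord[measurable]: "(\<lambda>y. fst (y i)) \<in> measurable lift (count_space UNIV)" for i
    by (rule measurable_compose[OF coord measurable_count_space])
  have pi_g[measurable]: "(\<lambda>y. pi_map \<kappa> (g y) i) \<in> measurable lift (count_space UNIV)" for i
    by (rule measurable_compose[OF g measurable_pi_map_nth])
  have Y[measurable]: "Y \<in> sets lift" unfolding Y_def by measurable
  have g_phi: "g (phi_map \<kappa> x) = x" for x by (simp add: g_def phi_map_def)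
  have phi_g: "phi_map \<kappa> (g y) = y" if "y \<in> Y" for y
    using that by (auto simp: Y_def phi_map_def g_def fun_eq_iff prod_eq_iff)
  have XY: "phi_map \<kappa> x \<in> Y" if "x \<in> X" for x
    using that by (simp add: Y_def space_lift phi_map_in_space g_phi) (simp add: phi_map_def)
  have YX: "g y \<in> X" if "y \<in> Y" for y
    using phi_g[OF that] that phi_map_in_space[of "g y"] by (simp add: Y_def space_lift)
  have bij: "bij_betw (phi_map \<kappa>) X Y"
    by (rule bij_betw_byWitness[where f' = g]) (use g_phi phi_g XY YX in auto)
  have sX: "space (restrict_space \<mu> X) = X" using X_def by (auto simp: space_restrict_space)
  have sY: "space (restrict_space lift Y) = Y" by (auto simp: space_restrict_space Y_def)
  have phi_meas: "phi_map \<kappa> \<in> measurable (restrict_space \<mu> X) (restrict_space lift Y)"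
    by (rule measurable_restrict_space2[OF _ measurable_phi_map]) (use XY sX in auto)
  show ?thesis
    unfolding mt_isomorphism_def
  proof (intro conjI bexI[of _ X] bexI[of _ Y])
    show "measure_preserving_system \<mu> shift"
      using stationary_axioms by (simp add: stationary_iff)
    show "measure_preserving_system lift shift" by (rule measure_preserving_lift)
    show "space \<mu> - X \<in> null_sets \<mu>"
    proof (subst AE_iff_null_sets)
      show "AE x in \<mu>. x \<notin> space \<mu> - X" using AE_X by eventually_elim simp
    qed (use sets.compl_sets[OF X_sets] in simp)
    \<comment> \<open>As \<open>phi_map\<close> sends \<open>X\<close> into \<open>Y\<close> and
      preimages lie in \<open>X\<close>, the complement of \<open>Y\<close> has empty preimage and
      hence \<open>lift\<close>-measure 0.\<close>
    have "phi_map \<kappa> -` (space lift - Y) = {}"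
      using XY vimage_phi_map(1)[of "space lift - Y"] Y by auto
    then show "space lift - Y \<in> null_sets lift"
      using vimage_phi_map(3)[of "space lift - Y"] Y by (auto simp: null_sets_def)
    show "shift ` X \<subseteq> X"
      by (auto simp: X_def pi_map_shift) (auto simp: shift_def)
    have "g (shift y) = shift (g y)" for y by (simp add: g_def shift_def)
    then show "shift ` Y \<subseteq> Y"
      by (auto simp: Y_def pi_map_shift space_lift) (auto simp: shift_def)
    show "the_inv_into X (phi_map \<kappa>) \<in> measurable (restrict_space lift Y) (restrict_space \<mu> X)"
    proof (subst measurable_cong)
      show "the_inv_into X (phi_map \<kappa>) y = g y" if "y \<in> space (restrict_space lift Y)" for y
        using that sY bij phi_g YX by (intro the_inv_into_f_eq) (auto simp: bij_betw_def)
      show "g \<in> measurable (restrict_space lift Y) (restrict_space \<mu> X)"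
        by (rule measurable_restrict_space2[OF _ measurable_restrict_space1[OF g]]) (use YX sY in auto)
    qed
    show "distr (restrict_space \<mu> X) (restrict_space lift Y) (phi_map \<kappa>) = restrict_space lift Y"
    proof (rule measure_eqI)
      fix A assume "A \<in> sets (distr (restrict_space \<mu> X) (restrict_space lift Y) (phi_map \<kappa>))"
      then have A': "A \<in> sets (restrict_space lift Y)" by simp
      then have A: "A \<subseteq> Y" "A \<in> sets lift" using Y by (auto simp: sets_restrict_space_iff)
      have "emeasure (distr (restrict_space \<mu> X) (restrict_space lift Y) (phi_map \<kappa>)) A =
          emeasure (restrict_space \<mu> X) (phi_map \<kappa> -` A \<inter> X)"
        using emeasure_distr[OF phi_meas A'] by (simp add: sX)
      also have "phi_map \<kappa> -` A \<inter> X = phi_map \<kappa> -` A" using vimage_phi_map(1)[OF A(2)] by auto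
      also have "emeasure (restrict_space \<mu> X) (phi_map \<kappa> -` A) = emeasure \<mu> (phi_map \<kappa> -` A)"
        by (rule emeasure_restrict_space) (use vimage_phi_map(1)[OF A(2)] in auto)
      also have "\<dots> = emeasure lift A" by (rule vimage_phi_map(3)[OF A(2), symmetric])
      also have "\<dots> = emeasure (restrict_space lift Y) A"
        by (rule emeasure_restrict_space[symmetric]) (use A Y in auto)
      finally show "emeasure (distr (restrict_space \<mu> X) (restrict_space lift Y) (phi_map \<kappa>)) A =
          emeasure (restrict_space lift Y) A" .
    qed simp
  qed (use bij phi_meas Y in \<open>auto simp: phi_map_shift\<close>)
qed

text \<open>The probability of the word \<open>w\<close> when one point of each subset
  \<open>z i\<close> is chosen uniformly and independently; an empty subset gives the factor
  0.\<close>

definition rho :: "nat \<Rightarrow> (nat \<Rightarrow> 'a) \<Rightarrow> (nat \<Rightarrow> 'a set) \<Rightarrow> real" where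
  "rho n w z = (\<Prod>i<n. of_bool (w i \<in> z i) / real (card (z i)))"

lemma rho_bound: "\<bar>rho n w z\<bar> \<le> 1"
proof -
  have "0 \<le> of_bool (w i \<in> z i) / real (card (z i)) \<and> of_bool (w i \<in> z i) / real (card (z i)) \<le> 1" for i
    by (cases "card (z i)") (auto simp: field_simps)
  then have "0 \<le> rho n w z" "rho n w z \<le> 1"
    unfolding rho_def by (auto intro: prod_nonneg prod_le_1)
  then show ?thesis by simp
qed

lemma measurable_rho[measurable]: "rho n w \<in> borel_measurable (seq_space UNIV)"
proof -
  have [measurable]: "(\<lambda>z. z i) \<in> measurable (seq_space UNIV) (count_space (UNIV :: 'a set set))" for i
    by (rule measurable_seq_space_coord)
  show ?thesis unfolding rho_def[abs_def] by measurable
qed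

sublocale tail: finite_measure_subalgebra \<mu> tail_algebra
  by unfold_locales (rule subalgebra_tail_algebra)

text \<open>A tail event is cut into finitely many tail events by the values of the first
  \<open>n\<close> subsets. On each piece \<open>rho\<close> is constant and
  \<open>prob_word_Int_tail\<close> applies, unless some \<open>w i\<close> is outside its subset,
  and then both sides vanish.\<close>

lemma real_cond_exp_word:
  "AE x in \<mu>. real_cond_exp \<mu> tail_algebra (indicator {x. \<forall>i<n. x i = w i}) x = rho n w (pi_map \<kappa> x)"
proof (rule tail.real_cond_exp_charact)
  let ?C = "{x. \<forall>i<n. x i = w i}"
  let ?r = "\<lambda>x. rho n w (pi_map \<kappa> x)"
  note C[measurable] = sets_coords[of n w]
  show int_C: "integrable \<mu> (indicator ?C :: _ \<Rightarrow> real)" by (simp add: less_top[symmetric])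
  show "?r \<in> borel_measurable tail_algebra" by measurable
  then have r[measurable]: "?r \<in> borel_measurable \<mu>" by (rule measurable_tail_imp)
  show int_r: "integrable \<mu> ?r"
    by (rule bounded_integrable[OF r rho_bound])
  fix A assume A: "A \<in> sets tail_algebra"
  note A'[measurable] = tail_algebra_imp_sets[OF A]
  let ?I = "{..<n} \<rightarrow>\<^sub>E (UNIV :: 'a set set)"
  let ?P = "\<lambda>B. {x \<in> space tail_algebra. \<forall>i\<in>{..<n}. pi_map \<kappa> x i = B i}"
  have finI: "finite ?I" by (intro finite_PiE) auto
  have AP: "A \<inter> ?P B \<in> sets tail_algebra" for B
  proof -
    have "?P B \<in> sets tail_algebra" by measurable
    then show ?thesis using A by auto
  qed
  note AP'[measurable] = tail_algebra_imp_sets[OF AP]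
  have split: "indicator A x = (\<Sum>B\<in>?I. indicator (A \<inter> ?P B) x :: real)" for x
  proof -
    let ?B = "restrict (pi_map \<kappa> x) {..<n}"
    have "(\<Sum>B\<in>?I. indicator (A \<inter> ?P B) x :: real) = (\<Sum>B\<in>?I. if B = ?B then indicator A x else 0)"
    proof (intro sum.cong refl)
      fix B assume B: "B \<in> ?I"
      have "x \<in> ?P B \<longleftrightarrow> B = ?B"
      proof
        assume "x \<in> ?P B"
        then show "B = ?B" using B by (intro PiE_ext[OF B]) auto
      qed auto
      then show "(indicator (A \<inter> ?P B) x :: real) = (if B = ?B then indicator A x else 0)"
        by (simp add: indicator_def)
    qed
    also have "\<dots> = indicator A x" using finI by (subst sum.delta) auto
    finally show ?thesis ..
  qed
  have part: "(\<integral>x. indicator A x * f x \<partial>\<mu>) = (\<Sum>B\<in>?I. \<integral>x. indicator (A \<inter> ?P B) x * f x \<partial>\<mu>)"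
    if "integrable \<mu> f" for f :: "_ \<Rightarrow> real"
    unfolding split sum_distrib_right
    by (rule Bochner_Integration.integral_sum) (subst mult.commute, rule integrable_real_mult_indicator[OF AP' that])
  have "(\<integral>x. indicator (A \<inter> ?P B) x * indicator ?C x \<partial>\<mu>) = (\<integral>x. indicator (A \<inter> ?P B) x * ?r x \<partial>\<mu>)"
    if B: "B \<in> ?I" for B
  proof -
    have "(\<integral>x. indicator (A \<inter> ?P B) x * ?r x \<partial>\<mu>) = (\<integral>x. indicator (A \<inter> ?P B) x * rho n w B \<partial>\<mu>)"
      by (intro Bochner_Integration.integral_cong) (auto simp: indicator_def rho_def intro!: prod.cong)
    also have "\<dots> = prob (A \<inter> ?P B) * rho n w B" by simp
    also have "\<dots> = prob (?C \<inter> (A \<inter> ?P B))"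
    proof (cases "\<forall>i<n. w i \<in> B i")
      case True
      then have "rho n w B = 1 / (\<Prod>i<n. real (card (B i)))"
        by (simp add: rho_def prod_dividef)
      moreover have "prob (?C \<inter> (A \<inter> ?P B)) = prob (A \<inter> ?P B) / (\<Prod>i<n. real (card (B i)))"
        using True by (intro prob_word_Int_tail AP) auto
      ultimately show ?thesis by simp
    next
      case False
      then obtain i where i: "i < n" "w i \<notin> B i" by blast
      have "rho n w B = 0" using i by (auto simp: rho_def)
      moreover have "prob (?C \<inter> (A \<inter> ?P B)) = prob {}"
      proof (rule measure_eq_AE)
        show "AE x in \<mu>. x \<in> ?C \<inter> (A \<inter> ?P B) \<longleftrightarrow> x \<in> {}"
          using AE_mem_pi_map
        proof eventually_elim
          case (elim x)
          have False if "x i = w i" "pi_map \<kappa> x i = B i"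
            using elim[rule_format, of i] that i(2) by simp
          then show ?case using i(1) by auto
        qed
      qed measurable
      ultimately show ?thesis by simp
    qed
    also have "\<dots> = (\<integral>x. indicator (?C \<inter> (A \<inter> ?P B)) x \<partial>\<mu>)" by simp
    also have "\<dots> = (\<integral>x. indicator (A \<inter> ?P B) x * indicator ?C x \<partial>\<mu>)"
      by (intro Bochner_Integration.integral_cong) (auto simp: indicator_def)
    finally show ?thesis ..
  qed
  then show "(LINT x:A|\<mu>. indicator ?C x) = (LINT x:A|\<mu>. ?r x)"
    using part[OF int_C] part[OF int_r] by (simp add: set_lebesgue_integral_def)
qed

text \<open>With \<open>g\<close> the conditional expectation of \<open>A\<close> given \<open>pi_map\<close>, the difference \<open>indicator A - g\<close> is
  orthogonal to \<open>g\<close> and to all cylinders, and the latter approximate \<open>A\<close>.\<close>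

lemma tail_event_pi_map:
  assumes A: "A \<in> sets tail_algebra"
  obtains D where "D \<in> sets (seq_space UNIV)" "AE x in \<mu>. x \<in> A \<longleftrightarrow> pi_map \<kappa> x \<in> D"
proof -
  define G where "G = vimage_algebra UNIV (pi_map \<kappa>) (seq_space UNIV)"
  have pi_G[measurable]: "pi_map \<kappa> \<in> measurable G (seq_space UNIV)"
    unfolding G_def by (rule measurable_vimage_algebra1) (simp add: space_seq_space)
  have sets_G: "sets G = {pi_map \<kappa> -` D \<inter> UNIV | D. D \<in> sets (seq_space UNIV)}"
    unfolding G_def by (rule sets_vimage_algebra2) (simp add: space_seq_space)
  have G_tail: "subalgebra tail_algebra G"
    unfolding subalgebra_def sets_G using measurable_sets[OF measurable_pi_map_tail]
    by (auto simp: G_def)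
  have G: "subalgebra \<mu> G"
    using G_tail subalgebra_tail_algebra by (auto simp: subalgebra_def)
  interpret G: finite_measure_subalgebra \<mu> G by unfold_locales (rule G)
  note A'[measurable] = tail_algebra_imp_sets[OF A]
  let ?a = "indicator A :: _ \<Rightarrow> real"
  define g0 where "g0 = real_cond_exp \<mu> G ?a"
  \<comment> \<open>Clamped because the conditional expectation lies in [0, 1] only almost surely,
    while the bounds below are used at every point.\<close>
  define g where "g x = max 0 (min 1 (g0 x))" for x
  have int_a: "integrable \<mu> ?a" by (simp add: less_top[symmetric])
  have gG[measurable]: "g \<in> borel_measurable G"
    unfolding g_def[abs_def] g0_def by measurable
  have gt: "g \<in> borel_measurable tail_algebra" by (rule measurable_from_subalg[OF G_tail gG])
  have gm[measurable]: "g \<in> borel_measurable \<mu>" by (rule measurable_from_subalg[OF G gG])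
  have gb: "0 \<le> g x" "g x \<le> 1" for x by (auto simp: g_def)
  have g_AE: "AE x in \<mu>. g0 x = g x"
  proof -
    have "AE x in \<mu>. 0 \<le> g0 x" unfolding g0_def by (rule G.real_cond_exp_ge_c[OF int_a]) simp
    moreover have "AE x in \<mu>. g0 x \<le> 1" unfolding g0_def
      by (rule G.real_cond_exp_le_c[OF int_a]) (simp add: indicator_le_1)
    ultimately show ?thesis by eventually_elim (simp add: g_def)
  qed
  have bnd: "\<bar>u * v\<bar> \<le> 1" if "\<bar>u\<bar> \<le> 1" "\<bar>v\<bar> \<le> 1" for u v :: real
    using mult_mono[OF that] by (simp add: abs_mult)
  have ab: "\<bar>?a x\<bar> \<le> 1" for x by (simp add: indicator_def)
  have gb': "\<bar>g x\<bar> \<le> 1" for x using gb[of x] by simp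
  have db: "\<bar>?a x - g x\<bar> \<le> 1" for x using gb[of x] by (simp add: indicator_def)
  have orth: "(\<integral>x. u x * (?a x - g x) \<partial>\<mu>) = 0"
    if u[measurable]: "u \<in> borel_measurable G" and ub: "\<And>x. \<bar>u x\<bar> \<le> 1" for u
  proof -
    note um[measurable] = measurable_from_subalg[OF G u]
    have i1: "integrable \<mu> (\<lambda>x. u x * ?a x)" by (rule bounded_integrable[OF _ bnd[OF ub ab]]) measurable
    have i2: "integrable \<mu> (\<lambda>x. u x * g x)" by (rule bounded_integrable[OF _ bnd[OF ub gb']]) measurable
    have "(\<integral>x. u x * ?a x \<partial>\<mu>) = (\<integral>x. u x * g0 x \<partial>\<mu>)"
      unfolding g0_def by (rule G.real_cond_exp_intg(2)[OF i1 u, symmetric]) measurable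
    also have "\<dots> = (\<integral>x. u x * g x \<partial>\<mu>)"
    proof (rule integral_cong_AE)
      show "AE x in \<mu>. u x * g0 x = u x * g x" using g_AE by eventually_elim simp
    qed (auto simp: g0_def)
    finally show ?thesis
      using Bochner_Integration.integral_diff[OF i1 i2] by (simp add: right_diff_distrib)
  qed
  have cyl: "(\<integral>x. indicator {x. \<forall>i<n. x i = w i} x * (?a x - g x) \<partial>\<mu>) = 0" for n w
  proof -
    let ?C = "{x. \<forall>i<n. x i = w i}"
    note C[measurable] = sets_coords[of n w]
    have d_tail[measurable]: "(\<lambda>x. ?a x - g x) \<in> borel_measurable tail_algebra"
      using A gt by measurable
    have "(\<integral>x. (?a x - g x) * indicator ?C x \<partial>\<mu>) =
        (\<integral>x. (?a x - g x) * real_cond_exp \<mu> tail_algebra (indicator ?C) x \<partial>\<mu>)"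
    proof (rule tail.real_cond_exp_intg(2)[OF _ d_tail, symmetric])
      show "integrable \<mu> (\<lambda>x. (?a x - g x) * indicator ?C x)"
        by (rule bounded_integrable[OF _ bnd[OF db]]) (auto simp: indicator_def)
    qed measurable
    \<comment> \<open>Since \<open>A\<close> is a tail event, conditioning on the tail leaves
      \<open>?a - g\<close> alone and turns the cylinder into a function of \<open>pi_map\<close>,
      to which \<open>?a - g\<close> is orthogonal.\<close>
    also have "\<dots> = (\<integral>x. (?a x - g x) * rho n w (pi_map \<kappa> x) \<partial>\<mu>)"
    proof (rule integral_cong_AE)
      show "AE x in \<mu>. (?a x - g x) * real_cond_exp \<mu> tail_algebra (indicator ?C) x =
          (?a x - g x) * rho n w (pi_map \<kappa> x)"
        using real_cond_exp_word[of n w] by eventually_elim simp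
    qed measurable
    also have "\<dots> = (\<integral>x. rho n w (pi_map \<kappa> x) * (?a x - g x) \<partial>\<mu>)" by (simp add: mult.commute)
    also have "\<dots> = 0" by (rule orth) (auto intro: rho_bound)
    finally show ?thesis by (simp add: mult.commute)
  qed
  have sq: "(\<integral>x. (?a x - g x)\<^sup>2 \<partial>\<mu>) \<le> e" if e: "0 < e" for e
  proof -
    obtain n W where nW: "prob {x. (x \<in> A) \<noteq> (word n x \<in> W)} < e"
      using cylinder_approx[OF A'] e unfolding cylinder_approx_def by blast
    note W[measurable] = sets_word[of n W] and mis[measurable] = sets_mismatch[OF A', of n W]
    let ?b = "indicator {x. word n x \<in> W} :: _ \<Rightarrow> real"
    let ?m = "indicator {x. (x \<in> A) \<noteq> (word n x \<in> W)} :: _ \<Rightarrow> real"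
    have bb: "\<bar>?b x\<bar> \<le> 1" for x by (simp add: indicator_def)
    have i1: "integrable \<mu> ?m"
      by (rule integrable_real_indicator[OF mis]) (simp add: less_top[symmetric])
    have i2: "integrable \<mu> (\<lambda>x. ?b x * (?a x - g x))"
      by (rule bounded_integrable[OF _ bnd[OF bb db]]) measurable
    have i3: "integrable \<mu> (\<lambda>x. g x * (?a x - g x))"
      by (rule bounded_integrable[OF _ bnd[OF gb' db]]) measurable
    have "(\<integral>x. ?b x * (?a x - g x) \<partial>\<mu>) = 0"
    proof -
      let ?V = "W \<inter> {v. length v = n}"
      have finV: "finite ?V" using finite_lists_length_eq[of "UNIV :: 'a set" n] by simp
      have "?b x = (\<Sum>v\<in>?V. indicator {x. \<forall>i<n. x i = v ! i} x)" for x
      proof -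
        have "(\<Sum>v\<in>?V. indicator {x. \<forall>i<n. x i = v ! i} x :: real) = (\<Sum>v\<in>?V. if v = word n x then 1 else 0)"
          by (intro sum.cong) (auto simp: indicator_def word_eq list_eq_iff_nth_eq)
        also have "\<dots> = ?b x"
          using finV by (subst sum.delta) (auto simp: word_eq)
        finally show ?thesis ..
      qed
      then have "(\<integral>x. ?b x * (?a x - g x) \<partial>\<mu>) =
          (\<integral>x. (\<Sum>v\<in>?V. indicator {x. \<forall>i<n. x i = v ! i} x * (?a x - g x)) \<partial>\<mu>)"
        by (simp add: sum_distrib_right)
      also have "\<dots> = (\<Sum>v\<in>?V. \<integral>x. indicator {x. \<forall>i<n. x i = v ! i} x * (?a x - g x) \<partial>\<mu>)"
      proof (rule Bochner_Integration.integral_sum)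
        fix v
        note sets_coords[of n "\<lambda>i. v ! i", measurable]
        show "integrable \<mu> (\<lambda>x. indicator {x. \<forall>i<n. x i = v ! i} x * (?a x - g x))"
          by (rule bounded_integrable[OF _ bnd[OF _ db]]) (auto simp: indicator_def)
      qed
      also have "\<dots> = 0" by (simp add: cyl)
      finally show ?thesis .
    qed
    moreover have "(\<integral>x. g x * (?a x - g x) \<partial>\<mu>) = 0" by (rule orth[OF gG gb'])
    moreover have "(\<integral>x. (?a x - g x)\<^sup>2 \<partial>\<mu>) \<le> (\<integral>x. ?m x + ?b x * (?a x - g x) - g x * (?a x - g x) \<partial>\<mu>)"
    proof (rule integral_mono)
      show "integrable \<mu> (\<lambda>x. (?a x - g x)\<^sup>2)"
        unfolding power2_eq_square by (rule bounded_integrable[OF _ bnd[OF db db]]) measurable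
      show "integrable \<mu> (\<lambda>x. ?m x + ?b x * (?a x - g x) - g x * (?a x - g x))"
        by (intro Bochner_Integration.integrable_add Bochner_Integration.integrable_diff i1 i2 i3)
      fix x
      \<comment> \<open>In the first product \<open>?a\<close> is exchanged for the word event
        \<open>?b\<close> at the price of the mismatch \<open>?m\<close>; the terms with
        \<open>?b\<close> and \<open>g\<close> then integrate to 0.\<close>
      have "(?a x - g x)\<^sup>2 = ?a x * (?a x - g x) - g x * (?a x - g x)"
        by (simp add: power2_eq_square algebra_simps)
      also have "?a x * (?a x - g x) \<le> ?m x + ?b x * (?a x - g x)"
        using gb[of x] by (auto simp: indicator_def)
      finally show "(?a x - g x)\<^sup>2 \<le> ?m x + ?b x * (?a x - g x) - g x * (?a x - g x)" by simp
    qed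
    moreover have "(\<integral>x. ?m x + ?b x * (?a x - g x) - g x * (?a x - g x) \<partial>\<mu>) =
        prob {x. (x \<in> A) \<noteq> (word n x \<in> W)} + (\<integral>x. ?b x * (?a x - g x) \<partial>\<mu>) - (\<integral>x. g x * (?a x - g x) \<partial>\<mu>)"
      using mis by (subst Bochner_Integration.integral_diff[OF Bochner_Integration.integrable_add[OF i1 i2] i3],
        subst Bochner_Integration.integral_add[OF i1 i2]) simp
    ultimately show ?thesis using nW by linarith
  qed
  have "(\<integral>x. (?a x - g x)\<^sup>2 \<partial>\<mu>) \<le> 0" by (rule field_le_epsilon) (use sq in simp)
  moreover have "0 \<le> (\<integral>x. (?a x - g x)\<^sup>2 \<partial>\<mu>)" by simp
  ultimately have "(\<integral>x. (?a x - g x)\<^sup>2 \<partial>\<mu>) = 0" by linarith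
  moreover have "integrable \<mu> (\<lambda>x. (?a x - g x)\<^sup>2)"
    unfolding power2_eq_square by (rule bounded_integrable[OF _ bnd[OF db db]]) measurable
  ultimately have "AE x in \<mu>. (?a x - g x)\<^sup>2 = 0"
    by (subst (asm) integral_nonneg_eq_0_iff_AE) auto
  \<comment> \<open>Now \<open>g\<close> equals the indicator of \<open>A\<close> almost surely, so
    any threshold strictly between 0 and 1 recovers \<open>A\<close> as an event of
    \<open>pi_map\<close>.\<close>
  then have ag: "AE x in \<mu>. x \<in> A \<longleftrightarrow> x \<in> {x \<in> space G. 1 / 2 < g x}"
  proof eventually_elim
    case (elim x)
    then show ?case by (cases "x \<in> A") (auto simp: G_def)
  qed
  have "{x \<in> space G. 1 / 2 < g x} \<in> sets G" by measurable
  then obtain D where D: "D \<in> sets (seq_space UNIV)" "{x \<in> space G. 1 / 2 < g x} = pi_map \<kappa> -` D \<inter> UNIV"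
    unfolding sets_G by blast
  show thesis using that[OF D(1)] ag unfolding D(2) by simp
qed

text \<open>Zero entropy events are tail events and these depend on \<open>pi_map\<close>; the
  converse inclusion is the entropy hypothesis in the form of
  \<open>pi_vimage_zero_rate\<close>.\<close>

lemma pinsker_factor_pi_map: "pinsker_factor \<mu> shift (pi_measure \<mu> \<kappa>) shift (pi_map \<kappa>)"
  unfolding pinsker_factor_def
proof
  have sets_pi: "sets (pi_measure \<mu> \<kappa>) = sets (seq_space UNIV)" by (simp add: pi_measure_def)
  show "factor_map \<mu> shift (pi_measure \<mu> \<kappa>) shift (pi_map \<kappa>)"
    unfolding factor_map_def
  proof (intro conjI)
    show "measure_preserving_system \<mu> shift" "measure_preserving_system (pi_measure \<mu> \<kappa>) shift"
      using stationary_axioms stationary_pi_measure by (simp_all add: stationary_iff)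
    show "pi_map \<kappa> \<in> measurable \<mu> (pi_measure \<mu> \<kappa>)"
      unfolding measurable_cong_sets[OF refl sets_pi] by (rule measurable_pi_map)
    show "distr \<mu> (pi_measure \<mu> \<kappa>) (pi_map \<kappa>) = pi_measure \<mu> \<kappa>"
      by (subst (2) pi_measure_def, rule distr_cong) (simp_all add: sets_pi)
  qed (simp add: pi_map_shift)
  have "pi_map \<kappa> \<in> space \<mu> \<rightarrow> space (pi_measure \<mu> \<kappa>)"
    by (simp add: pi_measure_def space_seq_space)
  then have sets_vimage: "sets (vimage_algebra (space \<mu>) (pi_map \<kappa>) (pi_measure \<mu> \<kappa>)) =
      {pi_map \<kappa> -` D | D. D \<in> sets (seq_space UNIV)}"
    by (subst sets_vimage_algebra2) (auto simp: sets_pi)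
  have sym_diff: "sym_diff A B \<in> null_sets \<mu>"
    if "A \<in> sets \<mu>" "B \<in> sets \<mu>" "AE x in \<mu>. x \<in> A \<longleftrightarrow> x \<in> B" for A B
  proof -
    have "AE x in \<mu>. x \<notin> sym_diff A B" using that(3) by eventually_elim auto
    then show ?thesis using that(1,2) by (subst AE_iff_null_sets) auto
  qed
  show "eq_mod_null \<mu> (pinsker_algebra \<mu> shift)
      (sets (vimage_algebra (space \<mu>) (pi_map \<kappa>) (pi_measure \<mu> \<kappa>)))"
    unfolding eq_mod_null_def sets_vimage
  proof (intro conjI ballI)
    fix A assume "A \<in> pinsker_algebra \<mu> shift"
    then have A: "A \<in> sets \<mu>" "entropy_rate \<mu> shift (\<lambda>x. x \<in> A) = 0"
      using partition_entropy_eq_rate[of A] by (auto simp: pinsker_algebra_def)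
    have "A \<in> sets tail_algebra"
      using zero_rate_tail_event[OF A] by (simp add: sets_tail_algebra)
    then obtain D where D: "D \<in> sets (seq_space UNIV)" "AE x in \<mu>. x \<in> A \<longleftrightarrow> pi_map \<kappa> x \<in> D"
      by (rule tail_event_pi_map)
    have "sym_diff A (pi_map \<kappa> -` D) \<in> null_sets \<mu>"
      using A(1) measurable_sets[OF measurable_pi_map D(1)] D(2) by (intro sym_diff) auto
    then show "\<exists>B\<in>{pi_map \<kappa> -` D | D. D \<in> sets (seq_space UNIV)}. sym_diff A B \<in> null_sets \<mu>"
      using D(1) by blast
  next
    fix B assume "B \<in> {pi_map \<kappa> -` D | D. D \<in> sets (seq_space UNIV)}"
    then obtain D where D: "D \<in> sets (seq_space UNIV)" "B = pi_map \<kappa> -` D" by blast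
    have B: "B \<in> sets \<mu>" using measurable_sets[OF measurable_pi_map D(1)] D(2) by simp
    then have "B \<in> pinsker_algebra \<mu> shift"
      using pi_vimage_zero_rate[OF D(1)] partition_entropy_eq_rate[OF B]
      by (simp add: pinsker_algebra_def D(2))
    then show "\<exists>A\<in>pinsker_algebra \<mu> shift. sym_diff A B \<in> null_sets \<mu>"
      by (intro bexI[of _ B]) auto
  qed
qed

end

section \<open>Invariance of the factor measure under the automaton on subsets\<close>

context ca_uniform_kernel
begin

lemma measurable_set_CA: "set_CA \<tau> \<in> measurable (seq_space UNIV) (seq_space UNIV)"
proof (rule measurable_seq_spaceI)
  fix i
  have [measurable]: "(\<lambda>z. z j) \<in> measurable (seq_space UNIV) (count_space (UNIV :: 'a set set))" for j
    by (rule measurable_seq_space_coord)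
  \<comment> \<open>One empty subset anywhere leaves no selector and empties all coordinates of the
    image; otherwise only the subsets at \<open>i\<close> and \<open>i + 1\<close> matter.\<close>
  have eq: "set_CA \<tau> A i = (if \<forall>j. A j \<noteq> {} then \<Union>b\<in>A (Suc i). (\<lambda>a. r a b) ` A i else {})" for A
  proof (cases "\<forall>j. A j \<noteq> {}")
    case True
    then have "\<forall>j. \<exists>a. a \<in> A j" by blast
    from choice[OF this] obtain y where y: "\<And>j. y j \<in> A j" by blast
    have "\<exists>z. r a b = \<tau> z i \<and> (\<forall>j. z j \<in> A j)" if "a \<in> A i" "b \<in> A (Suc i)" for a b
      by (rule exI[of _ "y(i := a, Suc i := b)"]) (use y that in \<open>auto simp: \<tau>_eq\<close>)
    then show ?thesis using True unfolding set_CA_def by (auto simp: \<tau>_eq)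
  qed (auto simp: set_CA_def)
  have "(\<lambda>A. \<Union>b\<in>A (Suc i). (\<lambda>a. r a b) ` A i) \<in> measurable (seq_space UNIV) (count_space UNIV)"
    by (intro measurable_compose_countable[of "\<lambda>Q A. \<Union>b\<in>Q. (\<lambda>a. r a b) ` A i" _ _ "\<lambda>A. A (Suc i)"]
        measurable_compose_countable[of "\<lambda>P A. \<Union>b\<in>_. (\<lambda>a. r a b) ` P" _ _ "\<lambda>A. A i"]) measurable
  then show "(\<lambda>A. set_CA \<tau> A i) \<in> measurable (seq_space UNIV) (count_space UNIV)"
    unfolding eq by measurable
qed

lemma measure_preserving_set_CA: "measure_preserving_system (pi_measure \<mu> \<kappa>) (set_CA \<tau>)"
  unfolding measure_preserving_system_def
proof (intro conjI)
  have sets_pi: "sets (pi_measure \<mu> \<kappa>) = sets (seq_space UNIV)" by (simp add: pi_measure_def)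
  show "prob_space (pi_measure \<mu> \<kappa>)"
    unfolding pi_measure_def by (rule prob_space_distr) measurable
  show "set_CA \<tau> \<in> measurable (pi_measure \<mu> \<kappa>) (pi_measure \<mu> \<kappa>)"
    unfolding measurable_cong_sets[OF sets_pi sets_pi] by (rule measurable_set_CA)
  have "distr (pi_measure \<mu> \<kappa>) (pi_measure \<mu> \<kappa>) (set_CA \<tau>) = distr (pi_measure \<mu> \<kappa>) (seq_space UNIV) (set_CA \<tau>)"
    by (rule distr_cong) (auto simp: sets_pi)
  also have "\<dots> = distr \<mu> (seq_space UNIV) (set_CA \<tau> \<circ> pi_map \<kappa>)"
    unfolding pi_measure_def by (rule distr_distr[OF measurable_set_CA measurable_pi_map])
  also have "\<dots> = distr \<mu> (seq_space UNIV) (pi_map \<kappa> \<circ> \<tau>)"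
  proof (rule distr_cong_AE)
    show "AE x in \<mu>. (set_CA \<tau> \<circ> pi_map \<kappa>) x = (pi_map \<kappa> \<circ> \<tau>) x"
      using AE_pi_map_\<tau> by eventually_elim simp
  qed (auto intro: measurable_comp measurable_set_CA measurable_pi_map)
  also have "\<dots> = distr (distr \<mu> \<mu> \<tau>) (seq_space UNIV) (pi_map \<kappa>)"
    by (rule distr_distr[OF measurable_pi_map CA.measurable_T, symmetric])
  finally show "distr (pi_measure \<mu> \<kappa>) (pi_measure \<mu> \<kappa>) (set_CA \<tau>) = pi_measure \<mu> \<kappa>"
    by (simp add: CA.distr_T pi_measure_def)
qed

end

theorem theorem6p4:
  fixes \<tau> :: "(nat \<Rightarrow> 'a::finite) \<Rightarrow> nat \<Rightarrow> 'a"
    and \<mu> :: "(nat \<Rightarrow> 'a) measure"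
    and \<kappa> :: "(nat \<Rightarrow> 'a) \<Rightarrow> (nat \<Rightarrow> 'a) measure"
  assumes "bipermutative_CA \<tau>"
    and "sets \<mu> = sets (seq_space UNIV)"
    and "measure_preserving_system \<mu> shift"
    and "measure_preserving_system \<mu> \<tau>"
    and "conditional_probability \<mu> (shift_preimage_algebra \<mu>) \<kappa>"
    and "mt_entropy (pi_measure \<mu> \<kappa>) shift = 0"
  shows
    "(\<exists>!\<mu>'. uniform_extension (pi_measure \<mu> \<kappa>) \<mu>') \<and>
     (\<forall>\<mu>'. uniform_extension (pi_measure \<mu> \<kappa>) \<mu>' \<longrightarrow>
        measure_preserving_system \<mu>' shift \<and>
        mt_isomorphism \<mu> shift \<mu>' shift (phi_map \<kappa>) \<and>
        (AE x in \<mu>. phi_map \<kappa> x \<in> space \<mu>') \<and>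
        (\<forall>B\<in>sets \<mu>'. emeasure \<mu> (phi_map \<kappa> -` B \<inter> space \<mu>) = emeasure \<mu>' B)) \<and>
     pinsker_factor \<mu> shift (pi_measure \<mu> \<kappa>) shift (pi_map \<kappa>) \<and>
     (AE x in \<mu>. pi_map \<kappa> (\<tau> x) = set_CA \<tau> (pi_map \<kappa> x)) \<and>
     measure_preserving_system (pi_measure \<mu> \<kappa>) (set_CA \<tau>) \<and>
     (jointly_ergodic \<mu> shift \<tau> \<longrightarrow>
        (\<exists>k. 1 \<le> k \<and> k \<le> card (UNIV :: 'a set) \<and>
             (AE A in pi_measure \<mu> \<kappa>. \<forall>i. card (A i) = k)))"
proof -
  obtain r where r: "\<And>x i. \<tau> x i = r (x i) (x (Suc i))" "\<And>a. bij (\<lambda>b. r b a)" "\<And>a. bij (\<lambda>b. r a b)"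
    using assms(1) unfolding bipermutative_CA_def by blast
  interpret stationary \<mu> shift using assms(3) by (simp add: stationary_iff)
  interpret CA: stationary \<mu> \<tau> using assms(4) by (simp add: stationary_iff)
  interpret ca_kernel \<mu> \<tau> r \<kappa> by unfold_locales (fact assms(2) r assms(5))+
  interpret ca_uniform_kernel \<mu> \<tau> r \<kappa> by unfold_locales (fact assms(6) AE_k_Lambda)+
  have unique: "\<mu>' = lift" if "uniform_extension (pi_measure \<mu> \<kappa>) \<mu>'" for \<mu>'
    by (rule uniform_extension_unique[OF that uniform_extension_lift])
  have card: "\<exists>k. 1 \<le> k \<and> k \<le> card (UNIV :: 'a set) \<and> (AE A in pi_measure \<mu> \<kappa>. \<forall>i. card (A i) = k)"
    if erg: "jointly_ergodic \<mu> shift \<tau>"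
  proof -
    obtain k where k: "1 \<le> k" "k \<le> card (UNIV :: 'a set)" "AE x in \<mu>. \<forall>i. card (pi_map \<kappa> x i) = k"
      by (rule AE_card_pi_map[OF erg])
    have [measurable]: "(\<lambda>z. z i) \<in> measurable (seq_space UNIV) (count_space (UNIV :: 'a set set))" for i
      by (rule measurable_seq_space_coord)
    have "AE A in pi_measure \<mu> \<kappa>. \<forall>i. card (A i) = k"
      unfolding pi_measure_def using k(3) by (subst AE_distr_iff) measurable
    with k(1,2) show ?thesis by blast
  qed
  have "AE x in \<mu>. phi_map \<kappa> x \<in> space lift"
    using AE_X by (simp add: space_lift phi_map_in_space)
  moreover have "\<forall>B\<in>sets lift. emeasure \<mu> (phi_map \<kappa> -` B \<inter> space \<mu>) = emeasure lift B"
    using vimage_phi_map(3) by simp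
  ultimately have "\<forall>\<mu>'. uniform_extension (pi_measure \<mu> \<kappa>) \<mu>' \<longrightarrow>
      measure_preserving_system \<mu>' shift \<and> mt_isomorphism \<mu> shift \<mu>' shift (phi_map \<kappa>) \<and>
      (AE x in \<mu>. phi_map \<kappa> x \<in> space \<mu>') \<and>
      (\<forall>B\<in>sets \<mu>'. emeasure \<mu> (phi_map \<kappa> -` B \<inter> space \<mu>) = emeasure \<mu>' B)"
    using unique measure_preserving_lift mt_isomorphism_lift by blast
  moreover have "\<exists>!\<mu>'. uniform_extension (pi_measure \<mu> \<kappa>) \<mu>'"
    using unique uniform_extension_lift by blast
  ultimately show ?thesis
    using pinsker_factor_pi_map AE_pi_map_\<tau> measure_preserving_set_CA card by blast
qed

end
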